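(* Let $P$ be an Ore semigroup with enveloping group $G$, let $\alpha$ be an action of $P$ by unital injective endomorphisms of a unital $C^*$-algebra $A$, and suppose that $V:G\to B(A)$ is an interaction group such that $V|_P=\alpha$ (i.e. $V_t=\alpha_t$ for all $t\in P$). Then $V$ has a minimal admissible dilation $(i,T)$, where $T=(B,\beta,F)$ and $i:A\to B$ is an embedding (injective), which has the following universal property: if $(i',(B',\beta',F'))$ is another admissible dilation of $V$, then there exists a unique morphism $\phi:(B,\beta,F)\to(B',\beta',F')$ such that $\phi i=i'$. Therefore the dilation $(i,T)$ is unique up to isomorphism in the class of minimal and admissible dilations of $V$.
   Context: Homomorphisms of $C^*$-algebras are $*$-homomorphisms; $B(A)$ is the algebra of bounded linear operators on $A$. Ore semigroup: a cancellative monoid $P$ with $Pr\cap Ps\neq\emptyset$ for all $r,s\in P$. Its enveloping group is the group $G$ (unique up to canonical isomorphism) containing $P$ with $G=P^{-1}P$. Interaction group: a map $V:G\to B(A)$, $A$ a unital $C^*$-algebra, such that (1) each $V_t$ is positive and unital; (2) $V$ is a partial representation, i.e. $V_e=\mathrm{Id}$, $V_{s^{-1}}V_sV_t=V_{s^{-1}}V_{st}$ and $V_sV_tV_{t^{-1}}=V_{st}V_{t^{-1}}$ for all $s,t\in G$; (3) $V_t(ab)=V_t(a)V_t(b)$ whenever $a$ or $b$ belongs to $V_{t^{-1}}(A)$. Category $\mathcal{T}_G$: objects are triples $(B,\beta,F)$, where $\beta$ is an action of the group $G$ on a unital $C^*$-algebra $B$ and $F:B\to B$ is a conditional expectation (a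 norm one idempotent whose range is a $C^*$-subalgebra of $B$). A morphism $(B,\beta,F)\to(B',\beta',F')$ is a unital homomorphism $\phi:B\to B'$ of $C^*$-algebras with $\phi F=F'\phi$ and $\phi\beta_t=\beta'_t\phi$ for all $t\in G$. $\mathcal{D}_G$ is the full subcategory of those $(B,\beta,F)$ such that $F\beta_tF(1)=F(1)$ for all $t\in G$ and $F_rF_s=F_sF_r$ for all $r,s\in G$, where $F_r=\beta_rF\beta_{r^{-1}}$. A dilation of $V$ is a pair $(i,T)$ with $T=(B,\beta,F)\in\mathcal{T}_G$ and $i:A\to B$ a homomorphism of $C^*$-algebras with $iV_t=F\beta_ti$ for all $t\in G$. It is minimal if $B=\overline{\mathrm{span}}\{\beta_t(i(a)):a\in A,t\in G\}$, and admissible if $T\in\mathcal{D}_G$. An isomorphism between dilations $(i,T)$ and $(i',T')$ is an isomorphism $\phi:T\to T'$ with $\phi i=i'$.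
   Formalization: A is nonzero; φ is claimed unital only when i' is unital (otherwise a unique equivariant homomorphism); uniqueness is only among minimal admissible dilations with i' injective or universal; universality is stated per carrier type, one (i,T) serving all up to isomorphism. *)

theory Defs
  imports "HOL-Analysis.Analysis" "HOL-Algebra.Module" "HOL-Algebra.Coset"
begin

text \<open>C*-algebras are rendered with explicit carriers, on top of the ring and module records of
  HOL-Algebra, so that the existence of an algebra can be asserted inside a formula.\<close>

definition complex_ring :: "complex ring" where
  "complex_ring = \<lparr>carrier = UNIV, mult = (*), one = 1, zero = 0, add = (+)\<rparr>"

record 'a star_normed = "(complex, 'a) module" +
  star :: "'a \<Rightarrow> 'a"
  nrm :: "'a \<Rightarrow> real"

text \<open>The locale \<open>Metric_space\<close> asks for symmetry and nonnegativity on the whole type, hence the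
  junk value 0 outside the carrier.\<close>

definition ndist :: "'a star_normed \<Rightarrow> 'a \<Rightarrow> 'a \<Rightarrow> real" where
  "ndist A x y = (if x \<in> carrier A \<and> y \<in> carrier A then nrm A (x \<ominus>\<^bsub>A\<^esub> y) else 0)"

definition norm_topology :: "'a star_normed \<Rightarrow> 'a topology" where
  "norm_topology A = Metric_space.mtopology (carrier A) (ndist A)"

locale pre_cstar_algebra = Module.module complex_ring A + Ring.ring A
  for A :: "'a star_normed" (structure) +
  assumes smult_mult_left: "\<lbrakk>x \<in> carrier A; y \<in> carrier A\<rbrakk> \<Longrightarrow> (c \<odot> x) \<otimes> y = c \<odot> (x \<otimes> y)"
    and smult_mult_right: "\<lbrakk>x \<in> carrier A; y \<in> carrier A\<rbrakk> \<Longrightarrow> x \<otimes> (c \<odot> y) = c \<odot> (x \<otimes> y)"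
    and star_closed: "x \<in> carrier A \<Longrightarrow> star A x \<in> carrier A"
    and star_star: "x \<in> carrier A \<Longrightarrow> star A (star A x) = x"
    and star_add: "\<lbrakk>x \<in> carrier A; y \<in> carrier A\<rbrakk> \<Longrightarrow> star A (x \<oplus> y) = star A x \<oplus> star A y"
    and star_smult: "x \<in> carrier A \<Longrightarrow> star A (c \<odot> x) = cnj c \<odot> star A x"
    and star_mult: "\<lbrakk>x \<in> carrier A; y \<in> carrier A\<rbrakk> \<Longrightarrow> star A (x \<otimes> y) = star A y \<otimes> star A x"
    and nrm_nonneg: "x \<in> carrier A \<Longrightarrow> 0 \<le> nrm A x"
    and nrm_eq_0: "x \<in> carrier A \<Longrightarrow> nrm A x = 0 \<longleftrightarrow> x = \<zero>"
    and nrm_triangle: "\<lbrakk>x \<in> carrier A; y \<in> carrier A\<rbrakk> \<Longrightarrow> nrm A (x \<oplus> y) \<le> nrm A x + nrm A y"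
    and nrm_smult: "x \<in> carrier A \<Longrightarrow> nrm A (c \<odot> x) = cmod c * nrm A x"
    and nrm_mult: "\<lbrakk>x \<in> carrier A; y \<in> carrier A\<rbrakk> \<Longrightarrow> nrm A (x \<otimes> y) \<le> nrm A x * nrm A y"
    and cstar_identity: "x \<in> carrier A \<Longrightarrow> nrm A (star A x \<otimes> x) = (nrm A x)\<^sup>2"

lemma (in pre_cstar_algebra) Metric_space_ndist: "Metric_space (carrier A) (ndist A)"
proof
  have neg: "nrm A (\<ominus> x) = nrm A x" if "x \<in> carrier A" for x
  proof -
    have "(-1) \<odot> x \<oplus> x = (-1) \<odot> x \<oplus> 1 \<odot> x"
      using that smult_one by (simp add: complex_ring_def)
    also have "\<dots> = (-1 + 1) \<odot> x"
      using smult_l_distr[of "-1" 1 x] that by (simp add: complex_ring_def)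
    also have "\<dots> = \<zero>"
      using that nrm_smult[of x 0] nrm_eq_0[of "0 \<odot> x"] smult_closed[of 0 x]
      by (simp add: complex_ring_def)
    finally have "\<ominus> x = (-1) \<odot> x"
      using that smult_closed[of "-1" x] minus_equality by (simp add: complex_ring_def)
    then show ?thesis
      using nrm_smult[OF that, of "-1"] by simp
  qed
  fix x y
  show "0 \<le> ndist A x y"
    by (simp add: ndist_def nrm_nonneg)
  show "ndist A x y = ndist A y x"
  proof (cases "x \<in> carrier A \<and> y \<in> carrier A")
    case True
    then have "\<ominus> (x \<ominus> y) = y \<ominus> x"
      by (simp add: minus_eq minus_add a_comm)
    then show ?thesis
      using True neg[of "x \<ominus> y"] by (simp add: ndist_def)
  qed (auto simp: ndist_def)
  show "ndist A x y = 0 \<longleftrightarrow> x = y" if "x \<in> carrier A" "y \<in> carrier A"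
  proof -
    have "x \<ominus> y = \<zero> \<longleftrightarrow> x = y"
      using that minus_equality[of x "\<ominus> y"] by (auto simp: minus_eq r_neg)
    then show ?thesis
      using that nrm_eq_0[of "x \<ominus> y"] by (simp add: ndist_def)
  qed
  fix z
  assume xyz: "x \<in> carrier A" "y \<in> carrier A" "z \<in> carrier A"
  have "x \<ominus> z = (x \<ominus> y) \<oplus> (y \<ominus> z)"
    using xyz by (simp add: minus_eq a_assoc r_neg1 r_neg2)
  then show "ndist A x z \<le> ndist A x y + ndist A y z"
    using xyz nrm_triangle[of "x \<ominus> y" "y \<ominus> z"] by (simp add: ndist_def)
qed

text \<open>Unital C*-algebras are nonzero here; a norm one idempotent exists only on a nonzero algebra.\<close>

locale unital_cstar_algebra = pre_cstar_algebra +
  assumes one_not_zero: "\<one> \<noteq> \<zero>"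
    and complete: "Metric_space.mcomplete (carrier A) (ndist A)"

definition linear_map :: "'a star_normed \<Rightarrow> 'b star_normed \<Rightarrow> ('a \<Rightarrow> 'b) \<Rightarrow> bool" where
  "linear_map A B f \<longleftrightarrow> f \<in> carrier A \<rightarrow> carrier B \<and>
     (\<forall>x\<in>carrier A. \<forall>y\<in>carrier A. f (x \<oplus>\<^bsub>A\<^esub> y) = f x \<oplus>\<^bsub>B\<^esub> f y) \<and>
     (\<forall>c. \<forall>x\<in>carrier A. f (c \<odot>\<^bsub>A\<^esub> x) = c \<odot>\<^bsub>B\<^esub> f x)"

text \<open>Not necessarily unital.\<close>

definition star_hom :: "'a star_normed \<Rightarrow> 'b star_normed \<Rightarrow> ('a \<Rightarrow> 'b) \<Rightarrow> bool" where
  "star_hom A B f \<longleftrightarrow> linear_map A B f \<and>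
     (\<forall>x\<in>carrier A. \<forall>y\<in>carrier A. f (x \<otimes>\<^bsub>A\<^esub> y) = f x \<otimes>\<^bsub>B\<^esub> f y) \<and>
     (\<forall>x\<in>carrier A. f (star A x) = star B (f x))"

definition bounded_operator :: "'a star_normed \<Rightarrow> ('a \<Rightarrow> 'a) \<Rightarrow> bool" where
  "bounded_operator A f \<longleftrightarrow> linear_map A A f \<and> (\<exists>K. \<forall>x\<in>carrier A. nrm A (f x) \<le> K * nrm A x)"

definition operator_norm :: "'a star_normed \<Rightarrow> ('a \<Rightarrow> 'a) \<Rightarrow> real" where
  "operator_norm A f = Sup {nrm A (f x) |x. x \<in> carrier A \<and> nrm A x \<le> 1}"

definition positive_elements :: "'a star_normed \<Rightarrow> 'a set" where
  "positive_elements A = {star A x \<otimes>\<^bsub>A\<^esub> x |x. x \<in> carrier A}"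

definition cstar_subalgebra :: "'a star_normed \<Rightarrow> 'a set \<Rightarrow> bool" where
  "cstar_subalgebra A S \<longleftrightarrow> submodule S complex_ring A \<and>
     (\<forall>x\<in>S. \<forall>y\<in>S. x \<otimes>\<^bsub>A\<^esub> y \<in> S) \<and> (\<forall>x\<in>S. star A x \<in> S) \<and> closedin (norm_topology A) S"

definition linear_span :: "'a star_normed \<Rightarrow> 'a set \<Rightarrow> 'a set" where
  "linear_span A S = \<Inter>{N. submodule N complex_ring A \<and> S \<subseteq> N}"

definition conditional_expectation :: "'a star_normed \<Rightarrow> ('a \<Rightarrow> 'a) \<Rightarrow> bool" where
  "conditional_expectation A F \<longleftrightarrow> bounded_operator A F \<and> operator_norm A F = 1 \<and>
     (\<forall>x\<in>carrier A. F (F x) = F x) \<and> cstar_subalgebra A (F ` carrier A)"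

definition ore_semigroup :: "('g, 'm) monoid_scheme \<Rightarrow> bool" where
  "ore_semigroup P \<longleftrightarrow> Group.monoid P \<and>
     (\<forall>x\<in>carrier P. \<forall>y\<in>carrier P. \<forall>z\<in>carrier P. x \<otimes>\<^bsub>P\<^esub> y = x \<otimes>\<^bsub>P\<^esub> z \<longrightarrow> y = z) \<and>
     (\<forall>x\<in>carrier P. \<forall>y\<in>carrier P. \<forall>z\<in>carrier P. y \<otimes>\<^bsub>P\<^esub> x = z \<otimes>\<^bsub>P\<^esub> x \<longrightarrow> y = z) \<and>
     (\<forall>r\<in>carrier P. \<forall>s\<in>carrier P. (carrier P #>\<^bsub>P\<^esub> r) \<inter> (carrier P #>\<^bsub>P\<^esub> s) \<noteq> {})"

text \<open>\<open>P\<close> is an Ore semigroup, realised inside its enveloping group \<open>G = P\<^sup>-\<^sup>1P\<close>.\<close>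

definition ore_in_enveloping_group :: "'g set \<Rightarrow> 'g monoid \<Rightarrow> bool" where
  "ore_in_enveloping_group P G \<longleftrightarrow> Group.group G \<and> submonoid P G \<and>
     ore_semigroup (G\<lparr>carrier := P\<rparr>) \<and> carrier G = (set_inv\<^bsub>G\<^esub> P) <#>\<^bsub>G\<^esub> P"

definition unital_injective_semigroup_action ::
    "'g monoid \<Rightarrow> 'g set \<Rightarrow> 'a star_normed \<Rightarrow> ('g \<Rightarrow> 'a \<Rightarrow> 'a) \<Rightarrow> bool" where
  "unital_injective_semigroup_action G P A \<alpha> \<longleftrightarrow>
     (\<forall>p\<in>P. star_hom A A (\<alpha> p) \<and> \<alpha> p \<one>\<^bsub>A\<^esub> = \<one>\<^bsub>A\<^esub> \<and> inj_on (\<alpha> p) (carrier A)) \<and>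
     (\<forall>x\<in>carrier A. \<alpha> \<one>\<^bsub>G\<^esub> x = x) \<and>
     (\<forall>p\<in>P. \<forall>q\<in>P. \<forall>x\<in>carrier A. \<alpha> (p \<otimes>\<^bsub>G\<^esub> q) x = \<alpha> p (\<alpha> q x))"

definition cstar_group_action ::
    "'g monoid \<Rightarrow> 'b star_normed \<Rightarrow> ('g \<Rightarrow> 'b \<Rightarrow> 'b) \<Rightarrow> bool" where
  "cstar_group_action G B \<beta> \<longleftrightarrow>
     (\<forall>t\<in>carrier G. star_hom B B (\<beta> t) \<and> bij_betw (\<beta> t) (carrier B) (carrier B)) \<and>
     (\<forall>x\<in>carrier B. \<beta> \<one>\<^bsub>G\<^esub> x = x) \<and>
     (\<forall>s\<in>carrier G. \<forall>t\<in>carrier G. \<forall>x\<in>carrier B. \<beta> (s \<otimes>\<^bsub>G\<^esub> t) x = \<beta> s (\<beta> t x))"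

definition interaction_group ::
    "'g monoid \<Rightarrow> 'a star_normed \<Rightarrow> ('g \<Rightarrow> 'a \<Rightarrow> 'a) \<Rightarrow> bool" where
  "interaction_group G A V \<longleftrightarrow>
     (\<forall>t\<in>carrier G. bounded_operator A (V t) \<and>
        V t ` positive_elements A \<subseteq> positive_elements A \<and> V t \<one>\<^bsub>A\<^esub> = \<one>\<^bsub>A\<^esub>) \<and>
     (\<forall>a\<in>carrier A. V \<one>\<^bsub>G\<^esub> a = a) \<and>
     (\<forall>s\<in>carrier G. \<forall>t\<in>carrier G. \<forall>a\<in>carrier A.
        V (inv\<^bsub>G\<^esub> s) (V s (V t a)) = V (inv\<^bsub>G\<^esub> s) (V (s \<otimes>\<^bsub>G\<^esub> t) a) \<and>
        V s (V t (V (inv\<^bsub>G\<^esub> t) a)) = V (s \<otimes>\<^bsub>G\<^esub> t) (V (inv\<^bsub>G\<^esub> t) a)) \<and>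
     (\<forall>t\<in>carrier G. \<forall>a\<in>carrier A. \<forall>b\<in>carrier A.
        a \<in> V (inv\<^bsub>G\<^esub> t) ` carrier A \<or> b \<in> V (inv\<^bsub>G\<^esub> t) ` carrier A \<longrightarrow>
        V t (a \<otimes>\<^bsub>A\<^esub> b) = V t a \<otimes>\<^bsub>A\<^esub> V t b)"

text \<open>A triple \<open>(B, \<beta>, F)\<close>.\<close>

type_synonym ('g, 'b) system = "'b star_normed \<times> ('g \<Rightarrow> 'b \<Rightarrow> 'b) \<times> ('b \<Rightarrow> 'b)"

fun TG_object :: "'g monoid \<Rightarrow> ('g, 'b) system \<Rightarrow> bool" where
  "TG_object G (B, \<beta>, F) \<longleftrightarrow>
     unital_cstar_algebra B \<and> cstar_group_action G B \<beta> \<and> conditional_expectation B F"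

fun DG_object :: "'g monoid \<Rightarrow> ('g, 'b) system \<Rightarrow> bool" where
  "DG_object G (B, \<beta>, F) \<longleftrightarrow> TG_object G (B, \<beta>, F) \<and>
     (\<forall>t\<in>carrier G. F (\<beta> t (F \<one>\<^bsub>B\<^esub>)) = F \<one>\<^bsub>B\<^esub>) \<and>
     (\<forall>r\<in>carrier G. \<forall>s\<in>carrier G. \<forall>x\<in>carrier B.
        let F' = (\<lambda>r y. \<beta> r (F (\<beta> (inv\<^bsub>G\<^esub> r) y))) in F' r (F' s x) = F' s (F' r x))"

fun equivariant_hom ::
    "'g monoid \<Rightarrow> ('g, 'b) system \<Rightarrow> ('g, 'c) system \<Rightarrow> ('b \<Rightarrow> 'c) \<Rightarrow> bool" where
  "equivariant_hom G (B, \<beta>, F) (B', \<beta>', F') \<phi> \<longleftrightarrow> star_hom B B' \<phi> \<and>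
     (\<forall>x\<in>carrier B. \<phi> (F x) = F' (\<phi> x)) \<and>
     (\<forall>t\<in>carrier G. \<forall>x\<in>carrier B. \<phi> (\<beta> t x) = \<beta>' t (\<phi> x))"

definition TG_morphism ::
    "'g monoid \<Rightarrow> ('g, 'b) system \<Rightarrow> ('g, 'c) system \<Rightarrow> ('b \<Rightarrow> 'c) \<Rightarrow> bool" where
  "TG_morphism G T T' \<phi> \<longleftrightarrow> equivariant_hom G T T' \<phi> \<and> \<phi> \<one>\<^bsub>fst T\<^esub> = \<one>\<^bsub>fst T'\<^esub>"

definition TG_isomorphism ::
    "'g monoid \<Rightarrow> ('g, 'b) system \<Rightarrow> ('g, 'c) system \<Rightarrow> ('b \<Rightarrow> 'c) \<Rightarrow> bool" where
  "TG_isomorphism G T T' \<phi> \<longleftrightarrow> TG_morphism G T T' \<phi> \<and>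
     (\<exists>\<psi>. TG_morphism G T' T \<psi> \<and>
        (\<forall>x\<in>carrier (fst T). \<psi> (\<phi> x) = x) \<and> (\<forall>y\<in>carrier (fst T'). \<phi> (\<psi> y) = y))"

fun dilation ::
    "'g monoid \<Rightarrow> 'a star_normed \<Rightarrow> ('g \<Rightarrow> 'a \<Rightarrow> 'a) \<Rightarrow> ('a \<Rightarrow> 'b) \<Rightarrow> ('g, 'b) system \<Rightarrow> bool" where
  "dilation G A V i (B, \<beta>, F) \<longleftrightarrow> TG_object G (B, \<beta>, F) \<and> star_hom A B i \<and>
     (\<forall>t\<in>carrier G. \<forall>a\<in>carrier A. i (V t a) = F (\<beta> t (i a)))"

fun minimal_dilation ::
    "'g monoid \<Rightarrow> 'a star_normed \<Rightarrow> ('g \<Rightarrow> 'a \<Rightarrow> 'a) \<Rightarrow> ('a \<Rightarrow> 'b) \<Rightarrow> ('g, 'b) system \<Rightarrow> bool" where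
  "minimal_dilation G A V i (B, \<beta>, F) \<longleftrightarrow> dilation G A V i (B, \<beta>, F) \<and>
     carrier B = norm_topology B closure_of
       linear_span B {\<beta> t (i a) |t a. t \<in> carrier G \<and> a \<in> carrier A}"

definition admissible_dilation ::
    "'g monoid \<Rightarrow> 'a star_normed \<Rightarrow> ('g \<Rightarrow> 'a \<Rightarrow> 'a) \<Rightarrow> ('a \<Rightarrow> 'b) \<Rightarrow> ('g, 'b) system \<Rightarrow> bool" where
  "admissible_dilation G A V i T \<longleftrightarrow> dilation G A V i T \<and> DG_object G T"

definition isomorphic_dilations ::
    "'g monoid \<Rightarrow> 'a star_normed \<Rightarrow> ('a \<Rightarrow> 'b) \<Rightarrow> ('g, 'b) system \<Rightarrow>
     ('a \<Rightarrow> 'c) \<Rightarrow> ('g, 'c) system \<Rightarrow> bool" where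
  "isomorphic_dilations G A i T i' T' \<longleftrightarrow>
     (\<exists>\<phi>. TG_isomorphism G T T' \<phi> \<and> (\<forall>a\<in>carrier A. \<phi> (i a) = i' a))"

text \<open>Universality of \<open>(i, T)\<close> among the admissible dilations whose algebras live on the type
  \<open>'c\<close>. In a dilation \<open>(i', T')\<close> the homomorphism \<open>i'\<close> need not be unital, whereas morphisms are.
  If \<open>i\<close> is unital, a morphism \<open>\<phi>\<close> with \<open>\<phi> i = i'\<close> can exist only for unital \<open>i'\<close>; for arbitrary
  \<open>i'\<close> the factorisation is through a homomorphism satisfying all requirements on a morphism
  except unitality. Maps are fixed outside the carrier by \<open>extensional\<close>.\<close>

definition universal_dilation ::
    "'c itself \<Rightarrow> 'g monoid \<Rightarrow> 'a star_normed \<Rightarrow> ('g \<Rightarrow> 'a \<Rightarrow> 'a) \<Rightarrow>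
     ('a \<Rightarrow> 'b) \<Rightarrow> ('g, 'b) system \<Rightarrow> bool" where
  "universal_dilation TYPE('c) G A V i T \<longleftrightarrow>
     (\<forall>i' (T' :: ('g, 'c) system). admissible_dilation G A V i' T' \<longrightarrow>
        (\<exists>!\<phi>. \<phi> \<in> extensional (carrier (fst T)) \<and> equivariant_hom G T T' \<phi> \<and>
              (\<forall>a\<in>carrier A. \<phi> (i a) = i' a)) \<and>
        (i' \<one>\<^bsub>A\<^esub> = \<one>\<^bsub>fst T'\<^esub> \<longrightarrow>
          (\<exists>!\<phi>. \<phi> \<in> extensional (carrier (fst T)) \<and> TG_morphism G T T' \<phi> \<and>
              (\<forall>a\<in>carrier A. \<phi> (i a) = i' a))))"

text \<open>\<open>(i, T)\<close> is isomorphic to every minimal admissible dilation \<open>(i', T')\<close> on the type \<open>'c\<close> that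
  shares its other properties: \<open>i'\<close> is injective, or \<open>(i', T')\<close> is universal among the admissible
  dilations on the type \<open>'b\<close> of \<open>(i, T)\<close>. Without any such requirement uniqueness fails:
  a dilation of \<open>V\<close> may have a kernel, e.g. a coordinate projection \<open>\<complex>\<^sup>2 \<rightarrow> \<complex>\<close> when everything
  else is trivial.\<close>

definition unique_minimal_admissible_dilation ::
    "'c itself \<Rightarrow> 'g monoid \<Rightarrow> 'a star_normed \<Rightarrow> ('g \<Rightarrow> 'a \<Rightarrow> 'a) \<Rightarrow>
     ('a \<Rightarrow> 'b) \<Rightarrow> ('g, 'b) system \<Rightarrow> bool" where
  "unique_minimal_admissible_dilation TYPE('c) G A V i T \<longleftrightarrow>
     (\<forall>i' (T' :: ('g, 'c) system).
        minimal_dilation G A V i' T' \<and> admissible_dilation G A V i' T' \<and>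
        (inj_on i' (carrier A) \<or> universal_dilation TYPE('b) G A V i' T') \<longrightarrow>
        isomorphic_dilations G A i T i' T')"

end

theory Submission
  imports Defs
begin

text \<open>The algebra \<open>B\<close> is the direct limit of copies of \<open>A\<close> along \<open>\<alpha>\<close>, realised as Cauchy nets
  \<open>f : P \<rightarrow> A\<close> modulo null nets, where \<open>P\<close> is directed by left multiplication: the net \<open>f\<close> stands
  for the limit of \<open>\<beta>\<^bsub>p\<^esub>\<^sup>-\<^sup>1 (i (f p))\<close>. The group acts by right translation of nets, \<open>i a\<close> is the net
  \<open>p \<mapsto> V\<^bsub>p\<^esub> a\<close>, and \<open>F\<close> maps \<open>f\<close> to \<open>i\<close> of the limit of \<open>V\<^bsub>q\<^esub> (f p)\<close> with \<open>q\<close> the inverse of \<open>p\<close>,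
  which exists because \<open>V\<^bsub>q\<^esub>\<close> is a positive unital left inverse of \<open>\<alpha>\<^bsub>p\<^esub>\<close> and hence contractive. In any
  admissible dilation the commutation of the conditional expectations forces \<open>\<beta>'\<^bsub>p\<^esub> i' = i' \<alpha>\<^bsub>p\<^esub>\<close> for
  \<open>p\<close> in \<open>P\<close>, so \<open>f \<mapsto> lim \<beta>'\<^bsub>p\<^esub>\<^sup>-\<^sup>1 (i' (f p))\<close> is the required morphism; it is isometric if \<open>i'\<close> is
  injective. The needed C*-theory rests on one device: if \<open>h\<close> and \<open>s\<close> are commuting self-adjoint
  elements with \<open>h\<^sup>2 + s\<^sup>2 = 1\<close>, then \<open>h\<close> is the real part of a unitary and so has norm at most 1.\<close>

section \<open>C*-algebras: norm limits and square roots\<close>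

text \<open>The existence claim fixes the type of the algebra in advance, so the direct limit and
  its completion are built in one go, on sets of functions from \<open>'g\<close> to
  \<open>'a\<close>. Two analytic facts carry the proof. Contractivity of V at p^-1 makes F well
  defined and contractive. The axioms give only boundedness and positivity of V_t, where positive
  elements are those of the form x* x, so it must be known that these are squares of self-adjoint
  elements. Isometry of injective homomorphisms makes each V_p isometric, so that norms converge
  along a Cauchy net, and makes the comparison of two dilations isometric, which gives uniqueness.
  For admissibility of the constructed dilation the conjugates F_r must commute, although they are
  defined by limits. On the dense set of elements \<beta>(w^-1)(i a) with w, wr and ws in P, the
  maps F_r and F_s act on a as V_g V_(g^-1) with g = wr and g = ws, and such products commute in
  every partial representation.\<close>

context pre_cstar_algebra
begin

section \<open>Scalars, involution and norm\<close>

lemma smult_in [simp, intro]: "x \<in> carrier A \<Longrightarrow> c \<odot> x \<in> carrier A"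
  using smult_closed by (simp add: complex_ring_def)

lemma smult_add_left: "x \<in> carrier A \<Longrightarrow> (c + d) \<odot> x = c \<odot> x \<oplus> d \<odot> x"
  using smult_l_distr[of c d x] by (simp add: complex_ring_def)

lemma smult_add_right: "\<lbrakk>x \<in> carrier A; y \<in> carrier A\<rbrakk> \<Longrightarrow> c \<odot> (x \<oplus> y) = c \<odot> x \<oplus> c \<odot> y"
  using smult_r_distr[of c x y] by (simp add: complex_ring_def)

lemma smult_smult: "x \<in> carrier A \<Longrightarrow> c \<odot> (d \<odot> x) = (c * d) \<odot> x"
  using smult_assoc1[of c d x] by (simp add: complex_ring_def)

lemma smult_1 [simp]: "x \<in> carrier A \<Longrightarrow> 1 \<odot> x = x"
  using smult_one[of x] by (simp add: complex_ring_def)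

lemma smult_0 [simp]: "x \<in> carrier A \<Longrightarrow> 0 \<odot> x = \<zero>"
  using smult_l_null[of x] by (simp add: complex_ring_def)

lemma smult_zero [simp]: "c \<odot> \<zero> = \<zero>"
  using smult_r_null[of c] by (simp add: complex_ring_def)

lemma uminus_smult: "x \<in> carrier A \<Longrightarrow> \<ominus> x = (-1) \<odot> x"
  by (metis add.inv_equality add.left_inverse smult_0 smult_1 smult_add_left smult_in)

lemma minus_smult: "\<lbrakk>x \<in> carrier A; y \<in> carrier A\<rbrakk> \<Longrightarrow> x \<ominus> y = x \<oplus> (-1) \<odot> y"
  by (simp add: minus_eq uminus_smult)

lemma minus_in [simp, intro]: "\<lbrakk>x \<in> carrier A; y \<in> carrier A\<rbrakk> \<Longrightarrow> x \<ominus> y \<in> carrier A"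
  by (rule minus_closed)

text \<open>Simplification turns \<open>1 \<odot> x\<close> into \<open>x\<close>, so the collection
  rules need a variant for every place where a coefficient 1 is invisible. Together with
  \<open>expand\<close> they carry the polynomial identities below.\<close>

lemma smult_collect_pair:
  assumes "x \<in> carrier A"
  shows "c \<odot> x \<oplus> d \<odot> x = (c + d) \<odot> x" "x \<oplus> d \<odot> x = (1 + d) \<odot> x" "c \<odot> x \<oplus> x = (c + 1) \<odot> x"
    "x \<oplus> x = 2 \<odot> x"
proof -
  show 1: "c \<odot> x \<oplus> d \<odot> x = (c + d) \<odot> x" for c d
    using assms by (simp add: smult_add_left)
  show "x \<oplus> d \<odot> x = (1 + d) \<odot> x" "c \<odot> x \<oplus> x = (c + 1) \<odot> x" "x \<oplus> x = 2 \<odot> x"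
    using 1[of 1 d] 1[of c 1] 1[of 1 1] assms by simp_all
qed

lemma smult_collect_sum:
  assumes "x \<in> carrier A" "y \<in> carrier A"
  shows "c \<odot> x \<oplus> (d \<odot> x \<oplus> y) = (c + d) \<odot> x \<oplus> y" "x \<oplus> (d \<odot> x \<oplus> y) = (1 + d) \<odot> x \<oplus> y"
    "c \<odot> x \<oplus> (x \<oplus> y) = (c + 1) \<odot> x \<oplus> y" "x \<oplus> (x \<oplus> y) = 2 \<odot> x \<oplus> y"
  using assms by (simp_all only: a_assoc[symmetric] smult_in smult_collect_pair)

lemmas smult_collect = smult_collect_pair smult_collect_sum

lemma add_interchange:
  "\<lbrakk>a \<in> carrier A; b \<in> carrier A; c \<in> carrier A; d \<in> carrier A\<rbrakk> \<Longrightarrow> (a \<oplus> b) \<oplus> (c \<oplus> d) = (a \<oplus> c) \<oplus> (b \<oplus> d)"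
  by (simp add: a_ac)

text \<open>AC sorting orders summands by the term order, which need not bring multiples of one
  monomial together. In the two long computations on positive elements this rule aligns them by
  position.\<close>

lemma add_interchange4:
  assumes "a \<in> carrier A" "b \<in> carrier A" "c \<in> carrier A" "d \<in> carrier A"
    "a' \<in> carrier A" "b' \<in> carrier A" "c' \<in> carrier A" "d' \<in> carrier A"
  shows "(a \<oplus> (b \<oplus> (c \<oplus> d))) \<oplus> (a' \<oplus> (b' \<oplus> (c' \<oplus> d'))) = (a \<oplus> a') \<oplus> ((b \<oplus> b') \<oplus> ((c \<oplus> c') \<oplus> (d \<oplus> d')))"
  using assms by (simp only: add_interchange[of a] add_interchange[of b] add_interchange[of c] a_closed)

lemmas expand = minus_smult smult_add_right smult_smult smult_mult_left smult_mult_right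
  l_distr r_distr m_assoc a_assoc

lemmas star_in [simp, intro] = star_closed
lemmas star_invol [simp] = star_star

lemma star_one [simp]: "star A \<one> = \<one>"
proof -
  have "star A \<one> = star A \<one> \<otimes> star A (star A \<one>)"
    by simp
  also have "\<dots> = star A (star A \<one> \<otimes> \<one>)"
    by (subst star_mult) auto
  also have "\<dots> = \<one>"
    by simp
  finally show ?thesis .
qed

lemma star_zero [simp]: "star A \<zero> = \<zero>"
  using star_smult[of \<one> 0] by simp

lemma star_minus: "\<lbrakk>x \<in> carrier A; y \<in> carrier A\<rbrakk> \<Longrightarrow> star A (x \<ominus> y) = star A x \<ominus> star A y"
  by (simp add: minus_smult star_add star_smult)

lemma nrm_zero [simp]: "nrm A \<zero> = 0"
  by (simp add: nrm_eq_0)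

text \<open>The C*-identity and submultiplicativity bound the squared norm of y by the product of
  the norms of y* and y. Cancelling gives one inequality; replacing y by y* gives the other.\<close>

lemma nrm_star [simp]:
  assumes "x \<in> carrier A" shows "nrm A (star A x) = nrm A x"
proof -
  have le: "nrm A y \<le> nrm A (star A y)" if y: "y \<in> carrier A" for y
  proof (cases "nrm A y = 0")
    case False
    have "nrm A y * nrm A y \<le> nrm A (star A y) * nrm A y"
      using cstar_identity[OF y] nrm_mult[of "star A y" y] y by (simp add: power2_eq_square)
    then show ?thesis
      using False nrm_nonneg[OF y] by simp
  qed (use y nrm_nonneg in auto)
  show ?thesis
    using le[OF assms] le[of "star A x"] assms by simp
qed

lemma nrm_minus_commute: "\<lbrakk>x \<in> carrier A; y \<in> carrier A\<rbrakk> \<Longrightarrow> nrm A (x \<ominus> y) = nrm A (y \<ominus> x)"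
proof -
  assume x: "x \<in> carrier A" and y: "y \<in> carrier A"
  have "x \<ominus> y = (-1) \<odot> (y \<ominus> x)"
    using x y by (simp add: expand a_comm)
  then show ?thesis
    using x y by (simp add: nrm_smult)
qed

lemma minus_split: "\<lbrakk>x \<in> carrier A; y \<in> carrier A; z \<in> carrier A\<rbrakk> \<Longrightarrow> x \<ominus> z = (x \<ominus> y) \<oplus> (y \<ominus> z)"
  by (simp add: minus_eq a_assoc r_neg1 r_neg2)

lemma nrm_minus_triangle:
  "\<lbrakk>x \<in> carrier A; y \<in> carrier A; z \<in> carrier A\<rbrakk> \<Longrightarrow> nrm A (x \<ominus> z) \<le> nrm A (x \<ominus> y) + nrm A (y \<ominus> z)"
  using nrm_triangle[of "x \<ominus> y" "y \<ominus> z"] minus_split[of x y z] by simp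

lemma nrm_diff_le: "\<lbrakk>x \<in> carrier A; y \<in> carrier A\<rbrakk> \<Longrightarrow> \<bar>nrm A x - nrm A y\<bar> \<le> nrm A (x \<ominus> y)"
proof -
  have *: "nrm A x \<le> nrm A (x \<ominus> y) + nrm A y" if "x \<in> carrier A" "y \<in> carrier A" for x y
    using nrm_minus_triangle[of x y \<zero>] that by (simp add: minus_smult)
  assume "x \<in> carrier A" "y \<in> carrier A"
  then show ?thesis
    using *[of x y] *[of y x] nrm_minus_commute[of x y] by (simp add: abs_le_iff)
qed

lemma minus_eq_zero_iff: "\<lbrakk>x \<in> carrier A; y \<in> carrier A\<rbrakk> \<Longrightarrow> x \<ominus> y = \<zero> \<longleftrightarrow> x = y"
  using minus_equality[of x "\<ominus> y"] by (auto simp: minus_eq r_neg)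

lemma nrm_minus_eq_0: "\<lbrakk>x \<in> carrier A; y \<in> carrier A\<rbrakk> \<Longrightarrow> nrm A (x \<ominus> y) = 0 \<longleftrightarrow> x = y"
  by (simp add: nrm_eq_0 minus_eq_zero_iff)

text \<open>An arbitrary filter is allowed because limits are taken both along sequences and along
  the directed semigroup. Membership is required only eventually: terms such as
  \<open>V (ginv p) (f p)\<close> are controlled only for \<open>p\<close> in
  \<open>P\<close>.\<close>

definition conv :: "('i \<Rightarrow> 'a) \<Rightarrow> 'a \<Rightarrow> 'i filter \<Rightarrow> bool" where
  "conv f x F \<longleftrightarrow> x \<in> carrier A \<and> (\<forall>\<^sub>F i in F. f i \<in> carrier A) \<and> ((\<lambda>i. nrm A (f i \<ominus> x)) \<longlongrightarrow> 0) F"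

lemma conv_in: "conv f x F \<Longrightarrow> x \<in> carrier A"
  by (simp add: conv_def)

lemma conv_bound:
  assumes "x \<in> carrier A" "\<forall>\<^sub>F i in F. f i \<in> carrier A" "\<forall>\<^sub>F i in F. nrm A (f i \<ominus> x) \<le> g i" "(g \<longlongrightarrow> 0) F"
  shows "conv f x F"
  unfolding conv_def
proof (intro conjI)
  show "((\<lambda>i. nrm A (f i \<ominus> x)) \<longlongrightarrow> 0) F"
  proof (rule tendsto_sandwich[OF _ assms(3) tendsto_const assms(4)])
    show "\<forall>\<^sub>F i in F. 0 \<le> nrm A (f i \<ominus> x)"
      using assms(2) by eventually_elim (use assms(1) nrm_nonneg in auto)
  qed
qed fact+

lemma conv_const: "x \<in> carrier A \<Longrightarrow> conv (\<lambda>i. x) x F"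
  by (simp add: conv_def minus_eq r_neg)

lemma conv_cong:
  assumes "conv f x F" "\<forall>\<^sub>F i in F. f i = g i" shows "conv g x F"
proof (rule conv_bound)
  show "x \<in> carrier A" "((\<lambda>i. nrm A (f i \<ominus> x)) \<longlongrightarrow> 0) F"
    using assms(1) by (auto simp: conv_def)
  show "\<forall>\<^sub>F i in F. g i \<in> carrier A"
    using assms by (auto simp: conv_def elim: eventually_elim2)
  show "\<forall>\<^sub>F i in F. nrm A (g i \<ominus> x) \<le> nrm A (f i \<ominus> x)"
    using assms(2) by eventually_elim simp
qed

lemma conv_add:
  assumes f: "conv f x F" and g: "conv g y F"
  shows "conv (\<lambda>i. f i \<oplus> g i) (x \<oplus> y) F"
proof (rule conv_bound)
  note [simp] = conv_in[OF f] conv_in[OF g]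
  have ev: "\<forall>\<^sub>F i in F. f i \<in> carrier A \<and> g i \<in> carrier A"
    using f g by (simp add: conv_def eventually_conj)
  then show "\<forall>\<^sub>F i in F. f i \<oplus> g i \<in> carrier A"
    by eventually_elim auto
  show "\<forall>\<^sub>F i in F. nrm A (f i \<oplus> g i \<ominus> (x \<oplus> y)) \<le> nrm A (f i \<ominus> x) + nrm A (g i \<ominus> y)"
    using ev
  proof eventually_elim
    case (elim i)
    then have "f i \<oplus> g i \<ominus> (x \<oplus> y) = (f i \<ominus> x) \<oplus> (g i \<ominus> y)"
      by (simp add: expand a_ac)
    then show ?case
      using elim by (simp add: nrm_triangle)
  qed
  show "((\<lambda>i. nrm A (f i \<ominus> x) + nrm A (g i \<ominus> y)) \<longlongrightarrow> 0) F"
    using tendsto_add[of "\<lambda>i. nrm A (f i \<ominus> x)" 0 F "\<lambda>i. nrm A (g i \<ominus> y)" 0] f g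
    by (simp add: conv_def)
qed (use conv_in[OF f] conv_in[OF g] in auto)

lemma conv_norm:
  assumes "conv f x F" shows "((\<lambda>i. nrm A (f i)) \<longlongrightarrow> nrm A x) F"
proof -
  have "((\<lambda>i. nrm A (f i) - nrm A x) \<longlongrightarrow> 0) F"
  proof (rule Lim_null_comparison)
    show "((\<lambda>i. nrm A (f i \<ominus> x)) \<longlongrightarrow> 0) F"
      using assms by (simp add: conv_def)
    have "\<forall>\<^sub>F i in F. f i \<in> carrier A" "x \<in> carrier A"
      using assms by (simp_all add: conv_def)
    then show "\<forall>\<^sub>F i in F. norm (nrm A (f i) - nrm A x) \<le> nrm A (f i \<ominus> x)"
      by (auto elim!: eventually_mono simp: nrm_diff_le)
  qed
  then show ?thesis
    by (simp add: Lim_null[symmetric])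
qed

lemma conv_mult:
  assumes f: "conv f x F" and g: "conv g y F"
  shows "conv (\<lambda>i. f i \<otimes> g i) (x \<otimes> y) F"
proof (rule conv_bound)
  note [simp] = conv_in[OF f] conv_in[OF g]
  have ev: "\<forall>\<^sub>F i in F. f i \<in> carrier A \<and> g i \<in> carrier A"
    using f g by (simp add: conv_def eventually_conj)
  then show "\<forall>\<^sub>F i in F. f i \<otimes> g i \<in> carrier A"
    by eventually_elim auto
  show "\<forall>\<^sub>F i in F. nrm A (f i \<otimes> g i \<ominus> x \<otimes> y) \<le> nrm A (f i \<ominus> x) * nrm A (g i) + nrm A x * nrm A (g i \<ominus> y)"
    using ev
  proof eventually_elim
    case (elim i)
    have "f i \<otimes> g i \<ominus> x \<otimes> y = (f i \<ominus> x) \<otimes> g i \<oplus> x \<otimes> (g i \<ominus> y)"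
      using elim minus_split[of "f i \<otimes> g i" "x \<otimes> g i" "x \<otimes> y"] by (simp add: expand)
    then have "nrm A (f i \<otimes> g i \<ominus> x \<otimes> y) \<le> nrm A ((f i \<ominus> x) \<otimes> g i) + nrm A (x \<otimes> (g i \<ominus> y))"
      using elim by (simp add: nrm_triangle)
    also have "\<dots> \<le> nrm A (f i \<ominus> x) * nrm A (g i) + nrm A x * nrm A (g i \<ominus> y)"
      using elim by (intro add_mono nrm_mult) auto
    finally show ?case .
  qed
  have "((\<lambda>i. nrm A (f i \<ominus> x) * nrm A (g i) + nrm A x * nrm A (g i \<ominus> y)) \<longlongrightarrow> 0 * nrm A y + nrm A x * 0) F"
    using f g by (intro tendsto_intros conv_norm) (auto simp: conv_def)
  then show "((\<lambda>i. nrm A (f i \<ominus> x) * nrm A (g i) + nrm A x * nrm A (g i \<ominus> y)) \<longlongrightarrow> 0) F"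
    by simp
qed (use conv_in[OF f] conv_in[OF g] in auto)

lemma conv_smult:
  assumes f: "conv f x F" shows "conv (\<lambda>i. c \<odot> f i) (c \<odot> x) F"
proof (rule conv_bound)
  note [simp] = conv_in[OF f]
  have ev: "\<forall>\<^sub>F i in F. f i \<in> carrier A"
    using f by (simp add: conv_def)
  then show "\<forall>\<^sub>F i in F. c \<odot> f i \<in> carrier A"
    by eventually_elim auto
  show "\<forall>\<^sub>F i in F. nrm A (c \<odot> f i \<ominus> c \<odot> x) \<le> cmod c * nrm A (f i \<ominus> x)"
    using ev
  proof eventually_elim
    case (elim i)
    then have "c \<odot> f i \<ominus> c \<odot> x = c \<odot> (f i \<ominus> x)"
      by (simp add: expand)
    then show ?case
      using elim by (simp add: nrm_smult)
  qed
  show "((\<lambda>i. cmod c * nrm A (f i \<ominus> x)) \<longlongrightarrow> 0) F"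
    using tendsto_mult_left[of "\<lambda>i. nrm A (f i \<ominus> x)" 0 F "cmod c"] f by (simp add: conv_def)
qed (use conv_in[OF f] in auto)

lemma conv_minus:
  assumes f: "conv f x F" and g: "conv g y F"
  shows "conv (\<lambda>i. f i \<ominus> g i) (x \<ominus> y) F"
proof -
  have "conv (\<lambda>i. f i \<oplus> (-1) \<odot> g i) (x \<ominus> y) F"
    using conv_add[OF f conv_smult[OF g, of "-1"]] conv_in[OF f] conv_in[OF g] by (simp add: minus_smult)
  moreover have "\<forall>\<^sub>F i in F. f i \<in> carrier A \<and> g i \<in> carrier A"
    using f g by (simp add: conv_def eventually_conj)
  then have "\<forall>\<^sub>F i in F. f i \<oplus> (-1) \<odot> g i = f i \<ominus> g i"
    by eventually_elim (simp add: minus_smult)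
  ultimately show ?thesis
    by (rule conv_cong)
qed

lemma conv_star:
  assumes f: "conv f x F" shows "conv (\<lambda>i. star A (f i)) (star A x) F"
proof (rule conv_bound)
  note [simp] = conv_in[OF f]
  have ev: "\<forall>\<^sub>F i in F. f i \<in> carrier A"
    using f by (simp add: conv_def)
  then show "\<forall>\<^sub>F i in F. star A (f i) \<in> carrier A"
    by eventually_elim auto
  show "\<forall>\<^sub>F i in F. nrm A (star A (f i) \<ominus> star A x) \<le> nrm A (f i \<ominus> x)"
    using ev by eventually_elim (simp add: star_minus[symmetric])
  show "((\<lambda>i. nrm A (f i \<ominus> x)) \<longlongrightarrow> 0) F"
    using f by (simp add: conv_def)
qed (use conv_in[OF f] in auto)

lemma conv_unique:
  assumes "conv f x F" "conv f y F" "F \<noteq> bot" shows "x = y"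
proof -
  note [simp] = conv_in[OF assms(1)] conv_in[OF assms(2)]
  have "conv (\<lambda>i. f i \<ominus> f i) (x \<ominus> y) F"
    by (rule conv_minus) fact+
  moreover have "\<forall>\<^sub>F i in F. f i \<ominus> f i = \<zero>"
    using assms(1) unfolding conv_def by (auto elim!: eventually_mono simp: minus_eq r_neg)
  ultimately have "conv (\<lambda>i. \<zero>) (x \<ominus> y) F"
    by (rule conv_cong)
  then have "((\<lambda>i. nrm A \<zero>) \<longlongrightarrow> nrm A (x \<ominus> y)) F"
    by (rule conv_norm)
  then have "nrm A (x \<ominus> y) = 0"
    using assms(3) by (simp add: tendsto_const_iff)
  then show ?thesis
    by (simp add: nrm_minus_eq_0)
qed

lemma conv_compose: "\<lbrakk>conv f x F; filterlim g F H\<rbrakk> \<Longrightarrow> conv (\<lambda>i. f (g i)) x H"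
  unfolding conv_def
  by (auto simp: filterlim_iff intro: filterlim_compose[where g = "\<lambda>i. nrm A (f i \<ominus> x)"])

lemma ndist_eq: "\<lbrakk>x \<in> carrier A; y \<in> carrier A\<rbrakk> \<Longrightarrow> ndist A x y = nrm A (x \<ominus> y)"
  by (simp add: ndist_def)

lemma conv_iff_limitin: "conv f x F \<longleftrightarrow> limitin (norm_topology A) f x F"
proof -
  interpret M: Metric_space "carrier A" "ndist A"
    by (rule Metric_space_ndist)
  have eq: "(\<forall>e>0. \<forall>\<^sub>F i in F. f i \<in> carrier A \<and> ndist A (f i) x < e) \<longleftrightarrow>
      (\<forall>\<^sub>F i in F. f i \<in> carrier A) \<and> (\<forall>e>0. \<forall>\<^sub>F i in F. dist (nrm A (f i \<ominus> x)) 0 < e)"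
    (is "?l \<longleftrightarrow> ?r1 \<and> ?r2") if x: "x \<in> carrier A"
  proof (intro iffI conjI allI impI)
    assume l: ?l
    show ?r1
      using spec[OF l, of 1] by (auto elim: eventually_mono)
    fix e :: real assume "e > 0"
    with l have "\<forall>\<^sub>F i in F. f i \<in> carrier A \<and> ndist A (f i) x < e"
      by blast
    then show "\<forall>\<^sub>F i in F. dist (nrm A (f i \<ominus> x)) 0 < e"
      by eventually_elim (use x nrm_nonneg in \<open>auto simp: ndist_eq\<close>)
  next
    fix e :: real assume r: "?r1 \<and> ?r2" and "e > 0"
    then have "\<forall>\<^sub>F i in F. f i \<in> carrier A" "\<forall>\<^sub>F i in F. dist (nrm A (f i \<ominus> x)) 0 < e"
      by blast+
    then show "\<forall>\<^sub>F i in F. f i \<in> carrier A \<and> ndist A (f i) x < e"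
      by eventually_elim (use x nrm_nonneg in \<open>auto simp: ndist_eq\<close>)
  qed
  show ?thesis
    unfolding conv_def norm_topology_def M.limitin_metric tendsto_iff
    using eq by blast
qed

lemma MCauchy_iff: "Metric_space.MCauchy (carrier A) (ndist A) f \<longleftrightarrow>
    (\<forall>n. f n \<in> carrier A) \<and> (\<forall>e>0. \<exists>N. \<forall>m\<ge>N. \<forall>n\<ge>N. nrm A (f m \<ominus> f n) < e)"
proof -
  interpret M: Metric_space "carrier A" "ndist A"
    by (rule Metric_space_ndist)
  show ?thesis
    unfolding M.MCauchy_def by (auto simp: ndist_def image_subset_iff) (metis+)?
qed

section \<open>Self-adjoint elements\<close>

definition selfadj :: "'a \<Rightarrow> bool" where
  "selfadj x \<longleftrightarrow> x \<in> carrier A \<and> star A x = x"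

lemma selfadj_in [simp]: "selfadj x \<Longrightarrow> x \<in> carrier A"
  by (simp add: selfadj_def)

lemma selfadj_star: "selfadj x \<Longrightarrow> star A x = x"
  by (simp add: selfadj_def)

lemma selfadj_one [simp]: "selfadj \<one>" and selfadj_zero [simp]: "selfadj \<zero>"
  by (simp_all add: selfadj_def)

lemma selfadj_add: "\<lbrakk>selfadj x; selfadj y\<rbrakk> \<Longrightarrow> selfadj (x \<oplus> y)"
  by (simp add: selfadj_def star_add)

lemma selfadj_smult: "\<lbrakk>selfadj x; c \<in> \<real>\<rbrakk> \<Longrightarrow> selfadj (c \<odot> x)"
  by (auto simp: selfadj_def star_smult Reals_cnj_iff)

lemma selfadj_smult_real [simp]: "selfadj x \<Longrightarrow> selfadj (complex_of_real c \<odot> x)"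
  by (simp add: selfadj_smult)

lemma selfadj_minus: "\<lbrakk>selfadj x; selfadj y\<rbrakk> \<Longrightarrow> selfadj (x \<ominus> y)"
  by (simp add: selfadj_def star_minus)

lemma selfadj_mult: "\<lbrakk>selfadj x; selfadj y; x \<otimes> y = y \<otimes> x\<rbrakk> \<Longrightarrow> selfadj (x \<otimes> y)"
  by (simp add: selfadj_def star_mult)

lemma selfadj_star_mult: "x \<in> carrier A \<Longrightarrow> selfadj (star A x \<otimes> x)"
  by (simp add: selfadj_def star_mult)

lemma nrm_selfadj_sq: "selfadj x \<Longrightarrow> nrm A (x \<otimes> x) = (nrm A x)\<^sup>2"
  using cstar_identity[of x] by (simp add: selfadj_def)

lemma selfadj_sq_eq_0: "\<lbrakk>selfadj x; x \<otimes> x = \<zero>\<rbrakk> \<Longrightarrow> x = \<zero>"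
  using nrm_selfadj_sq[of x] by (simp add: nrm_eq_0)

text \<open>The right side is the squared norm of \<^term>\<open>h \<oplus> \<i> \<odot> s\<close>, whose real part is \<^term>\<open>h\<close>.\<close>

lemma nrm_commuting_sq_le:
  assumes h: "selfadj h" and s: "selfadj s" and hs: "h \<otimes> s = s \<otimes> h"
  shows "(nrm A h)\<^sup>2 \<le> nrm A (h \<otimes> h \<oplus> s \<otimes> s)"
proof -
  note [simp] = selfadj_in[OF h] selfadj_in[OF s] selfadj_star[OF h] selfadj_star[OF s]
  define w where "w = h \<oplus> \<i> \<odot> s"
  have w: "w \<in> carrier A" by (simp add: w_def)
  have sw: "star A w = h \<oplus> (- \<i>) \<odot> s"
    by (simp add: w_def star_add star_smult)
  have "star A w \<otimes> w = h \<otimes> h \<oplus> s \<otimes> s \<oplus> (\<i> \<odot> (h \<otimes> s) \<oplus> (- \<i>) \<odot> (h \<otimes> s))"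
    unfolding sw unfolding w_def using hs by (simp add: expand a_ac)
  also have "\<dots> = h \<otimes> h \<oplus> s \<otimes> s"
    by (simp add: smult_collect)
  finally have 1: "(nrm A w)\<^sup>2 = nrm A (h \<otimes> h \<oplus> s \<otimes> s)"
    using cstar_identity[OF w] by simp
  have "w \<oplus> star A w = h \<oplus> h \<oplus> (\<i> \<odot> s \<oplus> (- \<i>) \<odot> s)"
    unfolding sw unfolding w_def by (simp add: a_ac)
  then have "w \<oplus> star A w = 2 \<odot> h"
    by (simp add: smult_collect)
  then have "2 * nrm A h \<le> nrm A w + nrm A (star A w)"
    using nrm_triangle[of w "star A w"] w by (simp add: nrm_smult)
  then have "nrm A h \<le> nrm A w"
    using w by simp
  then show ?thesis
    using 1 by (metis nrm_nonneg power_mono selfadj_in h)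
qed

end

section \<open>Completeness along filters and square roots\<close>

context unital_cstar_algebra
begin

lemma nrm_one: "nrm A \<one> = 1"
proof -
  have "nrm A \<one> * nrm A \<one> = 1 * nrm A \<one>"
    using nrm_selfadj_sq[of \<one>] by (simp add: power2_eq_square)
  moreover have "nrm A \<one> \<noteq> 0"
    by (simp add: nrm_eq_0 one_not_zero)
  ultimately show ?thesis
    by simp
qed

lemma Cauchy_conv:
  assumes f: "\<And>n. f n \<in> carrier A" and C: "\<And>e. e > 0 \<Longrightarrow> \<exists>N. \<forall>m\<ge>N. \<forall>n\<ge>N. nrm A (f m \<ominus> f n) < e"
  obtains x where "conv f x sequentially"
proof -
  interpret M: Metric_space "carrier A" "ndist A"
    by (rule Metric_space_ndist)
  have "M.MCauchy f"
    using f C by (simp add: MCauchy_iff)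
  then show ?thesis
    using complete that unfolding M.mcomplete_def conv_iff_limitin norm_topology_def by blast
qed

text \<open>Completeness is given for sequences only. Points that eventually approximate
  \<open>f\<close> up to 1/(n+1) form a Cauchy sequence, since on a nontrivial filter any two of
  them have a common nearby value of \<open>f\<close>; the limit of this sequence is also the limit
  of \<open>f\<close>.\<close>

lemma approx_conv:
  assumes bot: "F \<noteq> bot" and f: "\<forall>\<^sub>F i in F. f i \<in> carrier A"
    and C: "\<And>e. e > 0 \<Longrightarrow> \<exists>z\<in>carrier A. \<forall>\<^sub>F i in F. nrm A (f i \<ominus> z) \<le> e"
  obtains x where "conv f x F"
proof -
  have "\<forall>n. \<exists>z\<in>carrier A. \<forall>\<^sub>F i in F. nrm A (f i \<ominus> z) \<le> inverse (real (Suc n))"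
    by (intro allI C) simp
  then obtain z where z: "\<And>n. z n \<in> carrier A"
    and zf: "\<And>n. \<forall>\<^sub>F i in F. nrm A (f i \<ominus> z n) \<le> inverse (real (Suc n))"
    by metis
  have zz: "nrm A (z m \<ominus> z n) \<le> inverse (real (Suc m)) + inverse (real (Suc n))" for m n
  proof -
    have "\<forall>\<^sub>F i in F. nrm A (z m \<ominus> z n) \<le> inverse (real (Suc m)) + inverse (real (Suc n))"
      using zf[of m] zf[of n] f
    proof eventually_elim
      case (elim i)
      then show ?case
        using nrm_minus_triangle[of "z m" "f i" "z n"] nrm_minus_commute[of "f i" "z m"] z by force
    qed
    then show ?thesis
      using bot by simp
  qed
  have "\<exists>N. \<forall>m\<ge>N. \<forall>n\<ge>N. nrm A (z m \<ominus> z n) < e" if e: "e > 0" for e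
  proof -
    obtain N where N: "inverse (real (Suc N)) < e / 2"
      using reals_Archimedean[of "e / 2"] e by auto
    have "nrm A (z m \<ominus> z n) < e" if "m \<ge> N" "n \<ge> N" for m n
    proof -
      have "inverse (real (Suc m)) \<le> inverse (real (Suc N))" "inverse (real (Suc n)) \<le> inverse (real (Suc N))"
        using that by (intro le_imp_inverse_le; simp)+
      then show ?thesis
        using zz[of m n] N by linarith
    qed
    then show ?thesis
      by blast
  qed
  then obtain x where x: "conv z x sequentially"
    using Cauchy_conv[of z] z by blast
  note [simp] = conv_in[OF x] z
  have "((\<lambda>i. nrm A (f i \<ominus> x)) \<longlongrightarrow> 0) F"
  proof (rule tendstoI)
    fix e :: real assume e: "e > 0"
    have "\<forall>\<^sub>F n in sequentially. nrm A (z n \<ominus> x) < e / 2"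
      using x e by (intro order_tendstoD(2)[where y = 0]) (auto simp: conv_def)
    moreover have "\<forall>\<^sub>F n in sequentially. inverse (real (Suc n)) < e / 2"
      using e by (intro order_tendstoD(2)[OF LIMSEQ_inverse_real_of_nat]) auto
    ultimately have "\<forall>\<^sub>F n in sequentially. nrm A (z n \<ominus> x) < e / 2 \<and> inverse (real (Suc n)) < e / 2"
      by eventually_elim auto
    then obtain n where n: "nrm A (z n \<ominus> x) < e / 2" "inverse (real (Suc n)) < e / 2"
      using eventually_happens'[OF sequentially_bot] by blast
    show "\<forall>\<^sub>F i in F. dist (nrm A (f i \<ominus> x)) 0 < e"
      using zf[of n] f
    proof eventually_elim
      case (elim i)
      then show ?case
        using nrm_minus_triangle[of "f i" "z n" x] n nrm_nonneg[of "f i \<ominus> x"] by simp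
    qed
  qed
  then have "conv f x F"
    using f by (simp add: conv_def)
  then show ?thesis
    by (rule that)
qed

text \<open>The witness is one minus the limit of the iteration \<open>u \<mapsto> (1/2) \<odot> (x \<oplus> u \<otimes> u)\<close> started at zero; the
  same iteration for the real number 1 dominates the increments.\<close>

lemma ex_sqrt_one_minus:
  assumes x: "selfadj x" and nx: "nrm A x \<le> 1"
  obtains y where "selfadj y" "y \<otimes> y = \<one> \<ominus> x" "nrm A (\<one> \<ominus> y) \<le> 1"
    "\<And>z. \<lbrakk>z \<in> carrier A; z \<otimes> x = x \<otimes> z\<rbrakk> \<Longrightarrow> z \<otimes> y = y \<otimes> z"
proof -
  note [simp] = selfadj_in[OF x]
  define Y where "Y = rec_nat \<zero> (\<lambda>_ y. (1/2) \<odot> (x \<oplus> y \<otimes> y))"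
  define r :: "nat \<Rightarrow> real" where "r = rec_nat 0 (\<lambda>_ y. (1 + y * y) / 2)"
  have Y0: "Y 0 = \<zero>" and YS: "Y (Suc n) = (1/2) \<odot> (x \<oplus> Y n \<otimes> Y n)"
    and r0: "r 0 = 0" and rS: "r (Suc n) = (1 + r n * r n) / 2" for n
    by (simp_all add: Y_def r_def)
  have comm: "z \<otimes> Y n = Y n \<otimes> z" if "z \<in> carrier A" "z \<otimes> x = x \<otimes> z" "\<forall>n. Y n \<in> carrier A" for z n
  proof (induction n)
    case (Suc n)
    have "z \<otimes> (Y n \<otimes> Y n) = (Y n \<otimes> Y n) \<otimes> z"
      using that Suc by (metis m_assoc)
    then show ?case
      using that by (simp add: YS smult_mult_left smult_mult_right l_distr r_distr)
  qed (use that in \<open>simp add: Y0\<close>)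
  have saY: "selfadj (Y n)" for n
  proof (induction n)
    case (Suc n)
    then show ?case
      unfolding YS by (intro selfadj_smult selfadj_add selfadj_mult x) auto
  qed (simp add: Y0)
  then have Y [simp]: "Y n \<in> carrier A" for n
    by simp
  \<comment> \<open>Two uses of \<open>comm\<close>: every iterate commutes with \<open>x\<close>,
    hence with every other iterate.\<close>
  have YY: "Y m \<otimes> Y n = Y n \<otimes> Y m" for m n
    by (rule comm) (use comm[of x m] in auto)
  have r: "0 \<le> r n \<and> r n \<le> 1 \<and> r n \<le> r (Suc n)" for n
  proof (induction n)
    case (Suc n)
    then have 1: "r n * r n \<le> 1 * 1" and 2: "r n * r n \<le> r (Suc n) * r (Suc n)"
      by (intro mult_mono; linarith)+
    from 1 have "r (Suc n) \<le> 1"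
      unfolding rS by simp
    moreover from 2 have "(1 + r n * r n) / 2 \<le> (1 + r (Suc n) * r (Suc n)) / 2"
      by (intro divide_right_mono add_left_mono) auto
    then have "r (Suc n) \<le> r (Suc (Suc n))"
      by (simp only: rS[symmetric])
    ultimately show ?case
      using Suc by (meson order.trans)
  qed (simp add: r0 rS)
  have nY: "nrm A (Y n) \<le> r n" for n
  proof (induction n)
    case (Suc n)
    have "nrm A (Y n \<otimes> Y n) \<le> nrm A (Y n) * nrm A (Y n)"
      by (rule nrm_mult) auto
    also have "\<dots> \<le> r n * r n"
      by (intro mult_mono Suc.IH nrm_nonneg) (use r in auto)
    finally show ?case
      using nx nrm_triangle[of x "Y n \<otimes> Y n"] by (simp add: YS rS nrm_smult)
  qed (simp add: Y0 r0)
  have dY: "nrm A (Y (Suc n) \<ominus> Y n) \<le> r (Suc n) - r n" for n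
  proof (induction n)
    case 0
    show ?case using nY[of "Suc 0"] by (simp add: Y0 r0 minus_smult)
  next
    case (Suc n)
    have *: "a \<otimes> a \<ominus> b \<otimes> b = (a \<ominus> b) \<otimes> (a \<oplus> b)" if "a \<in> carrier A" "b \<in> carrier A" "a \<otimes> b = b \<otimes> a" for a b
    proof -
      have "(a \<ominus> b) \<otimes> (a \<oplus> b) = a \<otimes> a \<oplus> (-1) \<odot> (b \<otimes> b) \<oplus> (a \<otimes> b \<oplus> (-1) \<odot> (a \<otimes> b))"
        using that by (simp add: expand a_ac)
      also have "\<dots> = a \<otimes> a \<ominus> b \<otimes> b"
        using that by (simp add: smult_collect minus_smult)
      finally show ?thesis ..
    qed
    have "Y (Suc (Suc n)) \<ominus> Y (Suc n) = (1/2) \<odot> ((x \<oplus> (-1) \<odot> x) \<oplus> (Y (Suc n) \<otimes> Y (Suc n) \<ominus> Y n \<otimes> Y n))"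
      unfolding YS[of "Suc n"] YS[of n]
      by (simp add: expand a_ac del: YS)
    also have "\<dots> = (1/2) \<odot> (Y (Suc n) \<otimes> Y (Suc n) \<ominus> Y n \<otimes> Y n)"
      by (simp add: smult_collect)
    also have "\<dots> = (1/2) \<odot> ((Y (Suc n) \<ominus> Y n) \<otimes> (Y (Suc n) \<oplus> Y n))"
      using *[of "Y (Suc n)" "Y n"] YY by simp
    finally have "nrm A (Y (Suc (Suc n)) \<ominus> Y (Suc n)) = nrm A ((Y (Suc n) \<ominus> Y n) \<otimes> (Y (Suc n) \<oplus> Y n)) / 2"
      by (simp add: nrm_smult)
    also have "\<dots> \<le> (r (Suc n) - r n) * (r (Suc n) + r n) / 2"
    proof -
      have "nrm A (Y (Suc n) \<oplus> Y n) \<le> r (Suc n) + r n"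
        using nrm_triangle[of "Y (Suc n)" "Y n"] nY[of n] nY[of "Suc n"] by simp
      then have "nrm A ((Y (Suc n) \<ominus> Y n) \<otimes> (Y (Suc n) \<oplus> Y n)) \<le> (r (Suc n) - r n) * (r (Suc n) + r n)"
        using Suc.IH r[of n]
        by (intro order.trans[OF nrm_mult] mult_mono) (auto intro: nrm_nonneg)
      then show ?thesis by simp
    qed
    also have "\<dots> = (1 + r (Suc n) * r (Suc n)) / 2 - (1 + r n * r n) / 2"
      by (simp add: field_simps)
    also have "\<dots> = r (Suc (Suc n)) - r (Suc n)"
      by (simp only: rS[symmetric])
    finally show ?case .
  qed
  have dY': "nrm A (Y (n + k) \<ominus> Y n) \<le> r (n + k) - r n" for n k
  proof (induction k)
    case (Suc k)
    then show ?case
      using nrm_minus_triangle[of "Y (Suc (n + k))" "Y (n + k)" "Y n"] dY[of "n + k"] by simp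
  qed (simp add: minus_eq r_neg)
  have "incseq r" "\<forall>n. r n \<le> 1"
    using r by (auto simp: incseq_Suc_iff)
  then obtain L where "r \<longlonglongrightarrow> L"
    using incseq_convergent[of r 1] by blast
  then have Cr: "Cauchy r"
    by (rule LIMSEQ_imp_Cauchy)
  have "\<exists>N. \<forall>m\<ge>N. \<forall>n\<ge>N. nrm A (Y m \<ominus> Y n) < e" if e: "e > 0" for e
  proof -
    obtain N where N: "\<forall>m\<ge>N. \<forall>n\<ge>N. dist (r m) (r n) < e"
      using Cr e by (auto simp: Cauchy_def)
    have "nrm A (Y m \<ominus> Y n) < e" if "m \<ge> N" "n \<ge> N" for m n
    proof (cases "m \<le> n")
      case True
      then obtain k where "n = m + k"
        using le_Suc_ex by blast
      then show ?thesis
        using dY'[of m k] N[rule_format, OF that] nrm_minus_commute[of "Y m" "Y n"] Y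
        by (simp add: dist_real_def)
    next
      case False
      then obtain k where "m = n + k"
        using le_Suc_ex by (metis nle_le)
      then show ?thesis
        using dY'[of n k] N[rule_format, OF that] by (simp add: dist_real_def)
    qed
    then show ?thesis by blast
  qed
  then obtain u where u: "conv Y u sequentially"
    using Cauchy_conv[of Y, OF Y] by blast
  note uin [simp] = conv_in[OF u]
  have "conv (\<lambda>n. Y (Suc n)) u sequentially"
    using conv_compose[OF u filterlim_Suc] by simp
  moreover have "conv (\<lambda>n. Y (Suc n)) ((1/2) \<odot> (x \<oplus> u \<otimes> u)) sequentially"
    unfolding YS by (intro conv_smult conv_add conv_mult conv_const u) auto
  ultimately have uu: "u = (1/2) \<odot> (x \<oplus> u \<otimes> u)"
    by (rule conv_unique) simp
  \<comment> \<open>The fixed point equation of the iteration; it says that (1 - u)(1 - u) = 1 -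
    x.\<close>
  have 2: "2 \<odot> u = x \<oplus> u \<otimes> u"
    by (subst uu) (simp add: smult_smult)
  have su: "star A u = u"
  proof (rule conv_unique)
    show "conv (\<lambda>n. star A (Y n)) (star A u) sequentially"
      by (intro conv_star u)
    show "conv (\<lambda>n. star A (Y n)) u sequentially"
      using u saY by (simp add: selfadj_star)
  qed simp
  show ?thesis
  proof
    show "selfadj (\<one> \<ominus> u)"
      by (intro selfadj_minus) (simp_all add: su selfadj_def)
    have "(\<one> \<ominus> u) \<otimes> (\<one> \<ominus> u) = \<one> \<oplus> ((-1) \<odot> (2 \<odot> u) \<oplus> u \<otimes> u)"
      by (simp add: expand smult_collect)
    also have "\<dots> = \<one> \<oplus> ((-1) \<odot> x \<oplus> (u \<otimes> u \<oplus> (-1) \<odot> (u \<otimes> u)))"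
      unfolding 2 by (simp add: smult_add_right a_ac)
    also have "\<dots> = \<one> \<ominus> x"
      by (simp add: smult_collect minus_smult)
    finally show "(\<one> \<ominus> u) \<otimes> (\<one> \<ominus> u) = \<one> \<ominus> x" .
    have "\<one> \<ominus> (\<one> \<ominus> u) = u"
      by (simp add: expand smult_collect)
    moreover have "nrm A u \<le> 1"
    proof (rule LIMSEQ_le_const2)
      show "(\<lambda>n. nrm A (Y n)) \<longlonglongrightarrow> nrm A u"
        by (rule conv_norm[OF u])
      show "\<exists>N. \<forall>n\<ge>N. nrm A (Y n) \<le> 1"
        using nY r by (meson order.trans)
    qed
    ultimately show "nrm A (\<one> \<ominus> (\<one> \<ominus> u)) \<le> 1"
      by simp
    fix z assume z: "z \<in> carrier A" "z \<otimes> x = x \<otimes> z"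
    have "z \<otimes> u = u \<otimes> z"
    proof (rule conv_unique)
      show "conv (\<lambda>n. z \<otimes> Y n) (z \<otimes> u) sequentially"
        by (intro conv_mult conv_const u z)
      show "conv (\<lambda>n. z \<otimes> Y n) (u \<otimes> z) sequentially"
        unfolding comm[OF z, rule_format, OF Y] by (intro conv_mult conv_const u z)
    qed simp
    then show "z \<otimes> (\<one> \<ominus> u) = (\<one> \<ominus> u) \<otimes> z"
      using z by (simp add: expand)
  qed
qed

end

section \<open>Positive elements\<close>

text \<open>The closing arithmetic of \<open>star_mult_neg_sq\<close>: the two sides differ by 2 K
  N^2.\<close>

lemma real_eq_0_of_quadratic_le:
  fixes K N :: real
  assumes "K > 0" "(K^2 + 4 * K * N) * N \<le> K^2 * N + 2 * K * N^2"
  shows "N = 0"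
proof -
  have "2 * K * N^2 \<le> 0"
    using assms(2) by (simp add: power2_eq_square algebra_simps)
  then show ?thesis
    using assms(1) by (simp add: mult_le_0_iff)
qed

context unital_cstar_algebra
begin

lemma selfadj_add_star: "x \<in> carrier A \<Longrightarrow> selfadj (x \<oplus> star A x)"
  by (simp add: selfadj_def star_add a_comm)

lemma selfadj_minus_star:
  assumes "x \<in> carrier A" shows "selfadj (\<i> \<odot> (x \<ominus> star A x))"
proof -
  have "star A (\<i> \<odot> (x \<ominus> star A x)) = (- \<i>) \<odot> (star A x \<ominus> x)"
    using assms by (simp add: star_smult star_minus)
  also have "\<dots> = \<i> \<odot> x \<oplus> (- \<i>) \<odot> star A x"
    using assms by (subst a_comm) (simp_all add: expand)
  also have "\<dots> = \<i> \<odot> (x \<ominus> star A x)"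
    using assms by (simp add: expand)
  finally show ?thesis
    using assms by (simp add: selfadj_def)
qed

text \<open>Squares of self-adjoint elements admit a criterion by norms and so can be added and
  given roots. That all of \<open>positive_elements\<close>, the elements x* x, are of this kind is
  the deeper fact \<open>pos_star_mult\<close>.\<close>

definition pos :: "'a \<Rightarrow> bool" where
  "pos h \<longleftrightarrow> (\<exists>t. selfadj t \<and> h = t \<otimes> t)"

lemma pos_selfadj: "pos h \<Longrightarrow> selfadj h"
  by (auto simp: pos_def intro: selfadj_mult)

lemma pos_in: "pos h \<Longrightarrow> h \<in> carrier A"
  using pos_selfadj by simp

lemma pos_sq: "selfadj t \<Longrightarrow> pos (t \<otimes> t)"
  by (auto simp: pos_def)

lemma pos_smult:
  assumes "pos h" "c \<ge> 0" shows "pos (complex_of_real c \<odot> h)"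
proof -
  obtain t where t: "selfadj t" "h = t \<otimes> t"
    using assms(1) by (auto simp: pos_def)
  have "complex_of_real c \<odot> h = (complex_of_real (sqrt c) \<odot> t) \<otimes> (complex_of_real (sqrt c) \<odot> t)"
    using t assms(2) by (simp add: expand flip: of_real_mult)
  then show ?thesis
    using t pos_sq by simp
qed

text \<open>After division by c, h is 1 - x with x of norm at most 1, and
  \<open>ex_sqrt_one_minus\<close> applies. Together with \<open>pos_norm\<close> this characterises
  positivity by the distance from h to a multiple of the unit.\<close>

lemma ex_sqrt_norm:
  assumes h: "selfadj h" and c: "c > 0" and le: "nrm A (complex_of_real c \<odot> \<one> \<ominus> h) \<le> c"
  obtains t where "pos t" "t \<otimes> t = h" "\<And>z. \<lbrakk>z \<in> carrier A; z \<otimes> h = h \<otimes> z\<rbrakk> \<Longrightarrow> z \<otimes> t = t \<otimes> z"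
proof -
  note [simp] = selfadj_in[OF h]
  let ?c = "complex_of_real c"
  define x where "x = \<one> \<ominus> (1 / ?c) \<odot> h"
  have x: "selfadj x"
    unfolding x_def using selfadj_smult_real[OF h, of "1 / c"] by (intro selfadj_minus) auto
  have "x = (1 / ?c) \<odot> (?c \<odot> \<one> \<ominus> h)"
    unfolding x_def using c by (simp add: expand)
  then have "nrm A x = nrm A (?c \<odot> \<one> \<ominus> h) / c"
    using c by (simp add: nrm_smult norm_divide)
  then have "nrm A x \<le> 1"
    using le c by simp
  with x obtain y where y: "selfadj y" "y \<otimes> y = \<one> \<ominus> x" "nrm A (\<one> \<ominus> y) \<le> 1"
    and comm: "\<And>z. \<lbrakk>z \<in> carrier A; z \<otimes> x = x \<otimes> z\<rbrakk> \<Longrightarrow> z \<otimes> y = y \<otimes> z"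
    using ex_sqrt_one_minus by metis
  have xh: "\<one> \<ominus> x = (1 / ?c) \<odot> h"
    by (simp add: x_def expand smult_collect)
  note [simp] = selfadj_in[OF y(1)]
  \<comment> \<open>The bound on 1 - y permits a second extraction: y is itself the square of y', so
    the root found is positive.\<close>
  have "selfadj (\<one> \<ominus> y)"
    by (intro selfadj_minus y) simp
  then obtain y' where y': "selfadj y'" "y' \<otimes> y' = \<one> \<ominus> (\<one> \<ominus> y)"
    using ex_sqrt_one_minus[of "\<one> \<ominus> y"] y(3) by metis
  have "\<one> \<ominus> (\<one> \<ominus> y) = y"
    by (simp add: expand smult_collect)
  then have "pos y"
    using y' by (auto simp: pos_def)
  show ?thesis
  proof
    show "pos (complex_of_real (sqrt c) \<odot> y)"
      using \<open>pos y\<close> c by (intro pos_smult) auto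
    have "(complex_of_real (sqrt c) \<odot> y) \<otimes> (complex_of_real (sqrt c) \<odot> y) = ?c \<odot> (y \<otimes> y)"
      using c by (simp add: expand flip: of_real_mult)
    also have "\<dots> = h"
      using c by (simp add: y(2) xh smult_smult)
    finally show "(complex_of_real (sqrt c) \<odot> y) \<otimes> (complex_of_real (sqrt c) \<odot> y) = h" .
    fix z assume z: "z \<in> carrier A" "z \<otimes> h = h \<otimes> z"
    then have "z \<otimes> y = y \<otimes> z"
      by (intro comm) (simp_all add: x_def expand)
    then show "z \<otimes> (complex_of_real (sqrt c) \<odot> y) = (complex_of_real (sqrt c) \<odot> y) \<otimes> z"
      using z by (simp add: expand)
  qed
qed

text \<open>Scale the root t of h to u = t / sqrt c, so that u u has norm at most 1, and take a root
  y of 1 - u u that commutes with u. Then y y + u u = 1 bounds the norm of y by 1, and c - h = c y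
  y.\<close>

lemma pos_norm:
  assumes h: "pos h" and c: "nrm A h \<le> c" "c > 0"
  shows "nrm A (complex_of_real c \<odot> \<one> \<ominus> h) \<le> c"
proof -
  let ?c = "complex_of_real c"
  obtain t where t: "selfadj t" "h = t \<otimes> t"
    using h by (auto simp: pos_def)
  note [simp] = selfadj_in[OF t(1)]
  define u where "u = complex_of_real (1 / sqrt c) \<odot> t"
  have u: "selfadj u"
    unfolding u_def by (rule selfadj_smult_real) (rule t)
  note [simp] = selfadj_in[OF u]
  have uu: "u \<otimes> u = (1 / ?c) \<odot> h"
    using c by (simp add: u_def t(2) expand flip: of_real_mult)
  have "selfadj (u \<otimes> u)"
    by (intro selfadj_mult u refl)
  moreover have "nrm A (u \<otimes> u) \<le> 1"
    using c pos_in[OF h] by (simp add: uu nrm_smult norm_divide)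
  ultimately obtain y where y: "selfadj y" "y \<otimes> y = \<one> \<ominus> u \<otimes> u"
    and comm: "\<And>z. \<lbrakk>z \<in> carrier A; z \<otimes> (u \<otimes> u) = (u \<otimes> u) \<otimes> z\<rbrakk> \<Longrightarrow> z \<otimes> y = y \<otimes> z"
    using ex_sqrt_one_minus by metis
  note [simp] = selfadj_in[OF y(1)]
  have "(nrm A y)\<^sup>2 \<le> nrm A (y \<otimes> y \<oplus> u \<otimes> u)"
    using comm[of u] by (intro nrm_commuting_sq_le y u) (simp add: m_assoc)
  also have "y \<otimes> y \<oplus> u \<otimes> u = \<one>"
    by (simp add: y(2) expand smult_collect)
  finally have *: "nrm A (y \<otimes> y) \<le> 1"
    by (simp add: nrm_selfadj_sq[OF y(1)] nrm_one)
  have "?c \<odot> \<one> \<ominus> h = ?c \<odot> (y \<otimes> y)"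
    unfolding y(2) uu using c pos_in[OF h] by (simp add: expand)
  then show ?thesis
    using * c by (simp add: nrm_smult)
qed

lemma pos_sqrt:
  assumes "pos h"
  obtains t where "pos t" "t \<otimes> t = h" "\<And>z. \<lbrakk>z \<in> carrier A; z \<otimes> h = h \<otimes> z\<rbrakk> \<Longrightarrow> z \<otimes> t = t \<otimes> z"
  using ex_sqrt_norm[of h "nrm A h + 1"] pos_norm[of h "nrm A h + 1"] pos_selfadj[of h] assms
  by (smt (verit) nrm_nonneg pos_in)

text \<open>In the criterion by norms the bounds for h and k add up by the triangle inequality. This
  is why positivity is accessed through norms and not through roots, which need not commute.\<close>

lemma pos_add:
  assumes h: "pos h" and k: "pos k" shows "pos (h \<oplus> k)"
proof -
  note [simp] = pos_in[OF h] pos_in[OF k]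
  define c d where "c = nrm A h + 1" and "d = nrm A k + 1"
  have c: "c > 0" "nrm A h \<le> c" and d: "d > 0" "nrm A k \<le> d"
    using nrm_nonneg[of h] nrm_nonneg[of k] by (auto simp: c_def d_def)
  have "complex_of_real (c + d) \<odot> \<one> \<ominus> (h \<oplus> k) = (complex_of_real c \<odot> \<one> \<ominus> h) \<oplus> (complex_of_real d \<odot> \<one> \<ominus> k)"
    by (simp add: expand smult_add_left a_ac)
  then have "nrm A (complex_of_real (c + d) \<odot> \<one> \<ominus> (h \<oplus> k)) \<le> c + d"
    using nrm_triangle[of "complex_of_real c \<odot> \<one> \<ominus> h" "complex_of_real d \<odot> \<one> \<ominus> k"]
      pos_norm[OF h c(2,1)] pos_norm[OF k d(2,1)] by simp
  then show ?thesis
    using ex_sqrt_norm[of "h \<oplus> k" "c + d"] selfadj_add[OF pos_selfadj[OF h] pos_selfadj[OF k]] c d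
    by (metis add_pos_pos pos_sq pos_selfadj)
qed

text \<open>A root s of c - h commutes with h = c - s s, hence with the root t of h. So t t + s s =
  c bounds the squared norm of t, which is the norm of h.\<close>

lemma pos_le_norm:
  assumes h: "pos h" and hc: "pos (complex_of_real c \<odot> \<one> \<ominus> h)" and c: "c \<ge> 0"
  shows "nrm A h \<le> c"
proof -
  obtain t where t: "pos t" "t \<otimes> t = h"
    and comm: "\<And>z. \<lbrakk>z \<in> carrier A; z \<otimes> h = h \<otimes> z\<rbrakk> \<Longrightarrow> z \<otimes> t = t \<otimes> z"
    using pos_sqrt[OF h] by metis
  obtain s where s: "selfadj s" "complex_of_real c \<odot> \<one> \<ominus> h = s \<otimes> s"
    using hc by (auto simp: pos_def)
  note [simp] = pos_in[OF h] pos_in[OF t(1)] selfadj_in[OF s(1)]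
  have "h = complex_of_real c \<odot> \<one> \<ominus> s \<otimes> s"
    by (simp add: s(2)[symmetric] expand smult_collect)
  then have "s \<otimes> h = h \<otimes> s"
    by (simp add: expand)
  then have "(nrm A t)\<^sup>2 \<le> nrm A (t \<otimes> t \<oplus> s \<otimes> s)"
    using comm[of s] by (intro nrm_commuting_sq_le s pos_selfadj t) simp
  also have "t \<otimes> t \<oplus> s \<otimes> s = complex_of_real c \<odot> \<one>"
    unfolding t(2) s(2)[symmetric] using a_comm[of "complex_of_real c \<odot> \<one>"]
    by (simp add: expand smult_collect)
  finally show ?thesis
    using nrm_selfadj_sq[OF pos_selfadj[OF t(1)]] c by (simp add: t(2) nrm_smult nrm_one)
qed

text \<open>The distance from c - h to c is the norm of h, so the criterion
  \<open>ex_sqrt_norm\<close> applies. It needs c > 0, and c = 0 forces h = 0.\<close>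

lemma pos_norm_minus:
  assumes h: "selfadj h" and c: "nrm A h \<le> c"
  shows "pos (complex_of_real c \<odot> \<one> \<ominus> h)"
proof (cases "c = 0")
  case True
  then have "nrm A h = 0"
    using c nrm_nonneg[of h] h by simp
  then have "h = \<zero>"
    using h by (simp add: nrm_eq_0)
  then show ?thesis
    using True pos_sq[OF selfadj_zero] by (simp add: minus_eq)
next
  case False
  note [simp] = selfadj_in[OF h]
  have "c > 0"
    using False c nrm_nonneg[of h] by simp
  moreover have "complex_of_real c \<odot> \<one> \<ominus> (complex_of_real c \<odot> \<one> \<ominus> h) = h"
    by (simp add: expand smult_collect)
  moreover have "selfadj (complex_of_real c \<odot> \<one> \<ominus> h)"
    by (intro selfadj_minus h) simp
  ultimately show ?thesis
    using ex_sqrt_norm[of "complex_of_real c \<odot> \<one> \<ominus> h" c] c by (metis pos_sq pos_selfadj)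
qed

text \<open>In a positive \<^term>\<open>w \<otimes> star A w\<close> the operator \<^term>\<open>c \<odot> \<one> \<ominus> w \<otimes> star A w\<close> does not increase norms for
  large \<^term>\<open>c\<close>, while \<^term>\<open>c \<odot> \<one> \<ominus> star A w \<otimes> w = c \<odot> \<one> \<oplus> q \<otimes> q\<close> does, unless \<^term>\<open>q = \<zero>\<close>.\<close>

lemma star_mult_neg_sq:
  assumes w: "w \<in> carrier A" and q: "selfadj q" and wq: "star A w \<otimes> w = \<ominus> (q \<otimes> q)"
    and ww: "pos (w \<otimes> star A w)"
  shows "q = \<zero>"
proof -
  note [simp] = w selfadj_in[OF q] selfadj_star[OF q]
  define K where "K = nrm A (w \<otimes> star A w) + 1"
  have K: "K > 0" "nrm A (w \<otimes> star A w) \<le> K"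
    using nrm_nonneg[of "w \<otimes> star A w"] by (auto simp: K_def)
  let ?K = "complex_of_real K"
  define u where "u = q \<otimes> q"
  define N where "N = nrm A u"
  let ?N = "complex_of_real N"
  have [simp]: "u \<in> carrier A" and su: "selfadj u"
    using q by (auto simp: u_def intro: selfadj_mult)
  note [simp] = selfadj_star[OF su]
  have sw: "star A w \<otimes> w = (-1) \<odot> u"
    using wq by (simp add: u_def uminus_smult)
  have nw: "(nrm A w)\<^sup>2 = N"
    using cstar_identity[OF w] by (simp add: sw nrm_smult N_def)
  have N0: "N \<ge> 0"
    by (simp add: N_def nrm_nonneg)
  \<comment> \<open>T is minus \<open>star A v \<otimes> v\<close> for v = w (K + u). Moving K + u
    to the other side of w turns it into K - w w*, of norm at most K, so T has norm at most K^2
    N.\<close>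
  define T where "T = (?K \<odot> \<one> \<oplus> u) \<otimes> (u \<otimes> (?K \<odot> \<one> \<oplus> u))"
  have Te: "T = ?K\<^sup>2 \<odot> u \<oplus> ((2 * ?K) \<odot> (u \<otimes> u) \<oplus> u \<otimes> (u \<otimes> u))"
    by (simp add: T_def expand smult_collect power2_eq_square)
  have w1: "w \<otimes> (?K \<odot> \<one> \<oplus> u) = (?K \<odot> \<one> \<ominus> w \<otimes> star A w) \<otimes> w"
    by (simp add: expand sw)
  have "T = (-1) \<odot> ((?K \<odot> \<one> \<oplus> u) \<otimes> ((star A w \<otimes> w) \<otimes> (?K \<odot> \<one> \<oplus> u)))"
    by (simp add: T_def sw smult_mult_left smult_mult_right smult_smult)
  also have "\<dots> = (-1) \<odot> (star A (w \<otimes> (?K \<odot> \<one> \<oplus> u)) \<otimes> (w \<otimes> (?K \<odot> \<one> \<oplus> u)))"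
    by (simp add: star_mult star_add star_smult m_assoc)
  finally have T': "T = (-1) \<odot> (star A (w \<otimes> (?K \<odot> \<one> \<oplus> u)) \<otimes> (w \<otimes> (?K \<odot> \<one> \<oplus> u)))" .
  then have "nrm A T = (nrm A (w \<otimes> (?K \<odot> \<one> \<oplus> u)))\<^sup>2"
    by (simp add: nrm_smult cstar_identity)
  also have "\<dots> \<le> (K * nrm A w)\<^sup>2"
    unfolding w1
    by (intro power_mono order.trans[OF nrm_mult] mult_right_mono pos_norm ww K) (auto intro: nrm_nonneg)
  finally have nT: "nrm A T \<le> K\<^sup>2 * N"
    by (simp add: power_mult_distrib nw)
  have sT: "selfadj T"
    unfolding T' by (intro selfadj_smult selfadj_star_mult) auto
  have "pos (complex_of_real (K\<^sup>2 * N) \<odot> \<one> \<ominus> T)" (is "pos ?X")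
    by (intro pos_norm_minus sT nT)
  moreover have "pos (u \<otimes> (u \<otimes> u))"
  proof -
    have "u \<otimes> (u \<otimes> u) = (q \<otimes> u) \<otimes> (q \<otimes> u)"
      by (simp add: u_def m_assoc)
    moreover have "selfadj (q \<otimes> u)"
      by (intro selfadj_mult q su) (simp add: u_def m_assoc)
    ultimately show ?thesis
      using pos_sq by simp
  qed
  \<comment> \<open>Adding 2K (N - u)^2 and u^3 to K^2 N - T cancels the quadratic and the cubic
    term in u. What remains is a positive element linear in u, hence a bound on the norm of
    u.\<close>
  moreover have "pos (complex_of_real (2 * K) \<odot> ((?N \<odot> \<one> \<ominus> u) \<otimes> (?N \<odot> \<one> \<ominus> u)))" (is "pos ?Z")
    using K by (intro pos_smult pos_sq selfadj_minus su selfadj_smult_real) auto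
  ultimately have p: "pos (?X \<oplus> (?Z \<oplus> u \<otimes> (u \<otimes> u)))"
    by (intro pos_add)
  let ?a = "complex_of_real (K\<^sup>2 * N + 2 * K * N\<^sup>2)" and ?b = "complex_of_real (K\<^sup>2 + 4 * K * N)"
  have Z: "?Z \<oplus> u \<otimes> (u \<otimes> u) = (2 * ?K * ?N\<^sup>2) \<odot> \<one> \<oplus> ((- (4 * ?K * ?N)) \<odot> u \<oplus>
      ((2 * ?K) \<odot> (u \<otimes> u) \<oplus> u \<otimes> (u \<otimes> u)))"
    by (simp add: expand smult_collect power2_eq_square mult.assoc)
  have X: "?X = (?K\<^sup>2 * ?N) \<odot> \<one> \<oplus> ((- (?K\<^sup>2)) \<odot> u \<oplus> ((- (2 * ?K)) \<odot> (u \<otimes> u) \<oplus> (-1) \<odot> (u \<otimes> (u \<otimes> u))))"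
    unfolding Te by (simp add: expand)
  have "?X \<oplus> (?Z \<oplus> u \<otimes> (u \<otimes> u)) = ((?K\<^sup>2 * ?N) \<odot> \<one> \<oplus> (2 * ?K * ?N\<^sup>2) \<odot> \<one>) \<oplus>
      (((- (?K\<^sup>2)) \<odot> u \<oplus> (- (4 * ?K * ?N)) \<odot> u) \<oplus>
      (((- (2 * ?K)) \<odot> (u \<otimes> u) \<oplus> (2 * ?K) \<odot> (u \<otimes> u)) \<oplus> ((-1) \<odot> (u \<otimes> (u \<otimes> u)) \<oplus> u \<otimes> (u \<otimes> u))))"
    unfolding X Z by (rule add_interchange4) simp_all
  also have "\<dots> = (?K\<^sup>2 * ?N + 2 * ?K * ?N\<^sup>2) \<odot> \<one> \<oplus> (- (?K\<^sup>2 + 4 * ?K * ?N)) \<odot> u"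
    by (simp add: smult_collect_pair)
  also have "\<dots> = ?a \<odot> \<one> \<ominus> ?b \<odot> u"
    by (simp add: minus_smult smult_smult)
  finally have "pos (?a \<odot> \<one> \<ominus> ?b \<odot> u)"
    using p by simp
  moreover have b: "K\<^sup>2 + 4 * K * N \<ge> 0"
    using K N0 by simp
  then have "pos (?b \<odot> u)"
    using pos_smult[of u] pos_sq[OF q] u_def by blast
  moreover have "K\<^sup>2 * N + 2 * K * N\<^sup>2 \<ge> 0"
    using K N0 by simp
  ultimately have "nrm A (?b \<odot> u) \<le> K\<^sup>2 * N + 2 * K * N\<^sup>2"
    by (intro pos_le_norm)
  then have "(K\<^sup>2 + 4 * K * N) * N \<le> K\<^sup>2 * N + 2 * K * N\<^sup>2"
    using b by (simp only: nrm_smult norm_of_real abs_of_nonneg N_def \<open>u \<in> carrier A\<close>)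
  then have "N = 0"
    using K N0 by (intro real_eq_0_of_quadratic_le)
  then show ?thesis
    using nrm_eq_0[of u] selfadj_sq_eq_0[OF q] by (simp add: N_def u_def)
qed

text \<open>With h = x* x, let r be its absolute value and c = (r - h)/2 its negative part. Then w =
  x c satisfies w* w = -c^3, minus the square of a self-adjoint element, and w w* is positive. By
  \<open>star_mult_neg_sq\<close> this is possible only for c = 0, so h = r.\<close>

lemma pos_star_mult:
  assumes [simp]: "x \<in> carrier A" shows "pos (star A x \<otimes> x)"
proof -
  define h where "h = star A x \<otimes> x"
  have h: "selfadj h"
    unfolding h_def by (rule selfadj_star_mult) simp
  note [simp] = selfadj_in[OF h]
  obtain r where r: "pos r" and rr: "r \<otimes> r = h \<otimes> h"
    and rc: "\<And>z. \<lbrakk>z \<in> carrier A; z \<otimes> (h \<otimes> h) = (h \<otimes> h) \<otimes> z\<rbrakk> \<Longrightarrow> z \<otimes> r = r \<otimes> z"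
    using pos_sqrt[OF pos_sq[OF h]] by metis
  note [simp] = pos_in[OF r]
  obtain s where s: "pos s" and ss: "s \<otimes> s = r"
    and sc: "\<And>z. \<lbrakk>z \<in> carrier A; z \<otimes> r = r \<otimes> z\<rbrakk> \<Longrightarrow> z \<otimes> s = s \<otimes> z"
    using pos_sqrt[OF r] by metis
  note [simp] = pos_in[OF s]
  have hr: "h \<otimes> r = r \<otimes> h"
    by (rule rc) (simp_all add: m_assoc)
  have hs: "h \<otimes> s = s \<otimes> h"
    by (rule sc) (simp_all add: hr)
  have rs: "r \<otimes> s = s \<otimes> r"
    by (rule sc) simp_all
  define c where "c = (1/2) \<odot> (r \<ominus> h)"
  have sac: "selfadj c"
    unfolding c_def using selfadj_smult_real[of "r \<ominus> h" "1/2"] selfadj_minus[OF pos_selfadj[OF r] h] by simp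
  note [simp] = selfadj_in[OF sac]
  have cs: "c \<otimes> s = s \<otimes> c"
    using hs rs by (simp add: c_def expand)
  have rc': "r \<otimes> c = (1/2) \<odot> (r \<otimes> r \<ominus> r \<otimes> h)"
    by (simp add: c_def expand)
  have "c \<otimes> c = (1/4) \<odot> (r \<otimes> r \<oplus> (r \<otimes> r \<oplus> ((-1) \<odot> (r \<otimes> h) \<oplus> (-1) \<odot> (r \<otimes> h))))"
    by (simp add: c_def expand hr rr a_ac)
  also have "\<dots> = r \<otimes> c"
    by (simp add: rc' expand smult_collect)
  finally have cc: "c \<otimes> c = r \<otimes> c" .
  have "h \<otimes> c = (-1) \<odot> (r \<otimes> c)"
    unfolding rc' by (simp add: c_def expand hr rr a_ac)
  then have hc: "h \<otimes> c = (-1) \<odot> (c \<otimes> c)"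
    by (simp add: cc)
  define w where "w = x \<otimes> c"
  \<comment> \<open>An explicit self-adjoint root of c^3: from s s = r and c c = r c, all factors
    commuting, (s c)(s c) = r c c = c^3.\<close>
  define q where "q = s \<otimes> c"
  have [simp]: "w \<in> carrier A" by (simp add: w_def)
  have q: "selfadj q"
    unfolding q_def by (intro selfadj_mult pos_selfadj s sac) (simp add: cs)
  note [simp] = selfadj_in[OF q]
  have qq: "q \<otimes> q = c \<otimes> (c \<otimes> c)"
  proof -
    have "q \<otimes> q = s \<otimes> ((c \<otimes> s) \<otimes> c)"
      by (simp add: q_def m_assoc)
    also have "\<dots> = (s \<otimes> s) \<otimes> (c \<otimes> c)"
      unfolding cs by (simp add: m_assoc)
    also have "\<dots> = (r \<otimes> c) \<otimes> c"
      by (simp add: ss m_assoc)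
    also have "\<dots> = c \<otimes> (c \<otimes> c)"
      by (simp add: cc[symmetric] m_assoc)
    finally show ?thesis .
  qed
  have wq: "star A w \<otimes> w = \<ominus> (q \<otimes> q)"
  proof -
    have "star A w \<otimes> w = c \<otimes> (h \<otimes> c)"
      by (simp add: w_def h_def star_mult selfadj_star[OF sac] m_assoc)
    also have "\<dots> = \<ominus> (q \<otimes> q)"
      by (simp add: hc qq uminus_smult smult_mult_right)
    finally show ?thesis .
  qed
  \<comment> \<open>Twice the real part and minus twice the imaginary part of w. Their squares add
    up to 2 w w* + 2 w* w, and w* w = -q q, so w w* is a combination of squares with positive
    coefficients.\<close>
  define p n where "p = w \<oplus> star A w" and "n = \<i> \<odot> (w \<ominus> star A w)"
  have sp: "selfadj p"
    unfolding p_def by (rule selfadj_add_star) simp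
  have sn: "selfadj n"
    unfolding n_def by (rule selfadj_minus_star) simp
  note [simp] = selfadj_in[OF sp] selfadj_in[OF sn]
  have pp: "p \<otimes> p = w \<otimes> w \<oplus> (star A w \<otimes> w \<oplus> (w \<otimes> star A w \<oplus> star A w \<otimes> star A w))"
    by (simp add: p_def expand)
  have nn: "n \<otimes> n = (-1) \<odot> (w \<otimes> w) \<oplus> (star A w \<otimes> w \<oplus> (w \<otimes> star A w \<oplus> (-1) \<odot> (star A w \<otimes> star A w)))"
    by (simp add: n_def expand)
  have "p \<otimes> p \<oplus> n \<otimes> n = (w \<otimes> w \<oplus> (-1) \<odot> (w \<otimes> w)) \<oplus> ((star A w \<otimes> w \<oplus> star A w \<otimes> w) \<oplus>
      ((w \<otimes> star A w \<oplus> w \<otimes> star A w) \<oplus> (star A w \<otimes> star A w \<oplus> (-1) \<odot> (star A w \<otimes> star A w))))"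
    unfolding pp nn by (rule add_interchange4) simp_all
  also have "\<dots> = 2 \<odot> (star A w \<otimes> w) \<oplus> 2 \<odot> (w \<otimes> star A w)"
    by (simp add: smult_collect)
  also have "\<dots> = 2 \<odot> (w \<otimes> star A w) \<oplus> 2 \<odot> (star A w \<otimes> w)"
    by (rule a_comm) simp_all
  finally have pn: "p \<otimes> p \<oplus> n \<otimes> n = 2 \<odot> (w \<otimes> star A w) \<oplus> (-2) \<odot> (q \<otimes> q)"
    by (simp add: wq uminus_smult smult_smult)
  have "w \<otimes> star A w = complex_of_real (1/2) \<odot> (p \<otimes> p \<oplus> n \<otimes> n) \<oplus> q \<otimes> q"
  proof -
    have "X = complex_of_real (1/2) \<odot> (2 \<odot> X \<oplus> (-2) \<odot> Y) \<oplus> Y" if "X \<in> carrier A" "Y \<in> carrier A" for X Y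
      using that by (simp add: smult_add_right smult_smult a_assoc smult_collect_pair)
    then show ?thesis
      unfolding pn by simp
  qed
  then have ww: "pos (w \<otimes> star A w)"
    by (rule ssubst) (intro pos_add pos_smult pos_sq sp sn q, simp)
  have "q = \<zero>"
    by (rule star_mult_neg_sq[OF _ q wq ww]) simp
  \<comment> \<open>Vanishing descends through squares only, so the cube is first raised to the
    fourth power of c.\<close>
  then have "c \<otimes> (c \<otimes> c) = \<zero>"
    using qq by simp
  then have "(c \<otimes> c) \<otimes> (c \<otimes> c) = \<zero>"
    by (simp add: m_assoc)
  then have "c \<otimes> c = \<zero>"
    by (rule selfadj_sq_eq_0[OF selfadj_mult[OF sac sac refl]])
  then have "c = \<zero>"
    by (rule selfadj_sq_eq_0[OF sac])
  then have "2 \<odot> c = \<zero>"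
    by simp
  then have "r \<ominus> h = \<zero>"
    by (simp add: c_def smult_smult)
  then have "r = h"
    by (simp add: minus_eq_zero_iff)
  then show ?thesis
    using r by (simp add: h_def)
qed

text \<open>Makes contractivity readable from an identity: positive maps deliver their values in the
  form u* u, and 1 - b* b appears as a sum of two of them.\<close>

lemma nrm_le_one_of_star_sum:
  assumes [simp]: "b \<in> carrier A" "u \<in> carrier A" "v \<in> carrier A"
    and "star A b \<otimes> b \<oplus> (star A u \<otimes> u \<oplus> star A v \<otimes> v) = \<one>"
  shows "nrm A b \<le> 1"
proof -
  have "complex_of_real 1 \<odot> \<one> \<ominus> star A b \<otimes> b = star A u \<otimes> u \<oplus> star A v \<otimes> v"
    unfolding assms(4)[symmetric] using a_comm[of "star A b \<otimes> b" "star A u \<otimes> u \<oplus> star A v \<otimes> v"]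
    by (simp add: minus_eq a_assoc r_neg)
  then have "nrm A (star A b \<otimes> b) \<le> 1"
    using pos_le_norm[of "star A b \<otimes> b" 1] pos_star_mult pos_add by simp
  then have "(nrm A b)\<^sup>2 \<le> 1\<^sup>2"
    by (simp add: cstar_identity)
  then show ?thesis
    by (rule power2_le_imp_le) simp
qed

end

section \<open>Homomorphisms and positive left inverses\<close>

lemma linear_map_in: "\<lbrakk>linear_map A B f; x \<in> carrier A\<rbrakk> \<Longrightarrow> f x \<in> carrier B"
  by (auto simp: linear_map_def)

lemma linear_map_add: "\<lbrakk>linear_map A B f; x \<in> carrier A; y \<in> carrier A\<rbrakk> \<Longrightarrow> f (x \<oplus>\<^bsub>A\<^esub> y) = f x \<oplus>\<^bsub>B\<^esub> f y"
  by (simp add: linear_map_def)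

lemma linear_map_smult: "\<lbrakk>linear_map A B f; x \<in> carrier A\<rbrakk> \<Longrightarrow> f (c \<odot>\<^bsub>A\<^esub> x) = c \<odot>\<^bsub>B\<^esub> f x"
  by (simp add: linear_map_def)

lemma linear_map_minus:
  assumes "pre_cstar_algebra A" "pre_cstar_algebra B" "linear_map A B f" "x \<in> carrier A" "y \<in> carrier A"
  shows "f (x \<ominus>\<^bsub>A\<^esub> y) = f x \<ominus>\<^bsub>B\<^esub> f y"
proof -
  interpret A: pre_cstar_algebra A by fact
  interpret B: pre_cstar_algebra B by fact
  show ?thesis
    using assms(3-) by (simp add: A.minus_smult B.minus_smult linear_map_in linear_map_add linear_map_smult)
qed

lemma linear_map_zero:
  assumes "pre_cstar_algebra A" "pre_cstar_algebra B" "linear_map A B f"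
  shows "f \<zero>\<^bsub>A\<^esub> = \<zero>\<^bsub>B\<^esub>"
proof -
  interpret A: pre_cstar_algebra A by fact
  interpret B: pre_cstar_algebra B by fact
  show ?thesis
    using linear_map_smult[OF assms(3), of "\<zero>\<^bsub>A\<^esub>" 0] linear_map_in[OF assms(3), of "\<zero>\<^bsub>A\<^esub>"] by simp
qed

lemma star_hom_linear: "star_hom A B f \<Longrightarrow> linear_map A B f"
  by (simp add: star_hom_def)

lemma star_hom_mult: "\<lbrakk>star_hom A B f; x \<in> carrier A; y \<in> carrier A\<rbrakk> \<Longrightarrow> f (x \<otimes>\<^bsub>A\<^esub> y) = f x \<otimes>\<^bsub>B\<^esub> f y"
  by (simp add: star_hom_def)

lemma star_hom_star: "\<lbrakk>star_hom A B f; x \<in> carrier A\<rbrakk> \<Longrightarrow> f (star A x) = star B (f x)"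
  by (simp add: star_hom_def)

lemma conv_bounded_linear:
  assumes "pre_cstar_algebra A" "pre_cstar_algebra B" and f: "linear_map A B f"
    and K: "\<And>x. x \<in> carrier A \<Longrightarrow> nrm B (f x) \<le> K * nrm A x"
    and g: "pre_cstar_algebra.conv A g x F"
  shows "pre_cstar_algebra.conv B (\<lambda>i. f (g i)) (f x) F"
proof -
  interpret A: pre_cstar_algebra A by fact
  interpret B: pre_cstar_algebra B by fact
  have x: "x \<in> carrier A" and ev: "\<forall>\<^sub>F i in F. g i \<in> carrier A"
    using g by (auto simp: A.conv_def)
  show ?thesis
  proof (rule B.conv_bound)
    show "f x \<in> carrier B"
      using f x by (rule linear_map_in)
    show "\<forall>\<^sub>F i in F. f (g i) \<in> carrier B"
      using ev by eventually_elim (rule linear_map_in[OF f])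
    show "\<forall>\<^sub>F i in F. nrm B (f (g i) \<ominus>\<^bsub>B\<^esub> f x) \<le> K * nrm A (g i \<ominus>\<^bsub>A\<^esub> x)"
      using ev
    proof eventually_elim
      case (elim i)
      then show ?case
        using K[of "g i \<ominus>\<^bsub>A\<^esub> x"] x linear_map_minus[OF assms(1,2) f elim x] by simp
    qed
    show "((\<lambda>i. K * nrm A (g i \<ominus>\<^bsub>A\<^esub> x)) \<longlongrightarrow> 0) F"
      using tendsto_mult_left[of "\<lambda>i. nrm A (g i \<ominus>\<^bsub>A\<^esub> x)" 0 F K] g by (simp add: A.conv_def)
  qed
qed

text \<open>A self-adjoint contraction is the real part of a unitary, and homomorphisms map unitaries to partial
  isometries.\<close>

lemma star_hom_contractive:
  fixes A :: "'a star_normed" (structure)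
  assumes "unital_cstar_algebra A" "pre_cstar_algebra B" and f: "star_hom A B f" and x: "x \<in> carrier A"
  shows "nrm B (f x) \<le> nrm A x"
proof -
  interpret A: unital_cstar_algebra A by fact
  interpret B: pre_cstar_algebra B by fact
  note lin = star_hom_linear[OF f]
  note [simp] = linear_map_in[OF lin]
  have sa: "B.selfadj (f h)" if "A.selfadj h" for h
    using that star_hom_star[OF f, of h] by (simp add: A.selfadj_def B.selfadj_def)
  \<comment> \<open>Unitality of f is not assumed, but f maps the unit to a projection, whose norm
    is 0 or 1.\<close>
  have one: "nrm B (f \<one>) \<le> 1"
  proof -
    have "f \<one> \<otimes>\<^bsub>B\<^esub> f \<one> = f \<one>"
      by (simp flip: star_hom_mult[OF f])
    then have "nrm B (f \<one>) * nrm B (f \<one>) = 1 * nrm B (f \<one>)"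
      using B.nrm_selfadj_sq[OF sa[OF A.selfadj_one]] by (simp add: power2_eq_square)
    then show ?thesis
      by (metis mult_cancel_right zero_le_one order.refl)
  qed
  have *: "nrm B (f h) \<le> 1" if h: "A.selfadj h" and le: "nrm A h \<le> 1" for h
  proof -
    note [simp] = A.selfadj_in[OF h]
    have "nrm A (h \<otimes> h) \<le> 1"
      using le A.nrm_nonneg[of h] by (simp add: A.nrm_selfadj_sq[OF h] power_le_one)
    then obtain y where y: "A.selfadj y" "y \<otimes> y = \<one> \<ominus> h \<otimes> h"
      and comm: "\<And>z. \<lbrakk>z \<in> carrier A; z \<otimes> (h \<otimes> h) = (h \<otimes> h) \<otimes> z\<rbrakk> \<Longrightarrow> z \<otimes> y = y \<otimes> z"
      using A.ex_sqrt_one_minus[OF A.selfadj_mult[OF h h refl]] by metis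
    note [simp] = A.selfadj_in[OF y(1)]
    have hy: "h \<otimes> y = y \<otimes> h"
      by (rule comm) (simp_all add: A.m_assoc)
    have "f h \<otimes>\<^bsub>B\<^esub> f y = f y \<otimes>\<^bsub>B\<^esub> f h"
      by (simp add: hy flip: star_hom_mult[OF f])
    then have "(nrm B (f h))\<^sup>2 \<le> nrm B (f h \<otimes>\<^bsub>B\<^esub> f h \<oplus>\<^bsub>B\<^esub> f y \<otimes>\<^bsub>B\<^esub> f y)"
      by (intro B.nrm_commuting_sq_le sa h y)
    also have "f h \<otimes>\<^bsub>B\<^esub> f h \<oplus>\<^bsub>B\<^esub> f y \<otimes>\<^bsub>B\<^esub> f y = f (h \<otimes> h \<oplus> y \<otimes> y)"
      by (simp add: linear_map_add[OF lin] star_hom_mult[OF f])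
    also have "h \<otimes> h \<oplus> y \<otimes> y = y \<otimes> y \<oplus> h \<otimes> h"
      by (simp add: A.a_comm)
    also have "\<dots> = \<one>"
      unfolding y(2) by (simp add: A.expand A.smult_collect)
    finally have "(nrm B (f h))\<^sup>2 \<le> 1\<^sup>2"
      using one by simp
    then show ?thesis
      by (rule power2_le_imp_le) simp
  qed
  show ?thesis
  proof (cases "nrm A x = 0")
    case True
    then have "x = \<zero>"
      using x by (simp add: A.nrm_eq_0)
    then show ?thesis
      using linear_map_zero[OF A.pre_cstar_algebra_axioms assms(2) lin] by simp
  next
    case False
    then have c: "nrm A x > 0"
      using A.nrm_nonneg[OF x] by simp
    define y where "y = complex_of_real (1 / nrm A x) \<odot> x"
    have y: "y \<in> carrier A"
      using x by (simp add: y_def)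
    have "nrm A y = 1"
      using x c by (simp add: y_def A.nrm_smult norm_divide)
    then have "nrm B (f (star A y \<otimes> y)) \<le> 1"
      using * A.selfadj_star_mult[OF y] A.cstar_identity[OF y] by simp
    then have "(nrm B (f y))\<^sup>2 \<le> 1\<^sup>2"
      using y B.cstar_identity[of "f y"] by (simp add: star_hom_mult[OF f] star_hom_star[OF f])
    then have "nrm B (f y) \<le> 1"
      by (rule power2_le_imp_le) simp
    then show ?thesis
      using x c by (simp add: y_def linear_map_smult[OF lin] B.nrm_smult norm_divide)
  qed
qed

text \<open>If \<^term>\<open>f h\<close> is a contraction, then \<^term>\<open>f\<close> maps \<^term>\<open>m = \<one>\<^bsub>A\<^esub> \<ominus>\<^bsub>A\<^esub> h \<otimes>\<^bsub>A\<^esub> h\<close> and its absolute value \<^term>\<open>r\<close>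
  to the same element, by uniqueness of positive square roots.\<close>

lemma star_hom_isometric:
  fixes A :: "'a star_normed" (structure)
  assumes "unital_cstar_algebra A" "unital_cstar_algebra B" and f: "star_hom A B f"
    and inj: "inj_on f (carrier A)" and x: "x \<in> carrier A"
  shows "nrm B (f x) = nrm A x"
proof -
  interpret A: unital_cstar_algebra A by fact
  interpret B: unital_cstar_algebra B by fact
  note lin = star_hom_linear[OF f]
  note [simp] = linear_map_in[OF lin]
  note mult = star_hom_mult[OF f] and minus = linear_map_minus[OF A.pre_cstar_algebra_axioms B.pre_cstar_algebra_axioms lin]
  note zero = linear_map_zero[OF A.pre_cstar_algebra_axioms B.pre_cstar_algebra_axioms lin]
  have sa: "B.selfadj (f h)" if "A.selfadj h" for h
    using that star_hom_star[OF f, of h] by (simp add: A.selfadj_def B.selfadj_def)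
  have *: "nrm A h \<le> 1" if h: "A.selfadj h" and le: "nrm B (f h) \<le> 1" for h
  proof -
    note [simp] = A.selfadj_in[OF h]
    define k where "k = h \<otimes> h"
    have k: "A.selfadj k"
      unfolding k_def by (rule A.selfadj_mult[OF h h refl])
    note [simp] = A.selfadj_in[OF k]
    define m where "m = \<one> \<ominus> k"
    have m: "A.selfadj m"
      unfolding m_def by (rule A.selfadj_minus[OF A.selfadj_one k])
    note [simp] = A.selfadj_in[OF m]
    obtain r where r: "A.pos r" and rr: "r \<otimes> r = m \<otimes> m"
      and rc: "\<And>z. \<lbrakk>z \<in> carrier A; z \<otimes> (m \<otimes> m) = (m \<otimes> m) \<otimes> z\<rbrakk> \<Longrightarrow> z \<otimes> r = r \<otimes> z"
      using A.pos_sqrt[OF A.pos_sq[OF m]] by metis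
    note [simp] = A.pos_in[OF r]
    obtain s where s: "A.pos s" and ss: "s \<otimes> s = r"
      and sc: "\<And>z. \<lbrakk>z \<in> carrier A; z \<otimes> r = r \<otimes> z\<rbrakk> \<Longrightarrow> z \<otimes> s = s \<otimes> z"
      using A.pos_sqrt[OF r] by metis
    note [simp] = A.pos_in[OF s]
    note sas = A.pos_selfadj[OF s]
    have cr: "z \<otimes> r = r \<otimes> z" if z: "z \<in> carrier A" "z \<otimes> m = m \<otimes> z" for z
    proof (rule rc[OF z(1)])
      have "z \<otimes> (m \<otimes> m) = (m \<otimes> z) \<otimes> m"
        using z by (simp flip: A.m_assoc)
      also have "\<dots> = (m \<otimes> m) \<otimes> z"
        using z by (simp add: A.m_assoc)
      finally show "z \<otimes> (m \<otimes> m) = (m \<otimes> m) \<otimes> z" .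
    qed
    have hm: "h \<otimes> m = m \<otimes> h"
      by (simp add: m_def k_def A.expand)
    have mr: "m \<otimes> r = r \<otimes> m" and hr: "h \<otimes> r = r \<otimes> h"
      using cr[of m] cr[OF _ hm] by simp_all
    have ms: "m \<otimes> s = s \<otimes> m" and hs: "h \<otimes> s = s \<otimes> h" and rs: "r \<otimes> s = s \<otimes> r"
      using sc[OF _ mr] sc[OF _ hr] sc[of r] by simp_all
    define b where "b = f k"
    have b: "B.selfadj b"
      unfolding b_def by (rule sa[OF k])
    note [simp] = B.selfadj_in[OF b]
    have "nrm B b \<le> 1"
      using le B.nrm_nonneg[of "f h"] B.nrm_selfadj_sq[OF sa[OF h]]
      by (simp add: b_def k_def mult power_le_one)
    with b obtain q where q: "B.selfadj q" "q \<otimes>\<^bsub>B\<^esub> q = \<one>\<^bsub>B\<^esub> \<ominus>\<^bsub>B\<^esub> b"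
      and qc: "\<And>z. \<lbrakk>z \<in> carrier B; z \<otimes>\<^bsub>B\<^esub> b = b \<otimes>\<^bsub>B\<^esub> z\<rbrakk> \<Longrightarrow> z \<otimes>\<^bsub>B\<^esub> q = q \<otimes>\<^bsub>B\<^esub> z"
      using B.ex_sqrt_one_minus by metis
    note [simp] = B.selfadj_in[OF q(1)]
    define e where "e = f \<one>"
    have e: "B.selfadj e"
      unfolding e_def by (rule sa) simp
    note [simp] = B.selfadj_in[OF e]
    have e1: "e \<otimes>\<^bsub>B\<^esub> f z = f z" "f z \<otimes>\<^bsub>B\<^esub> e = f z" if "z \<in> carrier A" for z
      using that by (simp_all add: e_def flip: mult)
    have eq: "e \<otimes>\<^bsub>B\<^esub> q = q \<otimes>\<^bsub>B\<^esub> e"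
      by (rule qc) (simp_all add: b_def e1)
    have ee: "e \<otimes>\<^bsub>B\<^esub> e = e"
      using e1[of "\<one>"] by (simp add: e_def)
    \<comment> \<open>As f may fail to be unital, f m is e - b and not 1 - b. The projection e
      commutes with the root q of 1 - b, and e q is a root of e - b.\<close>
    define p where "p = e \<otimes>\<^bsub>B\<^esub> q"
    have p: "B.selfadj p"
      unfolding p_def by (rule B.selfadj_mult[OF e q(1) eq])
    note [simp] = B.selfadj_in[OF p]
    have "p \<otimes>\<^bsub>B\<^esub> p = e \<otimes>\<^bsub>B\<^esub> ((q \<otimes>\<^bsub>B\<^esub> e) \<otimes>\<^bsub>B\<^esub> q)"
      by (simp add: p_def B.m_assoc)
    also have "\<dots> = (e \<otimes>\<^bsub>B\<^esub> e) \<otimes>\<^bsub>B\<^esub> (q \<otimes>\<^bsub>B\<^esub> q)"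
      unfolding eq[symmetric] by (simp add: B.m_assoc)
    also have "\<dots> = e \<ominus>\<^bsub>B\<^esub> b"
      unfolding ee q(2) by (simp add: B.expand b_def e1)
    also have "\<dots> = f m"
      by (simp add: m_def minus e_def b_def)
    finally have pp: "p \<otimes>\<^bsub>B\<^esub> p = f m" .
    have fp: "f z \<otimes>\<^bsub>B\<^esub> p = p \<otimes>\<^bsub>B\<^esub> f z" if z: "z \<in> carrier A" "z \<otimes> m = m \<otimes> z" for z
    proof -
      have kz: "k = \<one> \<ominus> m"
        by (simp add: m_def A.expand A.smult_collect)
      have "z \<otimes> k = k \<otimes> z"
        using z by (simp add: kz A.expand)
      then have qz: "f z \<otimes>\<^bsub>B\<^esub> q = q \<otimes>\<^bsub>B\<^esub> f z"
        using z by (intro qc) (simp_all add: b_def flip: mult)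
      have "f z \<otimes>\<^bsub>B\<^esub> p = (f z \<otimes>\<^bsub>B\<^esub> e) \<otimes>\<^bsub>B\<^esub> q"
        using z by (simp add: p_def B.m_assoc)
      also have "\<dots> = (e \<otimes>\<^bsub>B\<^esub> f z) \<otimes>\<^bsub>B\<^esub> q"
        using z by (simp add: e1)
      also have "\<dots> = e \<otimes>\<^bsub>B\<^esub> (q \<otimes>\<^bsub>B\<^esub> f z)"
        using z by (simp add: B.m_assoc qz)
      also have "\<dots> = p \<otimes>\<^bsub>B\<^esub> f z"
        using z by (simp add: p_def B.m_assoc)
      finally show ?thesis .
    qed
    \<comment> \<open>The goal is f D = 0. Since r and m commute and have the same square, (r + m) D
      = 0.\<close>
    define D where "D = r \<ominus> m"
    have D: "A.selfadj D"
      unfolding D_def by (rule A.selfadj_minus[OF A.pos_selfadj[OF r] m])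
    note [simp] = A.selfadj_in[OF D]
    have rmD: "(r \<oplus> m) \<otimes> D = \<zero>"
    proof -
      have "(r \<oplus> m) \<otimes> D = (m \<otimes> m \<oplus> (-1) \<odot> (m \<otimes> m)) \<oplus> (r \<otimes> m \<oplus> (-1) \<odot> (r \<otimes> m))"
        by (simp add: D_def A.expand mr rr A.a_ac)
      then show ?thesis
        by (simp add: A.smult_collect_pair)
    qed
    have sD: "s \<otimes> D = D \<otimes> s" and mD: "D \<otimes> m = m \<otimes> D"
      by (simp_all add: D_def A.expand ms rs mr)
    define d where "d = f D"
    have d: "B.selfadj d"
      unfolding d_def by (rule sa[OF D])
    note [simp] = B.selfadj_in[OF d]
    have "A.selfadj (s \<otimes> D)"
      by (rule A.selfadj_mult[OF sas D sD])
    then have X: "B.selfadj (f s \<otimes>\<^bsub>B\<^esub> d)"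
      using sa[of "s \<otimes> D"] by (simp add: d_def mult)
    have pd: "p \<otimes>\<^bsub>B\<^esub> d = d \<otimes>\<^bsub>B\<^esub> p"
      using fp[of D] mD by (simp add: d_def)
    have Y: "B.selfadj (p \<otimes>\<^bsub>B\<^esub> d)"
      by (rule B.selfadj_mult[OF p d pd])
    have fs: "f s \<otimes>\<^bsub>B\<^esub> p = p \<otimes>\<^bsub>B\<^esub> f s"
      by (rule fp) (simp_all add: ms)
    have sd: "f s \<otimes>\<^bsub>B\<^esub> d = d \<otimes>\<^bsub>B\<^esub> f s"
      using sD by (simp add: d_def flip: mult)
    have XY: "(f s \<otimes>\<^bsub>B\<^esub> d) \<otimes>\<^bsub>B\<^esub> (p \<otimes>\<^bsub>B\<^esub> d) = (p \<otimes>\<^bsub>B\<^esub> d) \<otimes>\<^bsub>B\<^esub> (f s \<otimes>\<^bsub>B\<^esub> d)"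
    proof -
      have "(f s \<otimes>\<^bsub>B\<^esub> d) \<otimes>\<^bsub>B\<^esub> (p \<otimes>\<^bsub>B\<^esub> d) = f s \<otimes>\<^bsub>B\<^esub> ((d \<otimes>\<^bsub>B\<^esub> p) \<otimes>\<^bsub>B\<^esub> d)"
        by (simp add: B.m_assoc)
      also have "\<dots> = (f s \<otimes>\<^bsub>B\<^esub> p) \<otimes>\<^bsub>B\<^esub> (d \<otimes>\<^bsub>B\<^esub> d)"
        unfolding pd[symmetric] by (simp add: B.m_assoc)
      also have "\<dots> = p \<otimes>\<^bsub>B\<^esub> ((f s \<otimes>\<^bsub>B\<^esub> d) \<otimes>\<^bsub>B\<^esub> d)"
        unfolding fs by (simp add: B.m_assoc)
      also have "\<dots> = (p \<otimes>\<^bsub>B\<^esub> d) \<otimes>\<^bsub>B\<^esub> (f s \<otimes>\<^bsub>B\<^esub> d)"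
        by (subst (1) sd) (simp add: B.m_assoc)
      finally show ?thesis .
    qed
    have X2: "(f s \<otimes>\<^bsub>B\<^esub> d) \<otimes>\<^bsub>B\<^esub> (f s \<otimes>\<^bsub>B\<^esub> d) = d \<otimes>\<^bsub>B\<^esub> (f r \<otimes>\<^bsub>B\<^esub> d)"
      by (subst (1) sd) (simp add: ss[symmetric] mult B.m_assoc)
    have Y2: "(p \<otimes>\<^bsub>B\<^esub> d) \<otimes>\<^bsub>B\<^esub> (p \<otimes>\<^bsub>B\<^esub> d) = d \<otimes>\<^bsub>B\<^esub> (f m \<otimes>\<^bsub>B\<^esub> d)"
      by (subst (1) pd) (simp add: pp[symmetric] B.m_assoc)
    have "d \<otimes>\<^bsub>B\<^esub> (f r \<otimes>\<^bsub>B\<^esub> d) \<oplus>\<^bsub>B\<^esub> d \<otimes>\<^bsub>B\<^esub> (f m \<otimes>\<^bsub>B\<^esub> d) = d \<otimes>\<^bsub>B\<^esub> f ((r \<oplus> m) \<otimes> D)"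
      by (simp add: d_def mult linear_map_add[OF lin] B.expand)
    \<comment> \<open>The squares of f s d and p d are d (f r) d and d (f m) d, whose sum is d f((r
      + m) D) = 0. The two elements are self-adjoint and commute, so both vanish, and d d = (f r) d
      - (f m) d vanishes too.\<close>
    then have XY0: "(f s \<otimes>\<^bsub>B\<^esub> d) \<otimes>\<^bsub>B\<^esub> (f s \<otimes>\<^bsub>B\<^esub> d) \<oplus>\<^bsub>B\<^esub> (p \<otimes>\<^bsub>B\<^esub> d) \<otimes>\<^bsub>B\<^esub> (p \<otimes>\<^bsub>B\<^esub> d) = \<zero>\<^bsub>B\<^esub>"
      by (simp add: X2 Y2 rmD zero)
    have "(nrm B (f s \<otimes>\<^bsub>B\<^esub> d))\<^sup>2 \<le> 0"
      using B.nrm_commuting_sq_le[OF X Y XY] by (simp add: XY0)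
    then have X0: "f s \<otimes>\<^bsub>B\<^esub> d = \<zero>\<^bsub>B\<^esub>"
      by (simp add: B.nrm_eq_0)
    have "(nrm B (p \<otimes>\<^bsub>B\<^esub> d))\<^sup>2 \<le> 0"
      using B.nrm_commuting_sq_le[OF Y X XY[symmetric]] XY0 by (simp add: B.a_comm)
    then have Y0: "p \<otimes>\<^bsub>B\<^esub> d = \<zero>\<^bsub>B\<^esub>"
      by (simp add: B.nrm_eq_0)
    have "d \<otimes>\<^bsub>B\<^esub> d = f r \<otimes>\<^bsub>B\<^esub> d \<ominus>\<^bsub>B\<^esub> f m \<otimes>\<^bsub>B\<^esub> d"
      by (subst (1) d_def) (simp add: D_def minus B.expand)
    also have "f r \<otimes>\<^bsub>B\<^esub> d = f s \<otimes>\<^bsub>B\<^esub> (f s \<otimes>\<^bsub>B\<^esub> d)"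
      by (simp add: ss[symmetric] mult B.m_assoc)
    also have "f m \<otimes>\<^bsub>B\<^esub> d = p \<otimes>\<^bsub>B\<^esub> (p \<otimes>\<^bsub>B\<^esub> d)"
      by (simp add: pp[symmetric] B.m_assoc)
    finally have "d \<otimes>\<^bsub>B\<^esub> d = \<zero>\<^bsub>B\<^esub>"
      by (simp add: X0 Y0 B.minus_eq)
    then have "d = \<zero>\<^bsub>B\<^esub>"
      by (rule B.selfadj_sq_eq_0[OF d])
    then have "f D = f \<zero>"
      by (simp add: d_def zero)
    then have "D = \<zero>"
      using inj by (simp add: inj_on_def)
    then have "r = m"
      by (simp add: D_def A.minus_eq_zero_iff)
    \<comment> \<open>Now 1 - h h is the square of s, which commutes with h, so h has norm at most
      1.\<close>
    then have sm: "s \<otimes> s = \<one> \<ominus> k"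
      by (simp add: ss m_def)
    have "(nrm A h)\<^sup>2 \<le> nrm A (h \<otimes> h \<oplus> s \<otimes> s)"
      by (rule A.nrm_commuting_sq_le[OF h sas hs])
    also have "h \<otimes> h \<oplus> s \<otimes> s = \<one>"
      unfolding sm k_def[symmetric] using A.a_comm[of k "\<one> \<ominus> k"] by (simp add: A.expand A.smult_collect)
    finally have "(nrm A h)\<^sup>2 \<le> 1\<^sup>2"
      by (simp add: A.nrm_one)
    then show ?thesis
      by (rule power2_le_imp_le) simp
  qed
  have "nrm A x \<le> nrm B (f x)"
  proof (cases "nrm B (f x) = 0")
    case True
    then have "f x = f \<zero>"
      using x by (simp add: B.nrm_eq_0 zero)
    then have "x = \<zero>"
      using x inj by (simp add: inj_on_def)
    then show ?thesis
      by (simp add: zero)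
  next
    case False
    then have c: "nrm B (f x) > 0"
      using B.nrm_nonneg[of "f x"] x by simp
    define y where "y = complex_of_real (1 / nrm B (f x)) \<odot> x"
    have y: "y \<in> carrier A"
      using x by (simp add: y_def)
    have "nrm B (f y) = 1"
      using x c by (simp add: y_def linear_map_smult[OF lin] B.nrm_smult norm_divide)
    then have "nrm B (f (star A y \<otimes> y)) = 1"
      using y B.cstar_identity[of "f y"] by (simp add: mult star_hom_star[OF f])
    then have "nrm A (star A y \<otimes> y) \<le> 1"
      by (intro * A.selfadj_star_mult y) simp
    then have "(nrm A y)\<^sup>2 \<le> 1\<^sup>2"
      using y by (simp add: A.cstar_identity)
    then have "nrm A y \<le> 1"
      by (rule power2_le_imp_le) simp
    then show ?thesis
      using x c by (simp add: y_def A.nrm_smult norm_divide)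
  qed
  then show ?thesis
    using star_hom_contractive[OF assms(1) B.pre_cstar_algebra_axioms f x] by simp
qed

section \<open>Positive maps\<close>

context unital_cstar_algebra
begin

text \<open>Elements x* x are self-adjoint, and so are their images. A self-adjoint h is half the
  difference of (h + 1)^2 and h^2 + 1, both covered by this; a general element is split into real
  and imaginary part.\<close>

lemma positive_map_star:
  assumes lin: "linear_map A A f" and pos: "f ` positive_elements A \<subseteq> positive_elements A"
    and x: "x \<in> carrier A"
  shows "f (star A x) = star A (f x)"
proof -
  note [simp] = linear_map_in[OF lin] x
  have fpos: "star A (f (star A y \<otimes> y)) = f (star A y \<otimes> y)" if "y \<in> carrier A" for y
  proof -
    have "f (star A y \<otimes> y) \<in> positive_elements A"
      using pos that by (auto simp: positive_elements_def)
    then show ?thesis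
      by (auto simp: positive_elements_def star_mult)
  qed
  have sa: "selfadj (f h)" if h: "selfadj h" for h
  proof -
    note [simp] = selfadj_in[OF h]
    have "star A (h \<oplus> \<one>) \<otimes> (h \<oplus> \<one>) = (h \<otimes> h \<oplus> \<one>) \<oplus> 2 \<odot> h"
      by (simp add: star_add selfadj_star[OF h] expand a_ac smult_collect)
    moreover have "star A h \<otimes> h \<oplus> star A \<one> \<otimes> \<one> = h \<otimes> h \<oplus> \<one>"
      by (simp add: selfadj_star[OF h])
    moreover have "(a \<oplus> b) \<ominus> a = b" if "a \<in> carrier A" "b \<in> carrier A" for a b
      using a_comm[of a b] that by (simp add: minus_eq a_assoc r_neg)
    then have "((h \<otimes> h \<oplus> \<one>) \<oplus> 2 \<odot> h) \<ominus> (h \<otimes> h \<oplus> \<one>) = 2 \<odot> h"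
      by simp
    ultimately have "2 \<odot> h = star A (h \<oplus> \<one>) \<otimes> (h \<oplus> \<one>) \<ominus> (star A h \<otimes> h \<oplus> star A \<one> \<otimes> \<one>)"
      by simp
    then have "f (2 \<odot> h) = f (star A (h \<oplus> \<one>) \<otimes> (h \<oplus> \<one>)) \<ominus> (f (star A h \<otimes> h) \<oplus> f (star A \<one> \<otimes> \<one>))"
      using linear_map_minus[OF pre_cstar_algebra_axioms pre_cstar_algebra_axioms lin] linear_map_add[OF lin]
      by simp
    then have "star A (f (2 \<odot> h)) = f (2 \<odot> h)"
      using fpos[of h] fpos[of \<one>] fpos[of "h \<oplus> \<one>"]
      by (simp only: star_minus star_add fpos linear_map_in[OF lin] star_in m_closed a_closed one_closed
          selfadj_in[OF h])
    then have "(1/2) \<odot> star A (f (2 \<odot> h)) = (1/2) \<odot> f (2 \<odot> h)"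
      by simp
    then show ?thesis
      by (simp add: selfadj_def linear_map_smult[OF lin] star_smult smult_smult)
  qed
  define p n where "p = x \<oplus> star A x" and "n = \<i> \<odot> (x \<ominus> star A x)"
  have p: "selfadj p" and n: "selfadj n"
    unfolding p_def n_def by (simp_all add: selfadj_add_star selfadj_minus_star)
  note [simp] = selfadj_in[OF p] selfadj_in[OF n]
  have "p \<oplus> (-\<i>) \<odot> n = (x \<oplus> x) \<oplus> (star A x \<oplus> (-1) \<odot> star A x)"
    by (simp add: p_def n_def expand a_ac)
  then have "p \<oplus> (-\<i>) \<odot> n = 2 \<odot> x"
    by (simp add: smult_collect_pair)
  then have x_eq: "x = (1/2) \<odot> (p \<oplus> (-\<i>) \<odot> n)"
    by (simp add: smult_smult)
  have sx: "star A x = (1/2) \<odot> (p \<oplus> \<i> \<odot> n)"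
    by (subst x_eq) (simp add: star_smult star_add selfadj_star[OF p] selfadj_star[OF n])
  have "f (star A x) = (1/2) \<odot> (f p \<oplus> \<i> \<odot> f n)"
    by (simp add: sx linear_map_smult[OF lin] linear_map_add[OF lin])
  also have "\<dots> = star A (f x)"
    by (subst x_eq) (simp add: linear_map_smult[OF lin] linear_map_add[OF lin] star_smult star_add
        selfadj_star[OF sa[OF p]] selfadj_star[OF sa[OF n]])
  finally show ?thesis .
qed

text \<open>Positivity at \<^term>\<open>x \<ominus> g (f x)\<close> says that \<^term>\<open>f (star A x \<otimes> x)\<close> dominates
  \<^term>\<open>star A (f x) \<otimes> f x\<close>.\<close>

lemma left_inverse_contractive:
  assumes lin: "linear_map A A f" and pos: "f ` positive_elements A \<subseteq> positive_elements A"
    and one: "f \<one> = \<one>" and g: "star_hom A A g"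
    and fg: "\<And>a. a \<in> carrier A \<Longrightarrow> f (g a) = a"
    and mult_left: "\<And>a b. \<lbrakk>a \<in> carrier A; b \<in> carrier A\<rbrakk> \<Longrightarrow> f (g a \<otimes> b) = a \<otimes> f b"
    and mult_right: "\<And>a b. \<lbrakk>a \<in> carrier A; b \<in> carrier A\<rbrakk> \<Longrightarrow> f (b \<otimes> g a) = f b \<otimes> a"
    and x: "x \<in> carrier A"
  shows "nrm A (f x) \<le> nrm A x"
proof -
  note [simp] = linear_map_in[OF lin] linear_map_in[OF star_hom_linear[OF g]]
  note minus = linear_map_minus[OF pre_cstar_algebra_axioms pre_cstar_algebra_axioms lin]
  have *: "nrm A (f y) \<le> 1" if y: "y \<in> carrier A" and ny: "nrm A y \<le> 1" for y
  proof -
    note [simp] = y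
    have fpos: "\<exists>u\<in>carrier A. f (star A z \<otimes> z) = star A u \<otimes> u" if "z \<in> carrier A" for z
      using pos that by (force simp: positive_elements_def)
    define z where "z = y \<ominus> g (f y)"
    have [simp]: "z \<in> carrier A" by (simp add: z_def)
    have "nrm A (star A y \<otimes> y) \<le> 1"
      using ny nrm_nonneg[OF y] by (simp add: cstar_identity power_le_one)
    then obtain t where t: "selfadj t" "complex_of_real 1 \<odot> \<one> \<ominus> star A y \<otimes> y = t \<otimes> t"
      using pos_norm_minus[OF selfadj_star_mult[OF y]] unfolding pos_def by blast
    note [simp] = selfadj_in[OF t(1)]
    have "star A z \<otimes> z = star A y \<otimes> y \<ominus> star A y \<otimes> g (f y) \<ominus> (g (star A (f y)) \<otimes> y \<ominus> g (star A (f y) \<otimes> f y))"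
    proof -
      have "star A z = star A y \<ominus> g (star A (f y))"
        by (simp add: z_def star_minus star_hom_star[OF g])
      then show ?thesis
        by (simp add: z_def star_hom_mult[OF g] expand a_ac)
    qed
    then have "f (star A z \<otimes> z) = f (star A y \<otimes> y) \<ominus> star A (f y) \<otimes> f y \<ominus> (star A (f y) \<otimes> f y \<ominus> star A (f y) \<otimes> f y)"
      by (simp add: minus mult_left mult_right fg positive_map_star[OF lin pos])
    then have fz: "f (star A z \<otimes> z) = f (star A y \<otimes> y) \<ominus> star A (f y) \<otimes> f y"
      by (simp add: minus_eq r_neg)
    have "f (star A t \<otimes> t) = \<one> \<ominus> f (star A y \<otimes> y)"
      using t(2) minus[of \<one> "star A y \<otimes> y"] by (simp add: selfadj_star[OF t(1)] one)
    \<comment> \<open>The first two terms add up to f(y* y), and t t = 1 - y* y supplies the rest of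
      f 1 = 1.\<close>
    then have sum: "star A (f y) \<otimes> f y \<oplus> (f (star A z \<otimes> z) \<oplus> f (star A t \<otimes> t)) = \<one>"
      unfolding fz by (simp add: minus_eq a_ac r_neg r_neg1 r_neg2)
    obtain u v where "u \<in> carrier A" "v \<in> carrier A"
      "f (star A z \<otimes> z) = star A u \<otimes> u" "f (star A t \<otimes> t) = star A v \<otimes> v"
      using fpos[of z] fpos[of t] by auto
    then show ?thesis
      using sum by (intro nrm_le_one_of_star_sum[of "f y" u v]) simp_all
  qed
  show ?thesis
  proof (cases "nrm A x = 0")
    case True
    then have "x = \<zero>"
      using x by (simp add: nrm_eq_0)
    then show ?thesis
      using linear_map_zero[OF pre_cstar_algebra_axioms pre_cstar_algebra_axioms lin] by simp
  next
    case False
    then have c: "nrm A x > 0"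
      using nrm_nonneg[OF x] by simp
    define y where "y = complex_of_real (1 / nrm A x) \<odot> x"
    have "nrm A (f y) \<le> 1"
      using x c by (intro *) (simp_all add: y_def nrm_smult norm_divide)
    then show ?thesis
      using x c by (simp add: y_def linear_map_smult[OF lin] nrm_smult norm_divide)
  qed
qed

end

section \<open>Cauchy nets over an interaction group\<close>

text \<open>The endomorphisms \<alpha> enter as the restriction of \<open>V\<close> to
  \<open>P\<close>, so that one family provides both the connecting maps of the limit and their left
  inverses.\<close>

locale ore_interaction = unital_cstar_algebra A for A :: "'a star_normed" (structure) +
  fixes G :: "'g monoid" and P :: "'g set" and V :: "'g \<Rightarrow> 'a \<Rightarrow> 'a"
  assumes ore: "ore_in_enveloping_group P G"
    and interaction: "interaction_group G A V"
    and V_hom: "p \<in> P \<Longrightarrow> star_hom A A (V p)"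
    and V_inj: "p \<in> P \<Longrightarrow> inj_on (V p) (carrier A)"
begin

sublocale G: Group.group G
  using ore unfolding ore_in_enveloping_group_def by (rule conjunct1)

section \<open>The Ore semigroup and its tail filter\<close>

lemma P_submonoid: "submonoid P G"
  using ore by (simp add: ore_in_enveloping_group_def)

lemma P_in [simp]: "p \<in> P \<Longrightarrow> p \<in> carrier G"
  and P_one [simp]: "\<one>\<^bsub>G\<^esub> \<in> P"
  and P_mult [simp]: "\<lbrakk>p \<in> P; q \<in> P\<rbrakk> \<Longrightarrow> p \<otimes>\<^bsub>G\<^esub> q \<in> P"
  using submonoid.subset[OF P_submonoid] submonoid.one_closed[OF P_submonoid]
    submonoid.m_closed[OF P_submonoid] by blast+

lemma P_directed:
  assumes "r \<in> P" "s \<in> P" obtains a b where "a \<in> P" "b \<in> P" "a \<otimes>\<^bsub>G\<^esub> r = b \<otimes>\<^bsub>G\<^esub> s"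
proof -
  have "ore_semigroup (G\<lparr>carrier := P\<rparr>)"
    using ore by (simp add: ore_in_enveloping_group_def)
  then have "\<forall>r\<in>P. \<forall>s\<in>P. (P #>\<^bsub>G\<lparr>carrier := P\<rparr>\<^esub> r) \<inter> (P #>\<^bsub>G\<lparr>carrier := P\<rparr>\<^esub> s) \<noteq> {}"
    by (simp add: ore_semigroup_def)
  with assms have "(P #>\<^bsub>G\<lparr>carrier := P\<rparr>\<^esub> r) \<inter> (P #>\<^bsub>G\<lparr>carrier := P\<rparr>\<^esub> s) \<noteq> {}"
    by blast
  then obtain x where "x \<in> P #>\<^bsub>G\<lparr>carrier := P\<rparr>\<^esub> r" "x \<in> P #>\<^bsub>G\<lparr>carrier := P\<rparr>\<^esub> s"
    by blast
  then obtain a b where "a \<in> P" "x = a \<otimes>\<^bsub>G\<^esub> r" "b \<in> P" "x = b \<otimes>\<^bsub>G\<^esub> s"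
    by (auto simp: r_coset_def)
  then show ?thesis
    using that by metis
qed

lemma G_quotient:
  assumes "t \<in> carrier G" obtains p q where "p \<in> P" "q \<in> P" "t = inv\<^bsub>G\<^esub> p \<otimes>\<^bsub>G\<^esub> q"
proof -
  have "t \<in> (set_inv\<^bsub>G\<^esub> P) <#>\<^bsub>G\<^esub> P"
    using ore assms unfolding ore_in_enveloping_group_def by (metis (no_types))
  then show ?thesis
    using that by (auto simp: set_mult_def SET_INV_def)
qed

abbreviation gmult (infixl "\<cdot>" 70) where "p \<cdot> q \<equiv> p \<otimes>\<^bsub>G\<^esub> q"

abbreviation ginv where "ginv p \<equiv> inv\<^bsub>G\<^esub> p"

definition tail :: "'g filter" where
  "tail = (INF p\<in>P. principal {q \<cdot> p |q. q \<in> P})"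

text \<open>The Ore condition makes the sets Pp a filter base: if a r = b s, then P(a r) lies in
  both Pr and Ps.\<close>

lemma eventually_tail: "eventually Q tail \<longleftrightarrow> (\<exists>p\<in>P. \<forall>q\<in>P. Q (q \<cdot> p))"
proof -
  have "eventually Q tail \<longleftrightarrow> (\<exists>p\<in>P. eventually Q (principal {q \<cdot> p |q. q \<in> P}))"
    unfolding tail_def
  proof (rule eventually_INF_base)
    show "P \<noteq> {}" using P_one by blast
    fix r s assume rs: "r \<in> P" "s \<in> P"
    then obtain a b where ab: "a \<in> P" "b \<in> P" "a \<cdot> r = b \<cdot> s"
      by (rule P_directed)
    have sub: "{q \<cdot> (c \<cdot> x) |q. q \<in> P} \<subseteq> {q \<cdot> x |q. q \<in> P}" if "c \<in> P" "x \<in> P" for c x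
    proof clarify
      fix q assume "q \<in> P"
      then show "\<exists>q'. q \<cdot> (c \<cdot> x) = q' \<cdot> x \<and> q' \<in> P"
        using that by (intro exI[of _ "q \<cdot> c"]) (simp add: G.m_assoc)
    qed
    show "\<exists>x\<in>P. principal {q \<cdot> x |q. q \<in> P} \<le>
        inf (principal {q \<cdot> r |q. q \<in> P}) (principal {q \<cdot> s |q. q \<in> P})"
      using sub[of a r] sub[of b s] ab rs by (intro bexI[of _ "a \<cdot> r"]) simp_all
  qed
  then show ?thesis
    by (auto simp: eventually_principal)
qed

lemma tail_neq_bot [simp]: "tail \<noteq> bot"
  using P_one by (auto simp: trivial_limit_def eventually_tail)

lemma eventually_tail_P: "\<forall>\<^sub>F p in tail. p \<in> P"
  unfolding eventually_tail using P_one P_mult by blast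

lemma eventually_tail_mult:
  assumes "eventually Q tail" shows "\<forall>\<^sub>F p in tail. \<forall>q\<in>P. Q (q \<cdot> p)"
proof -
  obtain p where p: "p \<in> P" "\<forall>q\<in>P. Q (q \<cdot> p)"
    using assms unfolding eventually_tail by blast
  then show ?thesis
    unfolding eventually_tail by (intro bexI[of _ p]) (auto simp flip: G.m_assoc)
qed

text \<open>This lets the whole group act on nets indexed by the semigroup. For t = a^-1 b and a
  common multiple x b = y p, the index x a is translated to y p, and all later indices follow into
  Pp.\<close>

lemma filterlim_tail:
  assumes t: "t \<in> carrier G" shows "filterlim (\<lambda>p. p \<cdot> t) tail tail"
  unfolding filterlim_iff
proof (intro allI impI)
  fix Q assume "eventually Q tail"
  then obtain p where p: "p \<in> P" "\<forall>q\<in>P. Q (q \<cdot> p)"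
    unfolding eventually_tail by blast
  obtain a b where ab: "a \<in> P" "b \<in> P" "t = ginv a \<cdot> b"
    using t by (rule G_quotient)
  obtain x y where xy: "x \<in> P" "y \<in> P" "x \<cdot> b = y \<cdot> p"
    using ab p by (blast intro: P_directed)
  have "a \<cdot> (ginv a \<cdot> b) = (a \<cdot> ginv a) \<cdot> b"
    using ab by (intro G.m_assoc[symmetric]) auto
  then have "(x \<cdot> a) \<cdot> t = x \<cdot> b"
    using ab xy by (simp add: G.m_assoc)
  also have "\<dots> = y \<cdot> p"
    by (rule xy(3))
  finally have eq: "(x \<cdot> a) \<cdot> t = y \<cdot> p" .
  have "Q (q \<cdot> (x \<cdot> a) \<cdot> t)" if q: "q \<in> P" for q
  proof -
    have "q \<cdot> (x \<cdot> a) \<cdot> t = q \<cdot> ((x \<cdot> a) \<cdot> t)"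
      using q xy(1) ab(1) t by (intro G.m_assoc) auto
    also have "\<dots> = (q \<cdot> y) \<cdot> p"
      unfolding eq using q xy p by (simp add: G.m_assoc)
    finally show ?thesis
      using p(2) q xy by simp
  qed
  then show "\<forall>\<^sub>F p in tail. Q (p \<cdot> t)"
    unfolding eventually_tail using xy(1) ab(1) P_mult by blast
qed

section \<open>The interaction group on the semigroup\<close>

lemma V_linear: "t \<in> carrier G \<Longrightarrow> linear_map A A (V t)"
  using interaction by (simp add: interaction_group_def bounded_operator_def)

lemma V_in [simp, intro]: "\<lbrakk>t \<in> carrier G; a \<in> carrier A\<rbrakk> \<Longrightarrow> V t a \<in> carrier A"
  by (rule linear_map_in[OF V_linear])

lemma V_one [simp]: "t \<in> carrier G \<Longrightarrow> V t \<one> = \<one>"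
  using interaction by (simp add: interaction_group_def)

lemma V_id [simp]: "a \<in> carrier A \<Longrightarrow> V \<one>\<^bsub>G\<^esub> a = a"
  using interaction by (simp add: interaction_group_def)

lemma V_left: "\<lbrakk>s \<in> carrier G; t \<in> carrier G; a \<in> carrier A\<rbrakk> \<Longrightarrow>
    V (ginv s) (V s (V t a)) = V (ginv s) (V (s \<cdot> t) a)"
  and V_right: "\<lbrakk>s \<in> carrier G; t \<in> carrier G; a \<in> carrier A\<rbrakk> \<Longrightarrow>
    V s (V t (V (ginv t) a)) = V (s \<cdot> t) (V (ginv t) a)"
  using interaction by (simp_all add: interaction_group_def)

text \<open>A partial representation satisfies V_p V_(p^-1) V_p = V_p, and V_p is injective.\<close>

lemma V_inv_V [simp]:
  assumes p: "p \<in> P" and a: "a \<in> carrier A" shows "V (ginv p) (V p a) = a"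
proof -
  have "V p (V (ginv p) (V p a)) = V p a"
    using V_right[of p "ginv p" a] p a by simp
  then show ?thesis
    using V_inj[OF p] p a by (simp add: inj_on_def)
qed

text \<open>The right-hand law of a partial representation, read at \<open>V q a\<close>, loses its
  factors \<open>V (ginv q)\<close> by \<open>V_inv_V\<close>. The factor \<open>s\<close> may be
  any group element, which \<open>V_inv_mult\<close> and the dilation equation rely on.\<close>

lemma V_mult: "\<lbrakk>s \<in> carrier G; q \<in> P; a \<in> carrier A\<rbrakk> \<Longrightarrow> V (s \<cdot> q) a = V s (V q a)"
  using V_right[of s q "V q a"] by simp

lemma V_inv_mult: "\<lbrakk>q \<in> P; p \<in> P; a \<in> carrier A\<rbrakk> \<Longrightarrow> V (ginv (q \<cdot> p)) (V q a) = V (ginv p) a"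
  using V_mult[of "ginv p \<cdot> ginv q" q a] by (simp add: G.inv_mult_group G.m_assoc)

lemma V_isometric: "\<lbrakk>p \<in> P; a \<in> carrier A\<rbrakk> \<Longrightarrow> nrm A (V p a) = nrm A a"
  by (rule star_hom_isometric[OF unital_cstar_algebra_axioms unital_cstar_algebra_axioms V_hom V_inj])

text \<open>The multiplicativity axiom at p^-1 concerns the range of V_p. Combined with
  \<open>V_inv_V\<close> it makes V_(p^-1) a positive left inverse of V_p with the module property
  over its range.\<close>

lemma V_inv_contractive:
  assumes p: "p \<in> P" and a: "a \<in> carrier A" shows "nrm A (V (ginv p) a) \<le> nrm A a"
proof (rule left_inverse_contractive[OF V_linear _ _ V_hom[OF p]])
  have mult: "V (ginv p) (a \<otimes> b) = V (ginv p) a \<otimes> V (ginv p) b"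
    if "a \<in> V p ` carrier A \<or> b \<in> V p ` carrier A" "a \<in> carrier A" "b \<in> carrier A" for a b
    using interaction that p unfolding interaction_group_def by (metis G.inv_closed G.inv_inv P_in)
  show "V (ginv p) (V p a \<otimes> b) = a \<otimes> V (ginv p) b"
    "V (ginv p) (b \<otimes> V p a) = V (ginv p) b \<otimes> a" if "a \<in> carrier A" "b \<in> carrier A" for a b
    using mult[of "V p a" b] mult[of b "V p a"] p that by auto
  show "V (ginv p) ` positive_elements A \<subseteq> positive_elements A"
    using interaction p unfolding interaction_group_def by (meson G.inv_closed P_in)
qed (use p a in auto)

lemma V_minus: "\<lbrakk>t \<in> carrier G; x \<in> carrier A; y \<in> carrier A\<rbrakk> \<Longrightarrow> V t (x \<ominus> y) = V t x \<ominus> V t y"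
  by (rule linear_map_minus[OF pre_cstar_algebra_axioms pre_cstar_algebra_axioms V_linear])

text \<open>A Cauchy net \<^term>\<open>f\<close> stands for the limit of \<open>\<beta>\<^bsub>p\<^esub>\<^sup>-\<^sup>1 (i (f p))\<close>. Its values outside \<^term>\<open>P\<close> are
  irrelevant.\<close>

definition net :: "('g \<Rightarrow> 'a) \<Rightarrow> bool" where
  "net f \<longleftrightarrow> (\<forall>p. f p \<in> carrier A) \<and>
     (\<forall>e>0. \<forall>\<^sub>F p in tail. \<forall>q\<in>P. nrm A (f (q \<cdot> p) \<ominus> V q (f p)) \<le> e)"

lemma net_in [simp]: "net f \<Longrightarrow> f p \<in> carrier A"
  by (simp add: net_def)

lemma net_approx: "\<lbrakk>net f; e > 0\<rbrakk> \<Longrightarrow> \<forall>\<^sub>F p in tail. \<forall>q\<in>P. nrm A (f (q \<cdot> p) \<ominus> V q (f p)) \<le> e"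
  by (simp add: net_def)

lemma net_cong:
  assumes f: "net f" and eq: "\<forall>\<^sub>F p in tail. f p = h p" and h: "\<And>p. h p \<in> carrier A"
  shows "net h"
  unfolding net_def
proof (intro conjI allI impI h)
  fix e :: real assume "e > 0"
  from net_approx[OF f this] eventually_tail_mult[OF eq] eq
  show "\<forall>\<^sub>F p in tail. \<forall>q\<in>P. nrm A (h (q \<cdot> p) \<ominus> V q (h p)) \<le> e"
    by eventually_elim simp
qed

text \<open>Since \<open>V q\<close> is isometric, the norm at a later index exceeds that at
  \<open>p\<close> by at most the Cauchy defect.\<close>

lemma net_bound:
  assumes f: "net f" obtains K where "K > 0" "\<forall>\<^sub>F p in tail. nrm A (f p) \<le> K"
proof -
  from net_approx[OF f zero_less_one] eventually_tail_P
  have "\<forall>\<^sub>F p in tail. p \<in> P \<and> (\<forall>q\<in>P. nrm A (f (q \<cdot> p) \<ominus> V q (f p)) \<le> 1)"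
    by eventually_elim simp
  then obtain p where p: "p \<in> P" "\<forall>q\<in>P. nrm A (f (q \<cdot> p) \<ominus> V q (f p)) \<le> 1"
    using eventually_happens'[OF tail_neq_bot] by blast
  have le: "nrm A (f (q \<cdot> p)) \<le> nrm A (f p) + 1" if q: "q \<in> P" for q
    using nrm_diff_le[of "f (q \<cdot> p)" "V q (f p)"] p q f by (force simp: V_isometric)
  have "\<forall>\<^sub>F r in tail. nrm A (f r) \<le> nrm A (f p) + 1"
    unfolding eventually_tail
    using p(1) le by blast
  moreover have "nrm A (f p) + 1 > 0"
    using nrm_nonneg[of "f p"] f by simp
  ultimately show ?thesis
    using that by blast
qed

section \<open>Algebraic operations and limits of nets\<close>

lemma net_const_one: "net (\<lambda>p. \<one>)"
  by (simp add: net_def minus_eq r_neg)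

lemma net_zero: "net (\<lambda>p. \<zero>)"
  using linear_map_zero[OF pre_cstar_algebra_axioms pre_cstar_algebra_axioms V_linear]
  by (simp add: net_def minus_eq)

lemma net_add:
  assumes f: "net f" and h: "net h" shows "net (\<lambda>p. f p \<oplus> h p)"
  unfolding net_def
proof (intro conjI allI impI)
  fix e :: real assume "e > 0"
  then have e: "e / 2 > 0" by simp
  from net_approx[OF f e] net_approx[OF h e] eventually_tail_P
  show "\<forall>\<^sub>F p in tail. \<forall>q\<in>P. nrm A (f (q \<cdot> p) \<oplus> h (q \<cdot> p) \<ominus> V q (f p \<oplus> h p)) \<le> e"
  proof eventually_elim
    case (elim p)
    show ?case
    proof
      fix q assume q: "q \<in> P"
      have "f (q \<cdot> p) \<oplus> h (q \<cdot> p) \<ominus> V q (f p \<oplus> h p) =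
          (f (q \<cdot> p) \<ominus> V q (f p)) \<oplus> (h (q \<cdot> p) \<ominus> V q (h p))"
        using f h q by (simp add: linear_map_add[OF V_linear] expand add_interchange)
          (simp add: a_ac)
      then show "nrm A (f (q \<cdot> p) \<oplus> h (q \<cdot> p) \<ominus> V q (f p \<oplus> h p)) \<le> e"
        using nrm_triangle[of "f (q \<cdot> p) \<ominus> V q (f p)" "h (q \<cdot> p) \<ominus> V q (h p)"] f h q elim by force
    qed
  qed
qed (use f h in auto)

lemma net_smult:
  assumes f: "net f" shows "net (\<lambda>p. c \<odot> f p)"
  unfolding net_def
proof (intro conjI allI impI)
  fix e :: real assume "e > 0"
  then have e: "e / (cmod c + 1) > 0"
    by (simp add: add_nonneg_pos)
  from net_approx[OF f e]
  show "\<forall>\<^sub>F p in tail. \<forall>q\<in>P. nrm A (c \<odot> f (q \<cdot> p) \<ominus> V q (c \<odot> f p)) \<le> e"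
  proof eventually_elim
    case (elim p)
    show ?case
    proof
      fix q assume q: "q \<in> P"
      have "c \<odot> f (q \<cdot> p) \<ominus> V q (c \<odot> f p) = c \<odot> (f (q \<cdot> p) \<ominus> V q (f p))"
        using f q by (simp add: linear_map_smult[OF V_linear] expand)
      then have "nrm A (c \<odot> f (q \<cdot> p) \<ominus> V q (c \<odot> f p)) = cmod c * nrm A (f (q \<cdot> p) \<ominus> V q (f p))"
        using f q by (simp add: nrm_smult)
      also have "\<dots> \<le> (cmod c + 1) * (e / (cmod c + 1))"
        using elim q f e by (intro mult_mono) (auto intro: nrm_nonneg)
      also have "\<dots> = e"
        by (smt (verit) nonzero_mult_div_cancel_left norm_ge_zero times_divide_eq_right)
      finally show "nrm A (c \<odot> f (q \<cdot> p) \<ominus> V q (c \<odot> f p)) \<le> e" .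
    qed
  qed
qed (use f in auto)

lemma net_star:
  assumes f: "net f" shows "net (\<lambda>p. star A (f p))"
  unfolding net_def
proof (intro conjI allI impI)
  fix e :: real assume "e > 0"
  from net_approx[OF f this]
  show "\<forall>\<^sub>F p in tail. \<forall>q\<in>P. nrm A (star A (f (q \<cdot> p)) \<ominus> V q (star A (f p))) \<le> e"
  proof eventually_elim
    case (elim p)
    then show ?case
      using f by (simp add: star_hom_star[OF V_hom] flip: star_minus)
  qed
qed (use f in auto)

lemma net_mult:
  assumes f: "net f" and h: "net h" shows "net (\<lambda>p. f p \<otimes> h p)"
  unfolding net_def
proof (intro conjI allI impI)
  obtain K where K: "K > 0" "\<forall>\<^sub>F p in tail. nrm A (f p) \<le> K"
    using f by (rule net_bound)
  obtain L where L: "L > 0" "\<forall>\<^sub>F p in tail. nrm A (h p) \<le> L"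
    using h by (rule net_bound)
  fix e :: real assume "e > 0"
  then have e: "e / (2 * L) > 0" "e / (2 * K) > 0"
    using K L by simp_all
  \<comment> \<open>The product difference is split with \<open>h\<close> taken at the later index
    \<open>q \<cdot> p\<close>, so the bound on \<open>h\<close> must hold at all later indices,
    while \<open>f\<close> needs a bound only at \<open>p\<close>.\<close>
  from net_approx[OF f e(1)] net_approx[OF h e(2)] K(2) eventually_tail_mult[OF L(2)]
  show "\<forall>\<^sub>F p in tail. \<forall>q\<in>P. nrm A (f (q \<cdot> p) \<otimes> h (q \<cdot> p) \<ominus> V q (f p \<otimes> h p)) \<le> e"
  proof eventually_elim
    case (elim p)
    show ?case
    proof
      fix q assume q: "q \<in> P"
      let ?f = "f (q \<cdot> p)" and ?h = "h (q \<cdot> p)"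
      have "?f \<otimes> ?h \<ominus> V q (f p \<otimes> h p) = (?f \<ominus> V q (f p)) \<otimes> ?h \<oplus> V q (f p) \<otimes> (?h \<ominus> V q (h p))"
        using f h q minus_split[of "?f \<otimes> ?h" "V q (f p) \<otimes> ?h" "V q (f p) \<otimes> V q (h p)"]
        by (simp add: star_hom_mult[OF V_hom] expand)
      then have "nrm A (?f \<otimes> ?h \<ominus> V q (f p \<otimes> h p)) \<le>
          nrm A ((?f \<ominus> V q (f p)) \<otimes> ?h) + nrm A (V q (f p) \<otimes> (?h \<ominus> V q (h p)))"
        using f h q by (simp add: nrm_triangle)
      also have "\<dots> \<le> e / (2 * L) * L + K * (e / (2 * K))"
        using f h q elim K L e
        by (intro add_mono order.trans[OF nrm_mult] mult_mono) (auto simp: V_isometric intro: nrm_nonneg)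
      also have "\<dots> = e"
        using K L by simp
      finally show "nrm A (?f \<otimes> ?h \<ominus> V q (f p \<otimes> h p)) \<le> e" .
    qed
  qed
qed (use f h in auto)

text \<open>The compatibility of T with V turns the difference of the values at q p and at p into T
  applied to the Cauchy defect of f. Used with T_p = V_(p^-1) for the expectation and with T_p =
  \<beta>(p^-1) j for the map into another dilation.\<close>

lemma net_lim:
  assumes C: "unital_cstar_algebra C"
    and T: "\<And>p. p \<in> P \<Longrightarrow> linear_map A C (T p)"
    and le: "\<And>p a. \<lbrakk>p \<in> P; a \<in> carrier A\<rbrakk> \<Longrightarrow> nrm C (T p a) \<le> nrm A a"
    and TV: "\<And>p q a. \<lbrakk>p \<in> P; q \<in> P; a \<in> carrier A\<rbrakk> \<Longrightarrow> T (q \<cdot> p) (V q a) = T p a"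
    and f: "net f"
  obtains x where "pre_cstar_algebra.conv C (\<lambda>p. T p (f p)) x tail"
proof -
  interpret C: unital_cstar_algebra C by fact
  have approx: "\<exists>z\<in>carrier C. \<forall>\<^sub>F p in tail. nrm C (T p (f p) \<ominus>\<^bsub>C\<^esub> z) \<le> e" if e: "e > 0" for e
  proof -
    from net_approx[OF f e] eventually_tail_P
    have "\<forall>\<^sub>F p in tail. p \<in> P \<and> (\<forall>q\<in>P. nrm A (f (q \<cdot> p) \<ominus> V q (f p)) \<le> e)"
      by eventually_elim simp
    then obtain p where p: "p \<in> P" "\<forall>q\<in>P. nrm A (f (q \<cdot> p) \<ominus> V q (f p)) \<le> e"
      using eventually_happens'[OF tail_neq_bot] by blast
    have "nrm C (T (q \<cdot> p) (f (q \<cdot> p)) \<ominus>\<^bsub>C\<^esub> T p (f p)) \<le> e" if q: "q \<in> P" for q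
    proof -
      have "T (q \<cdot> p) (f (q \<cdot> p)) \<ominus>\<^bsub>C\<^esub> T p (f p) = T (q \<cdot> p) (f (q \<cdot> p) \<ominus> V q (f p))"
        using p q f
        by (simp add: linear_map_minus[OF pre_cstar_algebra_axioms C.pre_cstar_algebra_axioms T] TV)
      then show ?thesis
        using p q f le[of "q \<cdot> p" "f (q \<cdot> p) \<ominus> V q (f p)"] by force
    qed
    then have "\<forall>\<^sub>F r in tail. nrm C (T r (f r) \<ominus>\<^bsub>C\<^esub> T p (f p)) \<le> e"
      unfolding eventually_tail using p(1) by blast
    moreover have "T p (f p) \<in> carrier C"
      using T[OF p(1)] f by (simp add: linear_map_in)
    ultimately show ?thesis
      by blast
  qed
  have "\<forall>\<^sub>F p in tail. T p (f p) \<in> carrier C"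
    using eventually_tail_P by eventually_elim (use f in \<open>simp add: linear_map_in[OF T]\<close>)
  then show ?thesis
    by (rule C.approx_conv[OF tail_neq_bot _ approx]) (assumption, rule that)
qed

text \<open>Isometry of \<open>V q\<close> keeps the norms at later indices near the norm at
  \<open>p\<close>. Completeness of the reals is invoked for filters, as P need not be a
  sequence.\<close>

lemma net_nrm_lim:
  assumes f: "net f" obtains L where "((\<lambda>p. nrm A (f p)) \<longlongrightarrow> L) tail"
proof -
  have "cauchy_filter (filtermap (\<lambda>p. nrm A (f p)) tail)"
    unfolding cauchy_filter_metric_filtermap
  proof (intro allI impI)
    fix e :: real assume "e > 0"
    then have e: "e / 3 > 0" by simp
    from net_approx[OF f e] eventually_tail_P
    have "\<forall>\<^sub>F p in tail. p \<in> P \<and> (\<forall>q\<in>P. nrm A (f (q \<cdot> p) \<ominus> V q (f p)) \<le> e / 3)"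
      by eventually_elim simp
    then obtain p where p: "p \<in> P" "\<forall>q\<in>P. nrm A (f (q \<cdot> p) \<ominus> V q (f p)) \<le> e / 3"
      using eventually_happens'[OF tail_neq_bot] by blast
    have "\<bar>nrm A (f (q \<cdot> p)) - nrm A (f p)\<bar> \<le> e / 3" if q: "q \<in> P" for q
      using nrm_diff_le[of "f (q \<cdot> p)" "V q (f p)"] p q f by (force simp: V_isometric)
    then have "\<forall>\<^sub>F r in tail. \<bar>nrm A (f r) - nrm A (f p)\<bar> \<le> e / 3"
      unfolding eventually_tail using p(1) by blast
    then show "\<exists>Q. eventually Q tail \<and> (\<forall>x y. Q x \<and> Q y \<longrightarrow> dist (nrm A (f x)) (nrm A (f y)) < e)"
    proof (intro exI conjI allI impI)
      fix x y
      assume "\<bar>nrm A (f x) - nrm A (f p)\<bar> \<le> e / 3 \<and> \<bar>nrm A (f y) - nrm A (f p)\<bar> \<le> e / 3"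
      then show "dist (nrm A (f x)) (nrm A (f y)) < e"
        using \<open>e > 0\<close> unfolding dist_real_def by linarith
    qed
  qed
  moreover have "filtermap (\<lambda>p. nrm A (f p)) tail \<noteq> bot"
    by (simp add: filtermap_bot_iff)
  moreover have "filtermap (\<lambda>p. nrm A (f p)) tail \<le> principal UNIV"
    by simp
  ultimately have "\<exists>x\<in>UNIV. filtermap (\<lambda>p. nrm A (f p)) tail \<le> nhds x"
    using complete_UNIV unfolding complete_uniform by blast
  then show ?thesis
    using that by (auto simp: filterlim_def)
qed

end

section \<open>The limit algebra\<close>

lemma complex_ring_cring: "cring complex_ring"
proof (rule cringI)
  show "abelian_group complex_ring"
  proof (rule abelian_groupI)
    fix x assume "x \<in> carrier complex_ring"
    show "\<exists>y\<in>carrier complex_ring. y \<oplus>\<^bsub>complex_ring\<^esub> x = \<zero>\<^bsub>complex_ring\<^esub>"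
      by (rule bexI[of _ "- x"]) (simp_all add: complex_ring_def)
  qed (simp_all add: complex_ring_def algebra_simps)
  show "comm_monoid complex_ring"
    by (rule comm_monoidI) (simp_all add: complex_ring_def algebra_simps)
qed (simp add: complex_ring_def algebra_simps)

context ore_interaction
begin

section \<open>The quotient by null nets\<close>

definition eqv :: "('g \<Rightarrow> 'a) \<Rightarrow> ('g \<Rightarrow> 'a) \<Rightarrow> bool" where
  "eqv f h \<longleftrightarrow> ((\<lambda>p. nrm A (f p \<ominus> h p)) \<longlongrightarrow> 0) tail"

definition cls :: "('g \<Rightarrow> 'a) \<Rightarrow> ('g \<Rightarrow> 'a) set" where
  "cls f = {h. net h \<and> eqv f h}"

definition rep :: "('g \<Rightarrow> 'a) set \<Rightarrow> 'g \<Rightarrow> 'a" where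
  "rep X = (SOME f. f \<in> X)"

lemma eqv_bound:
  assumes "net f" "net h" "\<forall>\<^sub>F p in tail. nrm A (f p \<ominus> h p) \<le> g p" "(g \<longlongrightarrow> 0) tail"
  shows "eqv f h"
  unfolding eqv_def
proof (rule tendsto_sandwich[OF _ assms(3) tendsto_const assms(4)])
  show "\<forall>\<^sub>F p in tail. 0 \<le> nrm A (f p \<ominus> h p)"
    using assms(1,2) by (simp add: nrm_nonneg)
qed

lemma eqv_eventually:
  assumes "net f" "net h" "\<forall>\<^sub>F p in tail. f p = h p" shows "eqv f h"
proof (rule eqv_bound[OF assms(1,2) _ tendsto_const])
  show "\<forall>\<^sub>F p in tail. nrm A (f p \<ominus> h p) \<le> 0"
    using assms(3) by eventually_elim (use assms(2) in \<open>simp add: minus_eq r_neg\<close>)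
qed

lemma eqv_refl: "net f \<Longrightarrow> eqv f f"
  by (rule eqv_eventually) auto

lemma eqv_sym: "\<lbrakk>net f; net h; eqv f h\<rbrakk> \<Longrightarrow> eqv h f"
  unfolding eqv_def by (simp add: nrm_minus_commute[of "h _"])

lemma eqv_trans:
  assumes "net f" "net h" "net k" "eqv f h" "eqv h k" shows "eqv f k"
proof (rule eqv_bound[OF assms(1,3)])
  show "\<forall>\<^sub>F p in tail. nrm A (f p \<ominus> k p) \<le> nrm A (f p \<ominus> h p) + nrm A (h p \<ominus> k p)"
    using assms(1-3) by (simp add: nrm_minus_triangle)
  show "((\<lambda>p. nrm A (f p \<ominus> h p) + nrm A (h p \<ominus> k p)) \<longlongrightarrow> 0) tail"
    using tendsto_add[OF assms(4,5)[unfolded eqv_def]] by simp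
qed

lemma cls_eq_iff: "\<lbrakk>net f; net h\<rbrakk> \<Longrightarrow> cls f = cls h \<longleftrightarrow> eqv f h"
  unfolding cls_def using eqv_refl eqv_sym eqv_trans by (safe; blast)

lemma cls_eqI: "\<lbrakk>net f; net h; \<forall>\<^sub>F p in tail. f p = h p\<rbrakk> \<Longrightarrow> cls f = cls h"
  by (simp add: cls_eq_iff eqv_eventually)

lemma rep_cls: assumes "net f" shows "net (rep (cls f))" "eqv (rep (cls f)) f"
proof -
  have "f \<in> cls f"
    using assms by (simp add: cls_def eqv_refl)
  then have "rep (cls f) \<in> cls f"
    unfolding rep_def by (rule someI[of "\<lambda>h. h \<in> cls f"])
  then show "net (rep (cls f))" "eqv (rep (cls f)) f"
    using eqv_sym assms by (auto simp: cls_def)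
qed

lemma eqv_add:
  assumes "net f" "net f'" "net h" "net h'" "eqv f f'" "eqv h h'"
  shows "eqv (\<lambda>p. f p \<oplus> h p) (\<lambda>p. f' p \<oplus> h' p)"
proof (rule eqv_bound)
  show "\<forall>\<^sub>F p in tail. nrm A (f p \<oplus> h p \<ominus> (f' p \<oplus> h' p)) \<le> nrm A (f p \<ominus> f' p) + nrm A (h p \<ominus> h' p)"
  proof (rule always_eventually, rule allI)
    fix p
    have "f p \<oplus> h p \<ominus> (f' p \<oplus> h' p) = (f p \<ominus> f' p) \<oplus> (h p \<ominus> h' p)"
      using assms(1-4) by (simp add: minus_smult smult_add_right add_interchange)
    then show "nrm A (f p \<oplus> h p \<ominus> (f' p \<oplus> h' p)) \<le> nrm A (f p \<ominus> f' p) + nrm A (h p \<ominus> h' p)"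
      using assms(1-4) by (simp add: nrm_triangle)
  qed
  show "((\<lambda>p. nrm A (f p \<ominus> f' p) + nrm A (h p \<ominus> h' p)) \<longlongrightarrow> 0) tail"
    using tendsto_add[OF assms(5,6)[unfolded eqv_def]] by simp
qed (use assms in \<open>auto intro: net_add\<close>)

lemma eqv_smult:
  assumes "net f" "net f'" "eqv f f'" shows "eqv (\<lambda>p. c \<odot> f p) (\<lambda>p. c \<odot> f' p)"
proof (rule eqv_bound)
  show "\<forall>\<^sub>F p in tail. nrm A (c \<odot> f p \<ominus> c \<odot> f' p) \<le> cmod c * nrm A (f p \<ominus> f' p)"
  proof (rule always_eventually, rule allI)
    fix p
    have "c \<odot> f p \<ominus> c \<odot> f' p = c \<odot> (f p \<ominus> f' p)"
      using assms(1-2) by (simp add: expand)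
    then show "nrm A (c \<odot> f p \<ominus> c \<odot> f' p) \<le> cmod c * nrm A (f p \<ominus> f' p)"
      using assms(1-2) by (simp add: nrm_smult)
  qed
  show "((\<lambda>p. cmod c * nrm A (f p \<ominus> f' p)) \<longlongrightarrow> 0) tail"
    using tendsto_mult_left[OF assms(3)[unfolded eqv_def], of "cmod c"] by simp
qed (use assms in \<open>auto intro: net_smult\<close>)

lemma eqv_star:
  assumes "net f" "net f'" "eqv f f'" shows "eqv (\<lambda>p. star A (f p)) (\<lambda>p. star A (f' p))"
  using assms unfolding eqv_def by (simp flip: star_minus)

lemma eqv_mult:
  assumes "net f" "net f'" "net h" "net h'" "eqv f f'" "eqv h h'"
  shows "eqv (\<lambda>p. f p \<otimes> h p) (\<lambda>p. f' p \<otimes> h' p)"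
proof -
  obtain K where K: "\<forall>\<^sub>F p in tail. nrm A (f' p) \<le> K"
    using assms(2) by (rule net_bound)
  obtain L where L: "\<forall>\<^sub>F p in tail. nrm A (h p) \<le> L"
    using assms(3) by (rule net_bound)
  show ?thesis
  proof (rule eqv_bound)
    show "\<forall>\<^sub>F p in tail. nrm A (f p \<otimes> h p \<ominus> f' p \<otimes> h' p) \<le> nrm A (f p \<ominus> f' p) * L + K * nrm A (h p \<ominus> h' p)"
      using K L
    proof eventually_elim
      case (elim p)
      have "f p \<otimes> h p \<ominus> f' p \<otimes> h' p = (f p \<ominus> f' p) \<otimes> h p \<oplus> f' p \<otimes> (h p \<ominus> h' p)"
        using assms(1-4) minus_split[of "f p \<otimes> h p" "f' p \<otimes> h p" "f' p \<otimes> h' p"] by (simp add: expand)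
      then have "nrm A (f p \<otimes> h p \<ominus> f' p \<otimes> h' p) \<le> nrm A ((f p \<ominus> f' p) \<otimes> h p) + nrm A (f' p \<otimes> (h p \<ominus> h' p))"
        using assms(1-4) by (simp add: nrm_triangle)
      also have "\<dots> \<le> nrm A (f p \<ominus> f' p) * L + K * nrm A (h p \<ominus> h' p)"
        using assms(1-4) elim order.trans[OF nrm_nonneg elim(1)]
        by (intro add_mono order.trans[OF nrm_mult] mult_mono) (auto intro: nrm_nonneg)
      finally show ?case .
    qed
    have "((\<lambda>p. nrm A (f p \<ominus> f' p) * L + K * nrm A (h p \<ominus> h' p)) \<longlongrightarrow> 0 * L + K * 0) tail"
      using assms(5,6) unfolding eqv_def by (intro tendsto_intros)
    then show "((\<lambda>p. nrm A (f p \<ominus> f' p) * L + K * nrm A (h p \<ominus> h' p)) \<longlongrightarrow> 0) tail"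
      by simp
  qed (use assms in \<open>auto intro: net_mult\<close>)
qed

text \<open>The operations act on chosen representatives; the rules from \<open>lim_alg_add\<close>
  to \<open>lim_alg_star\<close> replace these by arbitrary ones. Forming classes of Cauchy nets
  gives the limit and its completion together.\<close>

definition lim_alg :: "('g \<Rightarrow> 'a) set star_normed" where
  "lim_alg = \<lparr>carrier = cls ` Collect net, mult = (\<lambda>X Y. cls (\<lambda>p. rep X p \<otimes> rep Y p)), one = cls (\<lambda>p. \<one>),
     zero = cls (\<lambda>p. \<zero>), add = (\<lambda>X Y. cls (\<lambda>p. rep X p \<oplus> rep Y p)),
     smult = (\<lambda>c X. cls (\<lambda>p. c \<odot> rep X p)), star = (\<lambda>X. cls (\<lambda>p. star A (rep X p))),
     nrm = (\<lambda>X. Lim tail (\<lambda>p. nrm A (rep X p)))\<rparr>"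

lemma lim_alg_carrier: "carrier lim_alg = cls ` Collect net"
  and lim_alg_one: "\<one>\<^bsub>lim_alg\<^esub> = cls (\<lambda>p. \<one>)" and lim_alg_zero: "\<zero>\<^bsub>lim_alg\<^esub> = cls (\<lambda>p. \<zero>)"
  by (simp_all add: lim_alg_def)

lemma cls_in [simp]: "net f \<Longrightarrow> cls f \<in> carrier lim_alg"
  by (simp add: lim_alg_carrier)

lemma lim_alg_cases: assumes "X \<in> carrier lim_alg" obtains f where "net f" "X = cls f"
  using assms that by (auto simp: lim_alg_carrier)

lemma lim_alg_add [simp]: "\<lbrakk>net f; net h\<rbrakk> \<Longrightarrow> cls f \<oplus>\<^bsub>lim_alg\<^esub> cls h = cls (\<lambda>p. f p \<oplus> h p)"
  using rep_cls[of f] rep_cls[of h] by (simp add: lim_alg_def cls_eq_iff net_add eqv_add)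

lemma lim_alg_mult [simp]: "\<lbrakk>net f; net h\<rbrakk> \<Longrightarrow> cls f \<otimes>\<^bsub>lim_alg\<^esub> cls h = cls (\<lambda>p. f p \<otimes> h p)"
  using rep_cls[of f] rep_cls[of h] by (simp add: lim_alg_def cls_eq_iff net_mult eqv_mult)

lemma lim_alg_smult [simp]: "net f \<Longrightarrow> c \<odot>\<^bsub>lim_alg\<^esub> cls f = cls (\<lambda>p. c \<odot> f p)"
  using rep_cls[of f] by (simp add: lim_alg_def cls_eq_iff net_smult eqv_smult)

lemma lim_alg_star [simp]: "net f \<Longrightarrow> star lim_alg (cls f) = cls (\<lambda>p. star A (f p))"
  using rep_cls[of f] by (simp add: lim_alg_def cls_eq_iff net_star eqv_star)

lemma lim_alg_nrm:
  assumes f: "net f" shows "((\<lambda>p. nrm A (f p)) \<longlongrightarrow> nrm lim_alg (cls f)) tail"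
proof -
  obtain L where L: "((\<lambda>p. nrm A (f p)) \<longlongrightarrow> L) tail"
    using f by (rule net_nrm_lim)
  have "((\<lambda>p. nrm A (rep (cls f) p) - nrm A (f p)) \<longlongrightarrow> 0) tail"
  proof (rule Lim_null_comparison)
    show "((\<lambda>p. nrm A (rep (cls f) p \<ominus> f p)) \<longlongrightarrow> 0) tail"
      using rep_cls(2)[OF f] by (simp add: eqv_def)
    show "\<forall>\<^sub>F p in tail. norm (nrm A (rep (cls f) p) - nrm A (f p)) \<le> nrm A (rep (cls f) p \<ominus> f p)"
      using rep_cls(1)[OF f] f by (simp add: nrm_diff_le)
  qed
  from tendsto_add[OF this L] have "((\<lambda>p. nrm A (rep (cls f) p)) \<longlongrightarrow> L) tail"
    by simp
  then have "nrm lim_alg (cls f) = L"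
    by (simp add: lim_alg_def tendsto_Lim)
  then show ?thesis
    using L by simp
qed

lemma lim_alg_nrm_eqI: "\<lbrakk>net f; ((\<lambda>p. nrm A (f p)) \<longlongrightarrow> L) tail\<rbrakk> \<Longrightarrow> nrm lim_alg (cls f) = L"
  using lim_alg_nrm[of f] tendsto_unique[OF tail_neq_bot] by blast

lemma lim_alg_nrm_leI: "\<lbrakk>net f; \<forall>\<^sub>F p in tail. nrm A (f p) \<le> K\<rbrakk> \<Longrightarrow> nrm lim_alg (cls f) \<le> K"
  by (rule tendsto_upperbound[OF lim_alg_nrm _ tail_neq_bot])

section \<open>Algebra axioms and C*-identity of the limit\<close>

lemma lim_alg_abelian_group: "abelian_group lim_alg"
proof (rule abelian_groupI)
  show "\<zero>\<^bsub>lim_alg\<^esub> \<in> carrier lim_alg"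
    by (simp add: lim_alg_zero net_zero)
  fix X assume "X \<in> carrier lim_alg"
  then obtain f where f: "net f" "X = cls f" by (rule lim_alg_cases)
  have "cls (\<lambda>p. (-1) \<odot> f p) \<oplus>\<^bsub>lim_alg\<^esub> X = \<zero>\<^bsub>lim_alg\<^esub>"
    using f by (simp add: net_smult lim_alg_zero smult_collect_pair)
  then show "\<exists>Y\<in>carrier lim_alg. Y \<oplus>\<^bsub>lim_alg\<^esub> X = \<zero>\<^bsub>lim_alg\<^esub>"
    using f net_smult cls_in by blast
  show "\<zero>\<^bsub>lim_alg\<^esub> \<oplus>\<^bsub>lim_alg\<^esub> X = X"
    using f by (simp add: lim_alg_zero net_zero)
  fix Y assume "Y \<in> carrier lim_alg"
  then obtain h where h: "net h" "Y = cls h" by (rule lim_alg_cases)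
  show "X \<oplus>\<^bsub>lim_alg\<^esub> Y \<in> carrier lim_alg"
    using f h by (simp add: net_add)
  have "(\<lambda>p. f p \<oplus> h p) = (\<lambda>p. h p \<oplus> f p)"
    using f h by (intro ext a_comm) auto
  then show "X \<oplus>\<^bsub>lim_alg\<^esub> Y = Y \<oplus>\<^bsub>lim_alg\<^esub> X"
    using f h by simp
  fix Z assume "Z \<in> carrier lim_alg"
  then obtain k where k: "net k" "Z = cls k" by (rule lim_alg_cases)
  show "(X \<oplus>\<^bsub>lim_alg\<^esub> Y) \<oplus>\<^bsub>lim_alg\<^esub> Z = X \<oplus>\<^bsub>lim_alg\<^esub> (Y \<oplus>\<^bsub>lim_alg\<^esub> Z)"
    using f h k by (simp add: net_add a_assoc)
qed

lemma lim_alg_monoid: "Group.monoid lim_alg"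
  by (rule monoidI) (auto elim!: lim_alg_cases simp: lim_alg_one net_mult net_const_one m_assoc)

lemma lim_alg_ring: "Ring.ring lim_alg"
  by (rule ringI[OF lim_alg_abelian_group lim_alg_monoid])
    (auto elim!: lim_alg_cases simp: net_mult net_add l_distr r_distr)

lemma lim_alg_module: "Module.module complex_ring lim_alg"
  by (rule moduleI[OF complex_ring_cring lim_alg_abelian_group])
    (auto elim!: lim_alg_cases simp: complex_ring_def net_smult net_add smult_add_left smult_add_right smult_smult)

lemma lim_alg_pre_cstar: "pre_cstar_algebra lim_alg"
proof (rule pre_cstar_algebra.intro[OF lim_alg_module lim_alg_ring], unfold_locales)
  fix X Y c
  assume X: "X \<in> carrier lim_alg"
  then obtain f where f: "net f" and Xf: "X = cls f" by (rule lim_alg_cases)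
  note lim = lim_alg_nrm[OF f]
  show "star lim_alg X \<in> carrier lim_alg" "star lim_alg (star lim_alg X) = X" "star lim_alg (c \<odot>\<^bsub>lim_alg\<^esub> X) = cnj c \<odot>\<^bsub>lim_alg\<^esub> star lim_alg X"
    using f by (simp_all add: Xf net_star net_smult star_smult)
  show "0 \<le> nrm lim_alg X"
    unfolding Xf by (rule tendsto_lowerbound[OF lim _ tail_neq_bot]) (use f in \<open>simp add: nrm_nonneg\<close>)
  show "nrm lim_alg X = 0 \<longleftrightarrow> X = \<zero>\<^bsub>lim_alg\<^esub>"
  proof -
    have "eqv f (\<lambda>p. \<zero>) \<longleftrightarrow> ((\<lambda>p. nrm A (f p)) \<longlongrightarrow> 0) tail"
      using f by (simp add: eqv_def minus_eq)
    then show ?thesis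
      unfolding Xf lim_alg_zero cls_eq_iff[OF f net_zero] using lim_alg_nrm_eqI[OF f, of 0] lim by metis
  qed
  show "nrm lim_alg (c \<odot>\<^bsub>lim_alg\<^esub> X) = cmod c * nrm lim_alg X"
    unfolding Xf lim_alg_smult[OF f]
  proof (rule lim_alg_nrm_eqI)
    show "((\<lambda>p. nrm A (c \<odot> f p)) \<longlongrightarrow> cmod c * nrm lim_alg (cls f)) tail"
      using tendsto_mult_left[OF lim, of "cmod c"] f by (simp add: nrm_smult)
  qed (rule net_smult[OF f])
  show "nrm lim_alg (star lim_alg X \<otimes>\<^bsub>lim_alg\<^esub> X) = (nrm lim_alg X)\<^sup>2"
    unfolding Xf lim_alg_star[OF f] lim_alg_mult[OF net_star[OF f] f]
  proof (rule lim_alg_nrm_eqI)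
    show "((\<lambda>p. nrm A (star A (f p) \<otimes> f p)) \<longlongrightarrow> (nrm lim_alg (cls f))\<^sup>2) tail"
      using tendsto_power[OF lim, of 2] f by (simp add: cstar_identity)
  qed (intro net_mult net_star f)
  assume Y: "Y \<in> carrier lim_alg"
  then obtain h where h: "net h" and Yh: "Y = cls h" by (rule lim_alg_cases)
  show "(c \<odot>\<^bsub>lim_alg\<^esub> X) \<otimes>\<^bsub>lim_alg\<^esub> Y = c \<odot>\<^bsub>lim_alg\<^esub> (X \<otimes>\<^bsub>lim_alg\<^esub> Y)" "X \<otimes>\<^bsub>lim_alg\<^esub> (c \<odot>\<^bsub>lim_alg\<^esub> Y) = c \<odot>\<^bsub>lim_alg\<^esub> (X \<otimes>\<^bsub>lim_alg\<^esub> Y)"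
    "star lim_alg (X \<oplus>\<^bsub>lim_alg\<^esub> Y) = star lim_alg X \<oplus>\<^bsub>lim_alg\<^esub> star lim_alg Y" "star lim_alg (X \<otimes>\<^bsub>lim_alg\<^esub> Y) = star lim_alg Y \<otimes>\<^bsub>lim_alg\<^esub> star lim_alg X"
    using f h
    by (simp_all add: Xf Yh net_smult net_mult net_star net_add smult_mult_left smult_mult_right star_add star_mult)
  show "nrm lim_alg (X \<oplus>\<^bsub>lim_alg\<^esub> Y) \<le> nrm lim_alg X + nrm lim_alg Y"
    unfolding Xf Yh lim_alg_add[OF f h]
    by (rule tendsto_le[OF tail_neq_bot tendsto_add[OF lim lim_alg_nrm[OF h]] lim_alg_nrm[OF net_add[OF f h]]])
      (use f h in \<open>simp add: nrm_triangle\<close>)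
  show "nrm lim_alg (X \<otimes>\<^bsub>lim_alg\<^esub> Y) \<le> nrm lim_alg X * nrm lim_alg Y"
    unfolding Xf Yh lim_alg_mult[OF f h]
    by (rule tendsto_le[OF tail_neq_bot tendsto_mult[OF lim lim_alg_nrm[OF h]] lim_alg_nrm[OF net_mult[OF f h]]])
      (use f h in \<open>simp add: nrm_mult\<close>)
qed

sublocale lim_alg: pre_cstar_algebra lim_alg
  by (rule lim_alg_pre_cstar)

lemma net_minus: "\<lbrakk>net f; net h\<rbrakk> \<Longrightarrow> net (\<lambda>p. f p \<ominus> h p)"
  using net_add[of f "\<lambda>p. (-1) \<odot> h p"] by (simp add: net_smult minus_smult)

lemma lim_alg_minus [simp]: "\<lbrakk>net f; net h\<rbrakk> \<Longrightarrow> cls f \<ominus>\<^bsub>lim_alg\<^esub> cls h = cls (\<lambda>p. f p \<ominus> h p)"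
  by (simp add: lim_alg.minus_smult net_smult minus_smult)

end

section \<open>Closed sets, closures and ranges\<close>

context pre_cstar_algebra
begin

lemma closedin_iff: "closedin (norm_topology A) S \<longleftrightarrow>
    S \<subseteq> carrier A \<and> (\<forall>\<sigma> l. range \<sigma> \<subseteq> S \<and> conv \<sigma> l sequentially \<longrightarrow> l \<in> S)"
proof -
  interpret M: Metric_space "carrier A" "ndist A"
    by (rule Metric_space_ndist)
  show ?thesis
    unfolding conv_iff_limitin norm_topology_def by (rule M.metric_closedin_iff_sequentially_closed)
qed

lemma closure_of_iff: "x \<in> norm_topology A closure_of S \<longleftrightarrow>
    x \<in> carrier A \<and> (\<forall>r>0. \<exists>y\<in>S. y \<in> carrier A \<and> nrm A (x \<ominus> y) < r)"
proof -
  interpret M: Metric_space "carrier A" "ndist A"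
    by (rule Metric_space_ndist)
  show ?thesis
    unfolding norm_topology_def M.metric_closure_of mem_Collect_eq M.in_mball
    by (rule conj_cong[OF refl]) (auto simp: ndist_def)
qed

lemma is_submoduleI:
  assumes "S \<subseteq> carrier A" "\<zero> \<in> S" "\<And>x y. \<lbrakk>x \<in> S; y \<in> S\<rbrakk> \<Longrightarrow> x \<oplus> y \<in> S" "\<And>c x. x \<in> S \<Longrightarrow> c \<odot> x \<in> S"
  shows "submodule S complex_ring A"
proof (rule submoduleI)
  show "\<ominus> x \<in> S" if "x \<in> S" for x
    using assms(4)[OF that, of "-1"] assms(1) that by (auto simp: uminus_smult)
qed (use assms in auto)

end

text \<open>The explicit rate is the point: completeness of the limit algebra applies this at every
  index of a net and needs a bound uniform in the index.\<close>

lemma (in unital_cstar_algebra) geometric_conv: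
  assumes x: "\<And>n. x n \<in> carrier A" and step: "\<And>n. nrm A (x (Suc n) \<ominus> x n) \<le> (1/2) ^ n"
  obtains y where "conv x y sequentially" "\<And>n. nrm A (x n \<ominus> y) \<le> 2 * (1/2) ^ n"
proof -
  have diff: "nrm A (x (n + k) \<ominus> x n) \<le> 2 * (1/2) ^ n - 2 * (1/2) ^ (n + k)" for n k
  proof (induction k)
    case 0
    show ?case using x by (simp add: minus_eq r_neg)
  next
    case (Suc k)
    have "nrm A (x (n + Suc k) \<ominus> x n) \<le> nrm A (x (Suc (n + k)) \<ominus> x (n + k)) + nrm A (x (n + k) \<ominus> x n)"
      using x nrm_minus_triangle[of "x (Suc (n + k))" "x (n + k)" "x n"] by simp
    also have "\<dots> \<le> (1/2) ^ (n + k) + (2 * (1/2) ^ n - 2 * (1/2) ^ (n + k))"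
      by (intro add_mono step Suc.IH)
    also have "\<dots> = 2 * (1/2) ^ n - 2 * (1/2) ^ (n + Suc k)"
      by simp
    finally show ?case .
  qed
  have le: "nrm A (x m \<ominus> x n) \<le> 2 * (1/2) ^ n" if "n \<le> m" for m n
  proof -
    obtain k where "m = n + k"
      using \<open>n \<le> m\<close> le_Suc_ex by blast
    then have "nrm A (x m \<ominus> x n) \<le> 2 * (1/2) ^ n - 2 * (1/2) ^ m"
      using diff[of n k] by simp
    also have "\<dots> \<le> 2 * (1/2) ^ n"
      by simp
    finally show ?thesis .
  qed
  have cau: "\<exists>N. \<forall>m\<ge>N. \<forall>n\<ge>N. nrm A (x m \<ominus> x n) < e" if e: "e > 0" for e
  proof -
    obtain N where N: "(1/2 :: real) ^ N < e / 4"
      using real_arch_pow_inv[of "e / 4" "1/2"] e by auto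
    have "nrm A (x m \<ominus> x n) < e" if "m \<ge> N" "n \<ge> N" for m n
    proof -
      have "nrm A (x m \<ominus> x n) \<le> nrm A (x m \<ominus> x N) + nrm A (x N \<ominus> x n)"
        using x by (simp add: nrm_minus_triangle)
      also have "nrm A (x N \<ominus> x n) = nrm A (x n \<ominus> x N)"
        using x by (simp add: nrm_minus_commute)
      also have "nrm A (x m \<ominus> x N) + nrm A (x n \<ominus> x N) \<le> 2 * (1/2) ^ N + 2 * (1/2) ^ N"
        by (intro add_mono le that)
      also have "\<dots> < e"
        using N by simp
      finally show ?thesis .
    qed
    then show ?thesis
      by blast
  qed
  obtain y where y: "conv x y sequentially"
    using Cauchy_conv[OF x cau] by blast
  have "nrm A (x n \<ominus> y) \<le> 2 * (1/2) ^ n" for n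
  proof (rule LIMSEQ_le_const2)
    have "conv (\<lambda>m. x n \<ominus> x m) (x n \<ominus> y) sequentially"
      by (rule conv_minus[OF conv_const[OF x] y])
    then show "(\<lambda>m. nrm A (x n \<ominus> x m)) \<longlonglongrightarrow> nrm A (x n \<ominus> y)"
      by (rule conv_norm)
    show "\<exists>N. \<forall>m\<ge>N. nrm A (x n \<ominus> x m) \<le> 2 * (1/2) ^ n"
      using le[of n] nrm_minus_commute x by (intro exI[of _ n]) auto
  qed
  then show ?thesis
    using that y by blast
qed

text \<open>Preimages of a convergent sequence are Cauchy. Needed for the range of the expectation
  and for surjectivity of the comparison map.\<close>

lemma isometric_range_closed:
  assumes "unital_cstar_algebra A" "pre_cstar_algebra B" and f: "linear_map A B f"
    and iso: "\<And>x. x \<in> carrier A \<Longrightarrow> nrm B (f x) = nrm A x"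
  shows "closedin (norm_topology B) (f ` carrier A)"
proof -
  interpret A: unital_cstar_algebra A by fact
  interpret B: pre_cstar_algebra B by fact
  have "l \<in> f ` carrier A" if \<sigma>: "range \<sigma> \<subseteq> f ` carrier A" and l: "B.conv \<sigma> l sequentially" for \<sigma> l
  proof -
    have "\<forall>n. \<exists>a. a \<in> carrier A \<and> \<sigma> n = f a"
      using \<sigma> by blast
    then obtain a where a: "\<And>n. a n \<in> carrier A" "\<And>n. \<sigma> n = f (a n)"
      by metis
    have "\<exists>x. A.conv a x sequentially"
    proof -
      have cau: "\<exists>N. \<forall>m\<ge>N. \<forall>n\<ge>N. nrm A (a m \<ominus>\<^bsub>A\<^esub> a n) < e" if e: "e > 0" for e
      proof -
        have "\<forall>\<^sub>F n in sequentially. nrm B (\<sigma> n \<ominus>\<^bsub>B\<^esub> l) < e / 2"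
          using l e by (intro order_tendstoD(2)[where y = 0]) (auto simp: B.conv_def)
        then obtain N where N: "\<And>n. n \<ge> N \<Longrightarrow> nrm B (\<sigma> n \<ominus>\<^bsub>B\<^esub> l) < e / 2"
          by (auto simp: eventually_sequentially)
        have "nrm A (a m \<ominus>\<^bsub>A\<^esub> a n) < e" if "m \<ge> N" "n \<ge> N" for m n
        proof -
          have fa: "f (a k) \<in> carrier B" for k
            using a(1) by (rule linear_map_in[OF f])
          have "nrm A (a m \<ominus>\<^bsub>A\<^esub> a n) = nrm B (f (a m) \<ominus>\<^bsub>B\<^esub> f (a n))"
            using iso[of "a m \<ominus>\<^bsub>A\<^esub> a n"] a
            by (simp add: linear_map_minus[OF A.pre_cstar_algebra_axioms assms(2) f])
          also have "\<dots> \<le> nrm B (f (a m) \<ominus>\<^bsub>B\<^esub> l) + nrm B (l \<ominus>\<^bsub>B\<^esub> f (a n))"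
            using fa B.conv_in[OF l] by (intro B.nrm_minus_triangle)
          also have "nrm B (l \<ominus>\<^bsub>B\<^esub> f (a n)) = nrm B (f (a n) \<ominus>\<^bsub>B\<^esub> l)"
            using fa B.conv_in[OF l] by (intro B.nrm_minus_commute)
          also have "nrm B (f (a m) \<ominus>\<^bsub>B\<^esub> l) + nrm B (f (a n) \<ominus>\<^bsub>B\<^esub> l) < e"
            using N[OF that(1)] N[OF that(2)] a(2) by simp
          finally show ?thesis .
        qed
        then show ?thesis
          by blast
      qed
      show ?thesis
        using A.Cauchy_conv[OF a(1) cau] by blast
    qed
    then obtain x where x: "A.conv a x sequentially" ..
    have "B.conv (\<lambda>n. f (a n)) (f x) sequentially"
      by (rule conv_bounded_linear[OF A.pre_cstar_algebra_axioms assms(2) f _ x, of 1]) (simp add: iso)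
    then have "B.conv \<sigma> (f x) sequentially"
      by (simp add: a(2)[abs_def])
    then have "l = f x"
      using B.conv_unique[OF l] by simp
    then show ?thesis
      using A.conv_in[OF x] by blast
  qed
  then show ?thesis
    unfolding B.closedin_iff using linear_map_in[OF f] by blast
qed

section \<open>Completeness of the limit algebra\<close>

context ore_interaction
begin

text \<open>A Cauchy sequence of classes controls differences of representatives only from some
  index on, and this index varies along the sequence, so no single index need serve all members. The
  representatives are altered until consecutive ones are close at every index; then the limit is
  taken pointwise.\<close>

lemma lim_alg_complete: "Metric_space.mcomplete (carrier lim_alg) (ndist lim_alg)"
proof -
  interpret M: Metric_space "carrier lim_alg" "ndist lim_alg"
    by (rule lim_alg.Metric_space_ndist)
  have "\<exists>x. limitin M.mtopology \<sigma> x sequentially" if C: "M.MCauchy \<sigma>" for \<sigma>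
  proof -
    have \<sigma>: "\<sigma> n \<in> carrier lim_alg" and Cauchy: "e > 0 \<Longrightarrow> \<exists>N. \<forall>m\<ge>N. \<forall>n\<ge>N. nrm lim_alg (\<sigma> m \<ominus>\<^bsub>lim_alg\<^esub> \<sigma> n) < e" for n e
      using C unfolding lim_alg.MCauchy_iff by blast+
    have "\<forall>n. \<exists>f. net f \<and> \<sigma> n = cls f"
      using \<sigma> lim_alg_cases by metis
    then obtain f where f: "\<And>n. net (f n)" and \<sigma>f: "\<And>n. \<sigma> n = cls (f n)"
      by metis
    have "\<forall>n. \<exists>N. \<forall>k\<ge>N. \<forall>m\<ge>N. nrm lim_alg (\<sigma> k \<ominus>\<^bsub>lim_alg\<^esub> \<sigma> m) < (1/2) ^ n"
      by (intro allI Cauchy) simp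
    then obtain N where N: "\<And>n k m. \<lbrakk>k \<ge> N n; m \<ge> N n\<rbrakk> \<Longrightarrow> nrm lim_alg (\<sigma> k \<ominus>\<^bsub>lim_alg\<^esub> \<sigma> m) < (1/2) ^ n"
      by metis
    \<comment> \<open>The sum puts \<open>r n\<close> above \<open>N n\<close>, and the summand
      \<open>n\<close> makes \<open>r\<close> strictly increasing.\<close>
    define r where "r n = n + (\<Sum>i\<le>n. N i)" for n
    have r: "strict_mono r"
      by (simp add: strict_mono_Suc_iff r_def)
    have rN: "r n \<ge> N n" for n
      unfolding r_def by (rule trans_le_add2) (rule member_le_sum, auto)
    have "r (Suc n) \<ge> N n" for n
      using rN[of n] strict_mono_mono[OF r] by (meson le_SucI mono_def order.refl order.trans)
    then have small: "nrm lim_alg (\<sigma> (r (Suc n)) \<ominus>\<^bsub>lim_alg\<^esub> \<sigma> (r n)) < (1/2) ^ n" for n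
      by (intro N rN)
    \<comment> \<open>At \<open>p\<close> the next value is accepted only if it is within (1/2)^n of
      the current one. Consecutive terms are then close at every \<open>p\<close>, while
      \<open>h n\<close> agrees with \<open>f (r n)\<close> on a tail and represents the same
      class.\<close>
    define h where "h = rec_nat (f (r 0))
      (\<lambda>n hn p. if nrm A (f (r (Suc n)) p \<ominus> hn p) \<le> (1/2) ^ n then f (r (Suc n)) p else hn p)"
    have h0: "h 0 = f (r 0)"
      and hS: "h (Suc n) p = (if nrm A (f (r (Suc n)) p \<ominus> h n p) \<le> (1/2) ^ n then f (r (Suc n)) p else h n p)"
      for n p
      by (simp_all add: h_def)
    have h_in [simp]: "h n p \<in> carrier A" for n p
      by (induction n) (use f in \<open>simp_all add: h0 hS\<close>)
    have h_ev: "\<forall>\<^sub>F p in tail. f (r n) p = h n p" for n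
    proof (induction n)
      case (Suc n)
      have "nrm lim_alg (cls (\<lambda>p. f (r (Suc n)) p \<ominus> f (r n) p)) < (1/2) ^ n"
        using small[of n] f by (simp add: \<sigma>f)
      then have "\<forall>\<^sub>F p in tail. nrm A (f (r (Suc n)) p \<ominus> f (r n) p) < (1/2) ^ n"
        using f by (intro order_tendstoD(2)[OF lim_alg_nrm] net_minus)
      then show ?case
        using Suc by eventually_elim (simp add: hS)
    qed (simp add: h0)
    have h_net: "net (h n)" for n
      using f h_ev h_in by (rule net_cong)
    have "\<forall>p. \<exists>y. conv (\<lambda>n. h n p) y sequentially \<and> (\<forall>n. nrm A (h n p \<ominus> y) \<le> 2 * (1/2) ^ n)"
    proof
      fix p
      have "nrm A (h (Suc n) p \<ominus> h n p) \<le> (1/2) ^ n" for n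
        by (simp add: hS minus_eq r_neg)
      then show "\<exists>y. conv (\<lambda>n. h n p) y sequentially \<and> (\<forall>n. nrm A (h n p \<ominus> y) \<le> 2 * (1/2) ^ n)"
        using geometric_conv[of "\<lambda>n. h n p"] h_in by metis
    qed
    then obtain g where g: "\<And>p. conv (\<lambda>n. h n p) (g p) sequentially"
      and hg: "\<And>n p. nrm A (h n p \<ominus> g p) \<le> 2 * (1/2) ^ n"
      by metis
    have g_in [simp]: "g p \<in> carrier A" for p
      by (rule conv_in[OF g])
    have g_net: "net g"
      unfolding net_def
    proof (intro conjI allI impI g_in)
      fix e :: real assume e: "e > 0"
      \<comment> \<open>Both replacements of \<open>g\<close> by \<open>h n\<close> cost at most 2
        (1/2)^n < e/3; the Cauchy defect of \<open>h n\<close> takes the remaining third.\<close>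
      obtain n where n: "(1/2 :: real) ^ n < e / 6"
        using real_arch_pow_inv[of "e / 6" "1/2"] e by auto
      have e3: "e / 3 > 0"
        using e by simp
      from net_approx[OF h_net e3, of n]
      show "\<forall>\<^sub>F p in tail. \<forall>q\<in>P. nrm A (g (q \<cdot> p) \<ominus> V q (g p)) \<le> e"
      proof eventually_elim
        case (elim p)
        show ?case
        proof
          fix q assume q: "q \<in> P"
          let ?p = "q \<cdot> p"
          have "nrm A (g ?p \<ominus> V q (g p)) \<le> nrm A (g ?p \<ominus> h n ?p) + nrm A (h n ?p \<ominus> V q (g p))"
            using q by (simp add: nrm_minus_triangle)
          also have "nrm A (h n ?p \<ominus> V q (g p)) \<le> nrm A (h n ?p \<ominus> V q (h n p)) + nrm A (V q (h n p) \<ominus> V q (g p))"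
            using q by (simp add: nrm_minus_triangle)
          also have "nrm A (V q (h n p) \<ominus> V q (g p)) = nrm A (h n p \<ominus> g p)"
            using q V_isometric[OF q, of "h n p \<ominus> g p"] by (simp add: V_minus)
          also have "nrm A (g ?p \<ominus> h n ?p) = nrm A (h n ?p \<ominus> g ?p)"
            by (simp add: nrm_minus_commute)
          finally show "nrm A (g ?p \<ominus> V q (g p)) \<le> e"
            using hg[of n ?p] hg[of n p] n elim[rule_format, OF q] by linarith
        qed
      qed
    qed
    have "lim_alg.conv (\<sigma> \<circ> r) (cls g) sequentially"
    proof (rule lim_alg.conv_bound)
      show "\<forall>\<^sub>F n in sequentially. (\<sigma> \<circ> r) n \<in> carrier lim_alg"
        using \<sigma> by simp
      have "nrm lim_alg ((\<sigma> \<circ> r) n \<ominus>\<^bsub>lim_alg\<^esub> cls g) \<le> 2 * (1/2) ^ n" for n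
      proof -
        have "(\<sigma> \<circ> r) n = cls (h n)"
          using cls_eqI[OF f h_net h_ev] by (simp add: \<sigma>f)
        then show ?thesis
          using g_net h_net hg by (simp add: lim_alg_nrm_leI net_minus)
      qed
      then show "\<forall>\<^sub>F n in sequentially. nrm lim_alg ((\<sigma> \<circ> r) n \<ominus>\<^bsub>lim_alg\<^esub> cls g) \<le> 2 * (1/2) ^ n"
        by simp
      have "(\<lambda>n. 2 * (1/2 :: real) ^ n) \<longlonglongrightarrow> 2 * 0"
        by (intro tendsto_mult tendsto_const LIMSEQ_power_zero) simp
      then show "(\<lambda>n. 2 * (1/2 :: real) ^ n) \<longlonglongrightarrow> 0"
        by simp
    qed (use g_net in simp)
    then have "limitin M.mtopology (\<sigma> \<circ> r) (cls g) sequentially"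
      unfolding lim_alg.conv_iff_limitin norm_topology_def .
    then have "limitin M.mtopology \<sigma> (cls g) sequentially"
      by (rule M.MCauchy_convergent_subsequence[OF C r])
    then show ?thesis ..
  qed
  then show ?thesis
    unfolding M.mcomplete_def by blast
qed

sublocale lim_alg: unital_cstar_algebra lim_alg
proof unfold_locales
  have "nrm lim_alg \<one>\<^bsub>lim_alg\<^esub> = 1"
    unfolding lim_alg_one by (rule lim_alg_nrm_eqI[OF net_const_one]) (simp add: nrm_one)
  moreover have "nrm lim_alg \<zero>\<^bsub>lim_alg\<^esub> = 0"
    by simp
  ultimately show "\<one>\<^bsub>lim_alg\<^esub> \<noteq> \<zero>\<^bsub>lim_alg\<^esub>"
    by auto
qed (rule lim_alg_complete)

end

section \<open>The dilation\<close>

text \<open>Reduces the commutation of the expectations and the uniqueness of the factorisation to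
  elements of the form \<open>act (ginv p) (emb a)\<close>.\<close>

lemma linear_eq_on_dense:
  assumes "pre_cstar_algebra A" "pre_cstar_algebra B" and f: "linear_map A B f" and g: "linear_map A B g"
    and fle: "\<And>x. x \<in> carrier A \<Longrightarrow> nrm B (f x) \<le> nrm A x" and gle: "\<And>x. x \<in> carrier A \<Longrightarrow> nrm B (g x) \<le> nrm A x"
    and dense: "\<And>e. e > 0 \<Longrightarrow> \<exists>y\<in>carrier A. f y = g y \<and> nrm A (x \<ominus>\<^bsub>A\<^esub> y) < e"
    and x: "x \<in> carrier A"
  shows "f x = g x"
proof -
  interpret A: pre_cstar_algebra A by fact
  interpret B: pre_cstar_algebra B by fact
  note [simp] = linear_map_in[OF f] linear_map_in[OF g] x
  have "nrm B (f x \<ominus>\<^bsub>B\<^esub> g x) \<le> 0"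
  proof (rule field_le_epsilon)
    fix e :: real assume "e > 0"
    then obtain y where y: "y \<in> carrier A" "f y = g y" "nrm A (x \<ominus>\<^bsub>A\<^esub> y) < e / 2"
      using dense[of "e / 2"] by auto
    have "nrm B (f x \<ominus>\<^bsub>B\<^esub> g x) \<le> nrm B (f x \<ominus>\<^bsub>B\<^esub> f y) + nrm B (g y \<ominus>\<^bsub>B\<^esub> g x)"
      using B.nrm_minus_triangle[of "f x" "f y" "g x"] y by simp
    also have "nrm B (f x \<ominus>\<^bsub>B\<^esub> f y) \<le> nrm A (x \<ominus>\<^bsub>A\<^esub> y)"
      using fle[of "x \<ominus>\<^bsub>A\<^esub> y"] y by (simp add: linear_map_minus[OF assms(1,2) f])
    also have "nrm B (g y \<ominus>\<^bsub>B\<^esub> g x) \<le> nrm A (x \<ominus>\<^bsub>A\<^esub> y)"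
      using gle[of "x \<ominus>\<^bsub>A\<^esub> y"] y B.nrm_minus_commute[of "g y" "g x"]
      by (simp add: linear_map_minus[OF assms(1,2) g])
    finally show "nrm B (f x \<ominus>\<^bsub>B\<^esub> g x) \<le> 0 + e"
      using y(3) by simp
  qed
  then have "nrm B (f x \<ominus>\<^bsub>B\<^esub> g x) = 0"
    using B.nrm_nonneg[of "f x \<ominus>\<^bsub>B\<^esub> g x"] by simp
  then show ?thesis
    by (simp add: B.nrm_minus_eq_0)
qed

lemma linear_map_comp: "\<lbrakk>linear_map A B f; linear_map B C g\<rbrakk> \<Longrightarrow> linear_map A C (\<lambda>x. g (f x))"
  by (simp add: linear_map_def Pi_iff)

lemma linear_map_range_submodule:
  assumes "pre_cstar_algebra A" "pre_cstar_algebra B" and f: "linear_map A B f"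
  shows "submodule (f ` carrier A) complex_ring B"
proof -
  interpret A: pre_cstar_algebra A by fact
  interpret B: pre_cstar_algebra B by fact
  show ?thesis
  proof (rule B.is_submoduleI)
    show "f ` carrier A \<subseteq> carrier B"
      using linear_map_in[OF f] by blast
    show "\<zero>\<^bsub>B\<^esub> \<in> f ` carrier A"
      using linear_map_zero[OF assms] by (metis A.zero_closed imageI)
    show "x \<oplus>\<^bsub>B\<^esub> y \<in> f ` carrier A" if "x \<in> f ` carrier A" "y \<in> f ` carrier A" for x y
      using that by (force simp flip: linear_map_add[OF f])
    show "c \<odot>\<^bsub>B\<^esub> x \<in> f ` carrier A" if "x \<in> f ` carrier A" for c x
      using that by (force simp flip: linear_map_smult[OF f])
  qed
qed

context ore_interaction
begin

text \<open>The default 0 is there because \<open>net\<close> asks for values in the carrier at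
  every index, also outside the group.\<close>

definition orb :: "'a \<Rightarrow> 'g \<Rightarrow> 'a" where
  "orb a = (\<lambda>p. if p \<in> P then V p a else \<zero>)"

definition emb :: "'a \<Rightarrow> ('g \<Rightarrow> 'a) set" where
  "emb a = cls (orb a)"

text \<open>Applying \<beta>(t) to the limit of \<beta>(p^-1)(i (f p)), with p t substituted for p,
  gives the limit of \<beta>(p^-1)(i (f(p t))).\<close>

definition act :: "'g \<Rightarrow> ('g \<Rightarrow> 'a) set \<Rightarrow> ('g \<Rightarrow> 'a) set" where
  "act t X = cls (\<lambda>p. rep X (p \<cdot> t))"

definition expect :: "('g \<Rightarrow> 'a) set \<Rightarrow> ('g \<Rightarrow> 'a) set" where
  "expect X = emb (SOME x. conv (\<lambda>p. V (ginv p) (rep X p)) x tail)"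

lemma orb_P [simp]: "p \<in> P \<Longrightarrow> orb a p = V p a"
  by (simp add: orb_def)

lemma orb_in [simp]: "a \<in> carrier A \<Longrightarrow> orb a p \<in> carrier A"
  by (simp add: orb_def)

lemma net_orb [simp]: assumes a: "a \<in> carrier A" shows "net (orb a)"
  unfolding net_def
proof (intro conjI allI impI)
  fix e :: real assume e: "e > 0"
  from eventually_tail_P show "\<forall>\<^sub>F p in tail. \<forall>q\<in>P. nrm A (orb a (q \<cdot> p) \<ominus> V q (orb a p)) \<le> e"
  proof eventually_elim
    case (elim p)
    then show ?case
      using a e V_mult[OF P_in] by (simp add: minus_eq r_neg)
  qed
qed (use a in simp)

lemma emb_in [simp]: "a \<in> carrier A \<Longrightarrow> emb a \<in> carrier lim_alg"
  by (simp add: emb_def)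

section \<open>The embedding\<close>

lemma emb_isometric: "a \<in> carrier A \<Longrightarrow> nrm lim_alg (emb a) = nrm A a"
  unfolding emb_def
proof (rule lim_alg_nrm_eqI)
  assume a: "a \<in> carrier A"
  have "\<forall>\<^sub>F p in tail. nrm A a = nrm A (orb a p)"
    using eventually_tail_P by eventually_elim (use a in \<open>simp add: V_isometric\<close>)
  then show "((\<lambda>p. nrm A (orb a p)) \<longlongrightarrow> nrm A a) tail"
    using tendsto_cong by fastforce
qed simp

lemma emb_hom: "star_hom A lim_alg emb"
  unfolding star_hom_def linear_map_def
proof (intro conjI ballI allI)
  fix x assume x: "x \<in> carrier A"
  have "orb (star A x) = (\<lambda>p. star A (orb x p))"
    using x star_hom_star[OF V_hom] by (auto simp: orb_def)
  then show "emb (star A x) = star lim_alg (emb x)"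
    using x by (simp add: emb_def)
  have "orb (c \<odot> x) = (\<lambda>p. c \<odot> orb x p)" for c
    using x by (auto simp: orb_def linear_map_smult[OF V_linear])
  then show "emb (c \<odot> x) = c \<odot>\<^bsub>lim_alg\<^esub> emb x" for c
    using x by (simp add: emb_def)
  fix y assume y: "y \<in> carrier A"
  have "orb (x \<oplus> y) = (\<lambda>p. orb x p \<oplus> orb y p)"
    using x y by (auto simp: orb_def linear_map_add[OF V_linear])
  then show "emb (x \<oplus> y) = emb x \<oplus>\<^bsub>lim_alg\<^esub> emb y"
    using x y by (simp add: emb_def)
  have "orb (x \<otimes> y) = (\<lambda>p. orb x p \<otimes> orb y p)"
    using x y star_hom_mult[OF V_hom] by (auto simp: orb_def)
  then show "emb (x \<otimes> y) = emb x \<otimes>\<^bsub>lim_alg\<^esub> emb y"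
    using x y by (simp add: emb_def)
qed auto

lemmas emb_linear = star_hom_linear[OF emb_hom]

lemma emb_inj: "inj_on emb (carrier A)"
proof (rule inj_onI)
  fix x y assume xy: "x \<in> carrier A" "y \<in> carrier A" "emb x = emb y"
  have "nrm lim_alg (emb (x \<ominus> y)) = nrm lim_alg (emb x \<ominus>\<^bsub>lim_alg\<^esub> emb y)"
    using xy linear_map_minus[OF pre_cstar_algebra_axioms lim_alg_pre_cstar emb_linear] by simp
  also have "\<dots> = 0"
    using xy by (simp add: lim_alg.nrm_minus_eq_0)
  finally show "x = y"
    using xy by (simp add: emb_isometric nrm_minus_eq_0)
qed

lemma emb_one: "emb \<one> = \<one>\<^bsub>lim_alg\<^esub>"
  unfolding emb_def lim_alg_one
proof (rule cls_eqI)
  show "\<forall>\<^sub>F p in tail. orb \<one> p = \<one>"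
    using eventually_tail_P by eventually_elim simp
qed (simp_all add: net_const_one)

section \<open>The group action\<close>

lemma net_shift:
  assumes f: "net f" and t: "t \<in> carrier G" shows "net (\<lambda>p. f (p \<cdot> t))"
  unfolding net_def
proof (intro conjI allI impI)
  fix e :: real assume "e > 0"
  from eventually_compose_filterlim[OF net_approx[OF f this] filterlim_tail[OF t]] eventually_tail_P
  show "\<forall>\<^sub>F p in tail. \<forall>q\<in>P. nrm A (f (q \<cdot> p \<cdot> t) \<ominus> V q (f (p \<cdot> t))) \<le> e"
    by eventually_elim (use t in \<open>simp add: G.m_assoc\<close>)
qed (use f in simp)

lemma act_cls [simp]:
  assumes f: "net f" and t: "t \<in> carrier G" shows "act t (cls f) = cls (\<lambda>p. f (p \<cdot> t))"
proof -
  have "eqv (\<lambda>p. rep (cls f) (p \<cdot> t)) (\<lambda>p. f (p \<cdot> t))"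
    using filterlim_compose[OF rep_cls(2)[OF f, unfolded eqv_def] filterlim_tail[OF t]]
    by (simp add: eqv_def)
  then show ?thesis
    unfolding act_def using rep_cls(1)[OF f] f t by (simp add: cls_eq_iff net_shift)
qed

lemma act_in [simp]: "\<lbrakk>X \<in> carrier lim_alg; t \<in> carrier G\<rbrakk> \<Longrightarrow> act t X \<in> carrier lim_alg"
  by (auto elim!: lim_alg_cases simp: net_shift)

lemma act_id [simp]: assumes "X \<in> carrier lim_alg" shows "act \<one>\<^bsub>G\<^esub> X = X"
proof -
  obtain f where f: "net f" "X = cls f"
    using assms by (rule lim_alg_cases)
  have "\<forall>\<^sub>F p in tail. f (p \<cdot> \<one>\<^bsub>G\<^esub>) = f p"
    using eventually_tail_P by eventually_elim simp
  then show ?thesis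
    using cls_eqI[OF net_shift[OF f(1) G.one_closed] f(1)] f by simp
qed

lemma act_mult:
  assumes "X \<in> carrier lim_alg" and s: "s \<in> carrier G" and t: "t \<in> carrier G"
  shows "act (s \<cdot> t) X = act s (act t X)"
proof -
  obtain f where f: "net f" "X = cls f"
    using assms(1) by (rule lim_alg_cases)
  have "\<forall>\<^sub>F p in tail. f (p \<cdot> (s \<cdot> t)) = f (p \<cdot> s \<cdot> t)"
    using eventually_tail_P by eventually_elim (use s t in \<open>simp add: G.m_assoc\<close>)
  then show ?thesis
    using cls_eqI[OF net_shift[OF f(1), of "s \<cdot> t"] net_shift[OF net_shift[OF f(1) t] s]] f s t
    by (simp add: net_shift)
qed

lemma act_hom: assumes t: "t \<in> carrier G" shows "star_hom lim_alg lim_alg (act t)"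
  unfolding star_hom_def linear_map_def
proof (intro conjI ballI allI)
  fix X assume "X \<in> carrier lim_alg"
  then obtain f where f: "net f" and X: "X = cls f" by (rule lim_alg_cases)
  show "act t (star lim_alg X) = star lim_alg (act t X)"
    using f t by (simp add: X net_star net_shift)
  show "act t (c \<odot>\<^bsub>lim_alg\<^esub> X) = c \<odot>\<^bsub>lim_alg\<^esub> act t X" for c
    using f t by (simp add: X net_smult net_shift)
  fix Y assume "Y \<in> carrier lim_alg"
  then obtain h where h: "net h" and Y: "Y = cls h" by (rule lim_alg_cases)
  show "act t (X \<oplus>\<^bsub>lim_alg\<^esub> Y) = act t X \<oplus>\<^bsub>lim_alg\<^esub> act t Y"
    using f h t by (simp add: X Y net_add net_shift)
  show "act t (X \<otimes>\<^bsub>lim_alg\<^esub> Y) = act t X \<otimes>\<^bsub>lim_alg\<^esub> act t Y"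
    using f h t by (simp add: X Y net_mult net_shift)
qed (use t in auto)

lemmas act_linear = star_hom_linear[OF act_hom]

lemma act_contractive: "\<lbrakk>t \<in> carrier G; X \<in> carrier lim_alg\<rbrakk> \<Longrightarrow> nrm lim_alg (act t X) \<le> nrm lim_alg X"
  by (rule star_hom_contractive[OF lim_alg.unital_cstar_algebra_axioms lim_alg_pre_cstar act_hom])

lemma act_group_action: "cstar_group_action G lim_alg act"
  unfolding cstar_group_action_def
proof (intro conjI ballI)
  fix t assume t: "t \<in> carrier G"
  show "star_hom lim_alg lim_alg (act t)"
    using t by (rule act_hom)
  show "bij_betw (act t) (carrier lim_alg) (carrier lim_alg)"
  proof (rule bij_betw_byWitness[of _ "act (ginv t)"])
    show "\<forall>X\<in>carrier lim_alg. act (ginv t) (act t X) = X" "\<forall>X\<in>carrier lim_alg. act t (act (ginv t) X) = X"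
      using t by (simp_all flip: act_mult)
  qed (use t in auto)
qed (simp_all add: act_mult)

text \<open>For t in P the translate of an orbit net is again an orbit net, by
  \<open>V_mult\<close>. So the copy of A may be moved to a later stage of the limit.\<close>

lemma act_emb: assumes t: "t \<in> P" and a: "a \<in> carrier A" shows "act t (emb a) = emb (V t a)"
proof -
  have "\<forall>\<^sub>F p in tail. orb a (p \<cdot> t) = orb (V t a) p"
    using eventually_tail_P by eventually_elim (use t a V_mult[OF P_in] in simp)
  then show ?thesis
    using cls_eqI[OF net_shift[OF net_orb[OF a]] net_orb[OF V_in]] t a by (simp add: emb_def)
qed

text \<open>The net f is close to the orbit of f p started at p, once p is beyond the Cauchy
  threshold. Single elements suffice, without linear combinations, because the translated copies of
  A form a directed family.\<close>

lemma lim_alg_dense: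
  assumes "X \<in> carrier lim_alg" and e: "e > 0"
  shows "\<exists>p\<in>P. \<exists>a\<in>carrier A. nrm lim_alg (X \<ominus>\<^bsub>lim_alg\<^esub> act (ginv p) (emb a)) < e"
proof -
  obtain f where f: "net f" "X = cls f"
    using assms(1) by (rule lim_alg_cases)
  have e2: "e / 2 > 0"
    using e by simp
  from net_approx[OF f(1) e2] eventually_tail_P
  have "\<forall>\<^sub>F p in tail. p \<in> P \<and> (\<forall>q\<in>P. nrm A (f (q \<cdot> p) \<ominus> V q (f p)) \<le> e / 2)"
    by eventually_elim simp
  then obtain p where p: "p \<in> P" "\<forall>q\<in>P. nrm A (f (q \<cdot> p) \<ominus> V q (f p)) \<le> e / 2"
    using eventually_happens'[OF tail_neq_bot] by blast
  have fp: "f p \<in> carrier A"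
    using f by simp
  have "nrm lim_alg (X \<ominus>\<^bsub>lim_alg\<^esub> act (ginv p) (emb (f p))) \<le> e / 2"
  proof -
    \<comment> \<open>Writing q as q p p^-1 makes the estimate a statement about the index r = q p
      alone, hence one that holds eventually.\<close>
    have "\<forall>q\<in>P. nrm A (f (q \<cdot> p) \<ominus> orb (f p) (q \<cdot> p \<cdot> ginv p)) \<le> e / 2"
      using p by (simp add: G.m_assoc)
    then have "\<forall>\<^sub>F r in tail. nrm A (f r \<ominus> orb (f p) (r \<cdot> ginv p)) \<le> e / 2"
      unfolding eventually_tail using p(1) by blast
    then have "nrm lim_alg (cls (\<lambda>r. f r \<ominus> orb (f p) (r \<cdot> ginv p))) \<le> e / 2"
      using f(1) p(1) fp by (intro lim_alg_nrm_leI net_minus net_shift) simp_all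
    then show ?thesis
      using f p fp by (simp add: emb_def net_shift)
  qed
  then show ?thesis
    using p(1) fp e by (intro bexI[of _ p] bexI[of _ "f p"]) auto
qed

section \<open>The conditional expectation\<close>

lemma expect_cls:
  assumes f: "net f" and x: "conv (\<lambda>p. V (ginv p) (f p)) x tail"
  shows "expect (cls f) = emb x"
proof -
  let ?r = "rep (cls f)"
  note r = rep_cls[OF f]
  \<comment> \<open>Contractivity of \<open>V (ginv p)\<close> makes the limit independent of the
    representative chosen by \<open>rep\<close>.\<close>
  have c: "conv (\<lambda>p. V (ginv p) (?r p)) x tail"
  proof (rule conv_bound)
    show "x \<in> carrier A"
      using x by (rule conv_in)
    show "\<forall>\<^sub>F p in tail. V (ginv p) (?r p) \<in> carrier A"
      using eventually_tail_P by eventually_elim (use r in simp)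
    show "\<forall>\<^sub>F p in tail. nrm A (V (ginv p) (?r p) \<ominus> x) \<le> nrm A (?r p \<ominus> f p) + nrm A (V (ginv p) (f p) \<ominus> x)"
      using eventually_tail_P
    proof eventually_elim
      case (elim p)
      have "nrm A (V (ginv p) (?r p) \<ominus> x) \<le> nrm A (V (ginv p) (?r p) \<ominus> V (ginv p) (f p)) +
          nrm A (V (ginv p) (f p) \<ominus> x)"
        using elim f r(1) conv_in[OF x] by (simp add: nrm_minus_triangle)
      also have "V (ginv p) (?r p) \<ominus> V (ginv p) (f p) = V (ginv p) (?r p \<ominus> f p)"
        using elim f r(1) by (simp add: V_minus)
      also have "nrm A \<dots> \<le> nrm A (?r p \<ominus> f p)"
        using elim f r(1) by (simp add: V_inv_contractive)
      finally show ?case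
        by simp
    qed
    show "((\<lambda>p. nrm A (?r p \<ominus> f p) + nrm A (V (ginv p) (f p) \<ominus> x)) \<longlongrightarrow> 0) tail"
      using tendsto_add[OF r(2)[unfolded eqv_def], of "\<lambda>p. nrm A (V (ginv p) (f p) \<ominus> x)" 0] x
      by (simp add: conv_def)
  qed
  have "(SOME x. conv (\<lambda>p. V (ginv p) (?r p)) x tail) = x"
    by (rule some_equality, rule c) (rule conv_unique[OF _ c tail_neq_bot])
  then show ?thesis
    by (simp add: expect_def)
qed

lemma expect_ex:
  assumes "net f" obtains x where "conv (\<lambda>p. V (ginv p) (f p)) x tail"
proof -
  have lin: "linear_map A A (V (ginv p))" if "p \<in> P" for p
    using that by (simp add: V_linear)
  show ?thesis
    by (rule net_lim[where T = "\<lambda>p. V (ginv p)", OF unital_cstar_algebra_axioms lin V_inv_contractive V_inv_mult assms])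
      (assumption | rule that)+
qed

lemma expect_cases:
  assumes "X \<in> carrier lim_alg"
  obtains f x where "net f" "X = cls f" "conv (\<lambda>p. V (ginv p) (f p)) x tail" "expect X = emb x"
    "x \<in> carrier A"
proof -
  obtain f where f: "net f" "X = cls f"
    using assms by (rule lim_alg_cases)
  obtain x where x: "conv (\<lambda>p. V (ginv p) (f p)) x tail"
    using f(1) by (rule expect_ex)
  show ?thesis
    using that[OF f x] f expect_cls[OF f(1) x] conv_in[OF x] by simp
qed

lemma expect_in [simp]: "X \<in> carrier lim_alg \<Longrightarrow> expect X \<in> carrier lim_alg"
  by (rule expect_cases) auto

text \<open>The defining net is eventually constant: as soon as p t lies in P, \<open>V_mult\<close>
  gives V_(p^-1) V_(p t) = V_t.\<close>

lemma expect_act_emb: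
  assumes t: "t \<in> carrier G" and a: "a \<in> carrier A" shows "expect (act t (emb a)) = emb (V t a)"
proof -
  have "\<forall>\<^sub>F p in tail. p \<cdot> t \<in> P"
    by (rule eventually_compose_filterlim[OF eventually_tail_P filterlim_tail[OF t]])
  with eventually_tail_P have "\<forall>\<^sub>F p in tail. V t a = V (ginv p) (orb a (p \<cdot> t))"
  proof eventually_elim
    case (elim p)
    have "ginv p \<cdot> (p \<cdot> t) = (ginv p \<cdot> p) \<cdot> t"
      using elim t by (intro G.m_assoc[symmetric]) auto
    then have "ginv p \<cdot> (p \<cdot> t) = t"
      using elim t by simp
    then show ?case
      using V_mult[of "ginv p" "p \<cdot> t" a] elim a by simp
  qed
  then have "conv (\<lambda>p. V (ginv p) (orb a (p \<cdot> t))) (V t a) tail"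
    by (rule conv_cong[OF conv_const[OF V_in[OF t a]]])
  then show ?thesis
    using expect_cls[OF net_shift[OF net_orb[OF a] t]] t a by (simp add: emb_def)
qed

lemma expect_emb: "a \<in> carrier A \<Longrightarrow> expect (emb a) = emb a"
  using expect_act_emb[of "\<one>\<^bsub>G\<^esub>" a] by simp

lemma expect_linear: "linear_map lim_alg lim_alg expect"
  unfolding linear_map_def
proof (intro conjI ballI allI)
  fix X assume "X \<in> carrier lim_alg"
  then obtain f x where f: "net f" "X = cls f" and x: "conv (\<lambda>p. V (ginv p) (f p)) x tail" "expect X = emb x"
    "x \<in> carrier A"
    by (rule expect_cases)
  show "expect (c \<odot>\<^bsub>lim_alg\<^esub> X) = c \<odot>\<^bsub>lim_alg\<^esub> expect X" for c
  proof -
    have "\<forall>\<^sub>F p in tail. c \<odot> V (ginv p) (f p) = V (ginv p) (c \<odot> f p)"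
      using eventually_tail_P by eventually_elim (use f in \<open>simp add: linear_map_smult[OF V_linear]\<close>)
    from conv_cong[OF conv_smult[OF x(1)] this] show ?thesis
      using expect_cls[OF net_smult[OF f(1)], of c "c \<odot> x"] f x by (simp add: linear_map_smult[OF emb_linear])
  qed
  fix Y assume "Y \<in> carrier lim_alg"
  then obtain h y where h: "net h" "Y = cls h" and y: "conv (\<lambda>p. V (ginv p) (h p)) y tail" "expect Y = emb y"
    "y \<in> carrier A"
    by (rule expect_cases)
  show "expect (X \<oplus>\<^bsub>lim_alg\<^esub> Y) = expect X \<oplus>\<^bsub>lim_alg\<^esub> expect Y"
  proof -
    have "\<forall>\<^sub>F p in tail. V (ginv p) (f p) \<oplus> V (ginv p) (h p) = V (ginv p) (f p \<oplus> h p)"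
      using eventually_tail_P by eventually_elim (use f h in \<open>simp add: linear_map_add[OF V_linear]\<close>)
    from conv_cong[OF conv_add[OF x(1) y(1)] this] show ?thesis
      using expect_cls[OF net_add[OF f(1) h(1)], of "x \<oplus> y"] f x h y by (simp add: linear_map_add[OF emb_linear])
  qed
qed auto

lemma expect_contractive: assumes "X \<in> carrier lim_alg" shows "nrm lim_alg (expect X) \<le> nrm lim_alg X"
proof -
  obtain f x where f: "net f" "X = cls f" and x: "conv (\<lambda>p. V (ginv p) (f p)) x tail" "expect X = emb x"
    "x \<in> carrier A"
    using assms by (rule expect_cases)
  have "nrm A x \<le> nrm lim_alg (cls f)"
  proof (rule tendsto_le[OF tail_neq_bot lim_alg_nrm[OF f(1)] conv_norm[OF x(1)]])
    show "\<forall>\<^sub>F p in tail. nrm A (V (ginv p) (f p)) \<le> nrm A (f p)"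
      using eventually_tail_P by eventually_elim (use f in \<open>simp add: V_inv_contractive\<close>)
  qed
  then show ?thesis
    using f x by (simp add: emb_isometric)
qed

lemma expect_range: "expect ` carrier lim_alg = emb ` carrier A"
proof
  show "expect ` carrier lim_alg \<subseteq> emb ` carrier A"
    by (auto elim!: expect_cases)
  show "emb ` carrier A \<subseteq> expect ` carrier lim_alg"
    using expect_emb by (metis emb_in image_eqI image_subsetI)
qed

lemma expect_conditional: "conditional_expectation lim_alg expect"
  unfolding conditional_expectation_def
proof (intro conjI ballI)
  show "bounded_operator lim_alg expect"
    unfolding bounded_operator_def using expect_linear expect_contractive
    by (intro conjI exI[of _ 1]) auto
  show "operator_norm lim_alg expect = 1"
    unfolding operator_norm_def
  proof (rule cSup_eq_maximum)
    \<comment> \<open>The supremum is attained at the unit, which the expectation fixes.\<close>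
    have "nrm lim_alg (expect \<one>\<^bsub>lim_alg\<^esub>) = 1"
      using expect_emb[of \<one>] by (simp add: emb_one lim_alg.nrm_one)
    then show "1 \<in> {nrm lim_alg (expect X) |X. X \<in> carrier lim_alg \<and> nrm lim_alg X \<le> 1}"
      using lim_alg.one_closed lim_alg.nrm_one by force
  qed (use expect_contractive in force)
  show "expect (expect X) = expect X" if "X \<in> carrier lim_alg" for X
    using that by (rule expect_cases) (simp add: expect_emb)
  show "cstar_subalgebra lim_alg (expect ` carrier lim_alg)"
    unfolding expect_range cstar_subalgebra_def
  proof (intro conjI ballI)
    show "submodule (emb ` carrier A) complex_ring lim_alg"
      by (rule linear_map_range_submodule[OF pre_cstar_algebra_axioms lim_alg_pre_cstar emb_linear])
    show "closedin (norm_topology lim_alg) (emb ` carrier A)"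
      by (rule isometric_range_closed[OF unital_cstar_algebra_axioms lim_alg_pre_cstar emb_linear emb_isometric])
    show "X \<otimes>\<^bsub>lim_alg\<^esub> Y \<in> emb ` carrier A" if "X \<in> emb ` carrier A" "Y \<in> emb ` carrier A" for X Y
      using that by (force simp flip: star_hom_mult[OF emb_hom])
    show "star lim_alg X \<in> emb ` carrier A" if "X \<in> emb ` carrier A" for X
      using that by (force simp flip: star_hom_star[OF emb_hom])
  qed
qed

text \<open>Put E_g = V_g V_(g^-1). The rule \<open>shift\<close> is V_g E_h = E_(gh) V_g. Moving
  E_h to the left through V_(g^-1) and then through V_g turns it into E_(g^-1 h) and back into
  E_h.\<close>

lemma V_range_commute:
  assumes g: "g \<in> carrier G" and h: "h \<in> carrier G" and a: "a \<in> carrier A"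
  shows "V g (V (ginv g) (V h (V (ginv h) a))) = V h (V (ginv h) (V g (V (ginv g) a)))"
proof -
  have shift: "V g (V h (V (ginv h) a)) = V (g \<cdot> h) (V (ginv (g \<cdot> h)) (V g a))"
    if g: "g \<in> carrier G" and h: "h \<in> carrier G" and a: "a \<in> carrier A" for g h a
  proof -
    have e: "g \<cdot> h \<cdot> ginv h = g"
      using g h by (simp add: G.m_assoc)
    have "V (g \<cdot> h) (V (ginv (g \<cdot> h)) (V (g \<cdot> h) (V (ginv h) a))) =
        V (g \<cdot> h) (V (ginv (g \<cdot> h)) (V g a))"
      using V_left[of "g \<cdot> h" "ginv h" a] g h a e by simp
    moreover have "V (g \<cdot> h) (V (ginv (g \<cdot> h)) (V (g \<cdot> h) (V (ginv h) a))) =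
        V (g \<cdot> h) (V (ginv h) a)"
      using V_right[of "g \<cdot> h" "ginv (g \<cdot> h)" "V (ginv h) a"] g h a by simp
    ultimately show ?thesis
      using V_right[of g h a] g h a by simp
  qed
  have "V g (V (ginv g) (V h (V (ginv h) a))) =
      V g (V (ginv g \<cdot> h) (V (ginv (ginv g \<cdot> h)) (V (ginv g) a)))"
    using shift[of "ginv g" h a] g h a by simp
  also have "\<dots> = V h (V (ginv h) (V g (V (ginv g) a)))"
  proof -
    have "g \<cdot> (ginv g \<cdot> h) = (g \<cdot> ginv g) \<cdot> h"
      using g h by (intro G.m_assoc[symmetric]) auto
    then have "g \<cdot> (ginv g \<cdot> h) = h"
      using g h by simp
    then show ?thesis
      using shift[of g "ginv g \<cdot> h" "V (ginv g) a"] g h a by simp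
  qed
  finally show ?thesis .
qed

definition expect_at :: "'g \<Rightarrow> ('g \<Rightarrow> 'a) set \<Rightarrow> ('g \<Rightarrow> 'a) set" where
  "expect_at r X = act r (expect (act (ginv r) X))"

text \<open>Undoing \<beta>(r) leads to \<beta>((wr)^-1)(i a), where the expectation is V_((wr)^-1).
  The way back by \<beta>(r) = \<beta>(w^-1) \<beta>(wr) can be absorbed into A because wr lies in
  P.\<close>

lemma expect_at_emb:
  assumes w: "w \<in> P" and r: "r \<in> carrier G" and wr: "w \<cdot> r \<in> P" and a: "a \<in> carrier A"
  shows "expect_at r (act (ginv w) (emb a)) =
    act (ginv w) (emb (V (w \<cdot> r) (V (ginv (w \<cdot> r)) a)))"
proof -
  have "act (ginv r) (act (ginv w) (emb a)) = act (ginv (w \<cdot> r)) (emb a)"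
    using w r a by (simp add: G.inv_mult_group act_mult)
  then have "expect_at r (act (ginv w) (emb a)) = act r (emb (V (ginv (w \<cdot> r)) a))"
    using w r a by (simp add: expect_at_def expect_act_emb)
  also have "r = ginv w \<cdot> (w \<cdot> r)"
  proof -
    have "ginv w \<cdot> (w \<cdot> r) = (ginv w \<cdot> w) \<cdot> r"
      using w r by (intro G.m_assoc[symmetric]) auto
    then show ?thesis
      using w r by simp
  qed
  then have "act r (emb (V (ginv (w \<cdot> r)) a)) =
      act (ginv w) (act (w \<cdot> r) (emb (V (ginv (w \<cdot> r)) a)))"
    using w r a act_mult[of "emb (V (ginv (w \<cdot> r)) a)" "ginv w" "w \<cdot> r"] by simp
  also have "\<dots> = act (ginv w) (emb (V (w \<cdot> r) (V (ginv (w \<cdot> r)) a)))"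
    using w r a wr by (simp add: act_emb)
  finally show ?thesis .
qed

lemma expect_at_linear: "r \<in> carrier G \<Longrightarrow> linear_map lim_alg lim_alg (expect_at r)"
  unfolding expect_at_def
  by (intro linear_map_comp[OF _ act_linear] linear_map_comp[OF act_linear expect_linear]) auto

lemma expect_at_contractive:
  assumes "r \<in> carrier G" "X \<in> carrier lim_alg" shows "nrm lim_alg (expect_at r X) \<le> nrm lim_alg X"
proof -
  have "nrm lim_alg (expect_at r X) \<le> nrm lim_alg (expect (act (ginv r) X))"
    unfolding expect_at_def using assms by (simp add: act_contractive)
  also have "\<dots> \<le> nrm lim_alg (act (ginv r) X)"
    using assms by (simp add: expect_contractive)
  also have "\<dots> \<le> nrm lim_alg X"
    using assms by (simp add: act_contractive)
  finally show ?thesis .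
qed

text \<open>Both sides are contractions, so a dense set suffices. There \<open>expect_at_emb\<close>
  turns the claim into commutation of the maps V_g V_(g^-1) on A.\<close>

lemma expect_at_commute:
  assumes r: "r \<in> carrier G" and s: "s \<in> carrier G" and X: "X \<in> carrier lim_alg"
  shows "expect_at r (expect_at s X) = expect_at s (expect_at r X)"
proof (rule linear_eq_on_dense[where f = "\<lambda>X. expect_at r (expect_at s X)" and g = "\<lambda>X. expect_at s (expect_at r X)",
      OF lim_alg_pre_cstar lim_alg_pre_cstar])
  show "linear_map lim_alg lim_alg (\<lambda>X. expect_at r (expect_at s X))" "linear_map lim_alg lim_alg (\<lambda>X. expect_at s (expect_at r X))"
    using r s by (auto intro: linear_map_comp expect_at_linear)
  show "nrm lim_alg (expect_at r (expect_at s Y)) \<le> nrm lim_alg Y" "nrm lim_alg (expect_at s (expect_at r Y)) \<le> nrm lim_alg Y"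
    if "Y \<in> carrier lim_alg" for Y
    using r s that expect_at_contractive linear_map_in[OF expect_at_linear] by (meson order.trans)+
  fix e :: real assume "e > 0"
  then obtain x a where xa: "x \<in> P" "a \<in> carrier A" "nrm lim_alg (X \<ominus>\<^bsub>lim_alg\<^esub> act (ginv x) (emb a)) < e"
    using lim_alg_dense[OF X] by blast
  have "\<forall>\<^sub>F q in tail. q \<cdot> (x \<cdot> r) \<in> P" "\<forall>\<^sub>F q in tail. q \<cdot> (x \<cdot> s) \<in> P"
    using xa r s by (auto intro!: eventually_compose_filterlim[OF eventually_tail_P filterlim_tail])
  with eventually_tail_P have "\<forall>\<^sub>F q in tail. q \<in> P \<and> q \<cdot> x \<cdot> r \<in> P \<and> q \<cdot> x \<cdot> s \<in> P"
    by eventually_elim (use xa r s in \<open>simp add: G.m_assoc\<close>)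
  then obtain q where q: "q \<in> P" "q \<cdot> x \<cdot> r \<in> P" "q \<cdot> x \<cdot> s \<in> P"
    using eventually_happens'[OF tail_neq_bot] by blast
  \<comment> \<open>Passing from x to the later index w = q x rewrites the same element and brings
    both w r and w s into P.\<close>
  let ?w = "q \<cdot> x"
  have "act (ginv ?w) (emb (V q a)) = act (ginv x) (act (ginv q) (act q (emb a)))"
    using q(1) xa by (simp add: G.inv_mult_group act_mult act_emb)
  also have "act (ginv q) (act q (emb a)) = emb a"
    using q(1) xa by (simp flip: act_mult)
  finally have w: "act (ginv x) (emb a) = act (ginv ?w) (emb (V q a))" ..
  have "expect_at r (expect_at s (act (ginv x) (emb a))) = expect_at s (expect_at r (act (ginv x) (emb a)))"
    unfolding w using q xa r s by (simp add: expect_at_emb V_range_commute)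
  then show "\<exists>Y\<in>carrier lim_alg. expect_at r (expect_at s Y) = expect_at s (expect_at r Y) \<and> nrm lim_alg (X \<ominus>\<^bsub>lim_alg\<^esub> Y) < e"
    using xa by (intro bexI[of _ "act (ginv x) (emb a)"]) auto
qed (rule X)

lemma lim_alg_admissible: "admissible_dilation G A V emb (lim_alg, act, expect)"
proof -
  have TG: "TG_object G (lim_alg, act, expect)"
    by (simp add: lim_alg.unital_cstar_algebra_axioms act_group_action expect_conditional)
  have one: "expect \<one>\<^bsub>lim_alg\<^esub> = \<one>\<^bsub>lim_alg\<^esub>"
    using expect_emb[of \<one>] by (simp add: emb_one)
  have "expect (act t \<one>\<^bsub>lim_alg\<^esub>) = \<one>\<^bsub>lim_alg\<^esub>" if "t \<in> carrier G" for t
    using expect_act_emb[of t \<one>] that by (simp add: emb_one)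
  then show ?thesis
    using TG expect_at_commute[unfolded expect_at_def]
    by (simp add: admissible_dilation_def one emb_hom expect_act_emb)
qed

lemma lim_alg_minimal: "minimal_dilation G A V emb (lim_alg, act, expect)"
proof -
  let ?S = "{act t (emb a) |t a. t \<in> carrier G \<and> a \<in> carrier A}"
  have "X \<in> norm_topology lim_alg closure_of linear_span lim_alg ?S" if X: "X \<in> carrier lim_alg" for X
    unfolding lim_alg.closure_of_iff
  proof (intro conjI allI impI X)
    fix e :: real assume "e > 0"
    then obtain p a where pa: "p \<in> P" "a \<in> carrier A" "nrm lim_alg (X \<ominus>\<^bsub>lim_alg\<^esub> act (ginv p) (emb a)) < e"
      using lim_alg_dense[OF X] by blast
    have "act (ginv p) (emb a) \<in> ?S"
      using pa(2) G.inv_closed[OF P_in[OF pa(1)]] by blast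
    then have "act (ginv p) (emb a) \<in> linear_span lim_alg ?S"
      by (auto simp: linear_span_def)
    then show "\<exists>Y\<in>linear_span lim_alg ?S. Y \<in> carrier lim_alg \<and> nrm lim_alg (X \<ominus>\<^bsub>lim_alg\<^esub> Y) < e"
      using pa by (intro bexI[of _ "act (ginv p) (emb a)"]) auto
  qed
  moreover have "norm_topology lim_alg closure_of linear_span lim_alg ?S \<subseteq> carrier lim_alg"
    by (auto simp: lim_alg.closure_of_iff)
  ultimately have "carrier lim_alg = norm_topology lim_alg closure_of linear_span lim_alg ?S"
    by blast
  then show ?thesis
    using lim_alg_admissible by (simp add: admissible_dilation_def)
qed

end

section \<open>Universality and uniqueness\<close>

locale admissible_target = ore_interaction A G P V
  for A :: "'a star_normed" and G :: "'g monoid" and P and V :: "'g \<Rightarrow> 'a \<Rightarrow> 'a" +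
  fixes B :: "'b star_normed" and \<beta> :: "'g \<Rightarrow> 'b \<Rightarrow> 'b" and F :: "'b \<Rightarrow> 'b" and j :: "'a \<Rightarrow> 'b"
  assumes admissible: "admissible_dilation G A V j (B, \<beta>, F)"
begin

section \<open>An arbitrary admissible dilation\<close>

sublocale B: unital_cstar_algebra B
  using admissible by (simp add: admissible_dilation_def)

lemma action: "cstar_group_action G B \<beta>" and F_conditional: "conditional_expectation B F"
  and j_hom: "star_hom A B j"
  and j_V: "\<lbrakk>t \<in> carrier G; a \<in> carrier A\<rbrakk> \<Longrightarrow> j (V t a) = F (\<beta> t (j a))"
  using admissible by (simp_all add: admissible_dilation_def)

lemma \<beta>_hom: "t \<in> carrier G \<Longrightarrow> star_hom B B (\<beta> t)"
  and \<beta>_id [simp]: "x \<in> carrier B \<Longrightarrow> \<beta> \<one>\<^bsub>G\<^esub> x = x"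
  and \<beta>_mult: "\<lbrakk>s \<in> carrier G; t \<in> carrier G; x \<in> carrier B\<rbrakk> \<Longrightarrow> \<beta> (s \<cdot> t) x = \<beta> s (\<beta> t x)"
  using action by (simp_all add: cstar_group_action_def)

lemmas \<beta>_linear = star_hom_linear[OF \<beta>_hom] and j_linear = star_hom_linear[OF j_hom]

lemma \<beta>_in [simp]: "\<lbrakk>t \<in> carrier G; x \<in> carrier B\<rbrakk> \<Longrightarrow> \<beta> t x \<in> carrier B"
  by (rule linear_map_in[OF \<beta>_linear])

lemma j_in [simp]: "a \<in> carrier A \<Longrightarrow> j a \<in> carrier B"
  by (rule linear_map_in[OF j_linear])

lemma F_linear: "linear_map B B F"
  using F_conditional by (simp add: conditional_expectation_def bounded_operator_def)

lemma F_in [simp]: "x \<in> carrier B \<Longrightarrow> F x \<in> carrier B"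
  by (rule linear_map_in[OF F_linear])

lemma \<beta>_inv [simp]: "\<lbrakk>t \<in> carrier G; x \<in> carrier B\<rbrakk> \<Longrightarrow> \<beta> (ginv t) (\<beta> t x) = x"
  "\<lbrakk>t \<in> carrier G; x \<in> carrier B\<rbrakk> \<Longrightarrow> \<beta> t (\<beta> (ginv t) x) = x"
  by (simp_all flip: \<beta>_mult)

lemma \<beta>_contractive: "\<lbrakk>t \<in> carrier G; x \<in> carrier B\<rbrakk> \<Longrightarrow> nrm B (\<beta> t x) \<le> nrm B x"
  by (rule star_hom_contractive[OF B.unital_cstar_algebra_axioms B.pre_cstar_algebra_axioms \<beta>_hom])

lemma \<beta>_isometric:
  assumes "t \<in> carrier G" "x \<in> carrier B" shows "nrm B (\<beta> t x) = nrm B x"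
  using \<beta>_contractive[of t x] \<beta>_contractive[of "ginv t" "\<beta> t x"] assms by simp

lemma j_contractive: "a \<in> carrier A \<Longrightarrow> nrm B (j a) \<le> nrm A a"
  by (rule star_hom_contractive[OF unital_cstar_algebra_axioms B.pre_cstar_algebra_axioms j_hom])

text \<open>The conditional expectations \<^term>\<open>F\<close> and \<open>F\<^bsub>p\<^esub>\<^sub>-\<^sub>1\<close> commute and \<^term>\<open>j a\<close> is fixed by \<^term>\<open>F\<close> and by the
  composition of the two, hence by the second one.\<close>

lemma \<beta>_j:
  assumes p: "p \<in> P" and a: "a \<in> carrier A" shows "\<beta> p (j a) = j (V p a)"
proof -
  note [simp] = P_in[OF p]
  have Fj: "F (j a) = j a"
    using j_V[of "\<one>\<^bsub>G\<^esub>" a] a by simp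
  have "j a = F (\<beta> (ginv p) (j (V p a)))"
    using j_V[of "ginv p" "V p a"] p a by simp
  then have 1: "j a = F (\<beta> (ginv p) (F (\<beta> p (j a))))"
    using j_V[of p a] a by simp
  have "\<forall>r\<in>carrier G. \<forall>s\<in>carrier G. \<forall>x\<in>carrier B.
      \<beta> r (F (\<beta> (ginv r) (\<beta> s (F (\<beta> (ginv s) x))))) = \<beta> s (F (\<beta> (ginv s) (\<beta> r (F (\<beta> (ginv r) x)))))"
    using admissible by (simp add: admissible_dilation_def)
  \<comment> \<open>Commutation of F_r and F_s at r = 1 and s = p^-1: the first is F, the second is
    \<beta>(p^-1) F \<beta>(p).\<close>
  from this[rule_format, of "\<one>\<^bsub>G\<^esub>" "ginv p" "j a"]
  have "F (\<beta> (ginv p) (F (\<beta> p (j a)))) = \<beta> (ginv p) (F (\<beta> p (F (j a))))"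
    using a by simp
  with 1 have "j a = \<beta> (ginv p) (F (\<beta> p (j a)))"
    by (simp add: Fj)
  then have "\<beta> p (j a) = \<beta> p (\<beta> (ginv p) (F (\<beta> p (j a))))"
    by simp
  then show ?thesis
    using j_V[of p a] a by simp
qed

section \<open>The factorising homomorphism\<close>

definition approx :: "'g \<Rightarrow> 'a \<Rightarrow> 'b" where
  "approx p a = \<beta> (ginv p) (j a)"

lemma approx_linear: "p \<in> P \<Longrightarrow> linear_map A B (approx p)"
  unfolding approx_def by (rule linear_map_comp[OF j_linear \<beta>_linear]) simp

lemma approx_in [simp]: "\<lbrakk>p \<in> P; a \<in> carrier A\<rbrakk> \<Longrightarrow> approx p a \<in> carrier B"
  by (simp add: approx_def)

lemma approx_nrm: "\<lbrakk>p \<in> P; a \<in> carrier A\<rbrakk> \<Longrightarrow> nrm B (approx p a) = nrm B (j a)"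
  by (simp add: approx_def \<beta>_isometric)

lemma approx_contractive: "\<lbrakk>p \<in> P; a \<in> carrier A\<rbrakk> \<Longrightarrow> nrm B (approx p a) \<le> nrm A a"
  by (simp add: approx_nrm j_contractive)

text \<open>The compatibility required by \<open>net_lim\<close>; by \<open>\<beta>_j\<close> the
  factor V_q becomes \<beta>(q), which cancels in \<beta>((qp)^-1).\<close>

lemma approx_V: "\<lbrakk>p \<in> P; q \<in> P; a \<in> carrier A\<rbrakk> \<Longrightarrow> approx (q \<cdot> p) (V q a) = approx p a"
  unfolding approx_def using \<beta>_mult[of "ginv p" "ginv q"] by (simp add: G.inv_mult_group flip: \<beta>_j)

text \<open>The value \<open>undefined\<close> off the carrier puts the map into
  \<open>extensional\<close>, where its uniqueness is claimed.\<close>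

definition lift :: "('g \<Rightarrow> 'a) set \<Rightarrow> 'b" where
  "lift X = (if X \<in> carrier lim_alg then SOME y. B.conv (\<lambda>p. approx p (rep X p)) y tail else undefined)"

lemma lift_cls:
  assumes f: "net f" shows "B.conv (\<lambda>p. approx p (f p)) (lift (cls f)) tail"
proof -
  let ?r = "rep (cls f)"
  note r = rep_cls[OF f]
  have "\<exists>y. B.conv (\<lambda>p. approx p (?r p)) y tail"
    using net_lim[where T = approx, OF B.unital_cstar_algebra_axioms approx_linear approx_contractive approx_V r(1)]
    by blast
  then have "B.conv (\<lambda>p. approx p (?r p)) (SOME y. B.conv (\<lambda>p. approx p (?r p)) y tail) tail"
    by (rule someI_ex)
  then have c: "B.conv (\<lambda>p. approx p (?r p)) (lift (cls f)) tail"
    using f by (simp add: lift_def)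
  note [simp] = B.conv_in[OF c]
  show ?thesis
  proof (rule B.conv_bound)
    show "\<forall>\<^sub>F p in tail. approx p (f p) \<in> carrier B"
      using eventually_tail_P by eventually_elim (use f in simp)
    show "\<forall>\<^sub>F p in tail. nrm B (approx p (f p) \<ominus>\<^bsub>B\<^esub> lift (cls f)) \<le>
        nrm A (?r p \<ominus>\<^bsub>A\<^esub> f p) + nrm B (approx p (?r p) \<ominus>\<^bsub>B\<^esub> lift (cls f))"
      using eventually_tail_P
    proof eventually_elim
      case (elim p)
      have "nrm B (approx p (f p) \<ominus>\<^bsub>B\<^esub> lift (cls f)) \<le>
          nrm B (approx p (f p) \<ominus>\<^bsub>B\<^esub> approx p (?r p)) + nrm B (approx p (?r p) \<ominus>\<^bsub>B\<^esub> lift (cls f))"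
        using elim f r(1) by (simp add: B.nrm_minus_triangle)
      also have "approx p (f p) \<ominus>\<^bsub>B\<^esub> approx p (?r p) = approx p (f p \<ominus>\<^bsub>A\<^esub> ?r p)"
        using elim f r(1)
        by (simp add: linear_map_minus[OF pre_cstar_algebra_axioms B.pre_cstar_algebra_axioms approx_linear])
      also have "nrm B \<dots> \<le> nrm A (f p \<ominus>\<^bsub>A\<^esub> ?r p)"
        using elim f r(1) by (simp add: approx_contractive)
      also have "\<dots> = nrm A (?r p \<ominus>\<^bsub>A\<^esub> f p)"
        using f r(1) by (simp add: nrm_minus_commute)
      finally show ?case
        by simp
    qed
    show "((\<lambda>p. nrm A (?r p \<ominus>\<^bsub>A\<^esub> f p) + nrm B (approx p (?r p) \<ominus>\<^bsub>B\<^esub> lift (cls f))) \<longlongrightarrow> 0) tail"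
      using tendsto_add[OF r(2)[unfolded eqv_def], of "\<lambda>p. nrm B (approx p (?r p) \<ominus>\<^bsub>B\<^esub> lift (cls f))" 0] c
      by (simp add: B.conv_def)
  qed simp
qed

lemma lift_eqI:
  assumes f: "net f" and c: "B.conv (\<lambda>p. approx p (f p)) y tail" shows "lift (cls f) = y"
  by (rule B.conv_unique[OF lift_cls[OF f] c tail_neq_bot])

lemma lift_extensional: "lift \<in> extensional (carrier lim_alg)"
  by (simp add: extensional_def lift_def)

lemma lift_in [simp]: "X \<in> carrier lim_alg \<Longrightarrow> lift X \<in> carrier B"
  by (erule lim_alg_cases) (auto intro: B.conv_in[OF lift_cls])

lemma lift_hom: "star_hom lim_alg B lift"
  unfolding star_hom_def linear_map_def
proof (intro conjI ballI allI)
  fix X assume "X \<in> carrier lim_alg"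
  then obtain f where f: "net f" and X: "X = cls f" by (rule lim_alg_cases)
  have "\<forall>\<^sub>F p in tail. star B (approx p (f p)) = approx p (star A (f p))"
    using eventually_tail_P
    by eventually_elim (use f in \<open>simp add: approx_def star_hom_star[OF \<beta>_hom] star_hom_star[OF j_hom]\<close>)
  from lift_eqI[OF net_star[OF f] B.conv_cong[OF B.conv_star[OF lift_cls[OF f]] this]]
  show "lift (star lim_alg X) = star B (lift X)"
    using f by (simp add: X)
  show "lift (c \<odot>\<^bsub>lim_alg\<^esub> X) = c \<odot>\<^bsub>B\<^esub> lift X" for c
  proof -
    have "\<forall>\<^sub>F p in tail. c \<odot>\<^bsub>B\<^esub> approx p (f p) = approx p (c \<odot>\<^bsub>A\<^esub> f p)"
      using eventually_tail_P by eventually_elim (use f in \<open>simp add: linear_map_smult[OF approx_linear]\<close>)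
    from lift_eqI[OF net_smult[OF f] B.conv_cong[OF B.conv_smult[OF lift_cls[OF f]] this]]
    show ?thesis
      using f by (simp add: X)
  qed
  fix Y assume "Y \<in> carrier lim_alg"
  then obtain h where h: "net h" and Y: "Y = cls h" by (rule lim_alg_cases)
  have "\<forall>\<^sub>F p in tail. approx p (f p) \<oplus>\<^bsub>B\<^esub> approx p (h p) = approx p (f p \<oplus>\<^bsub>A\<^esub> h p)"
    using eventually_tail_P by eventually_elim (use f h in \<open>simp add: linear_map_add[OF approx_linear]\<close>)
  from lift_eqI[OF net_add[OF f h] B.conv_cong[OF B.conv_add[OF lift_cls[OF f] lift_cls[OF h]] this]]
  show "lift (X \<oplus>\<^bsub>lim_alg\<^esub> Y) = lift X \<oplus>\<^bsub>B\<^esub> lift Y"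
    using f h by (simp add: X Y)
  have "\<forall>\<^sub>F p in tail. approx p (f p) \<otimes>\<^bsub>B\<^esub> approx p (h p) = approx p (f p \<otimes>\<^bsub>A\<^esub> h p)"
    using eventually_tail_P
    by eventually_elim (use f h in \<open>simp add: approx_def star_hom_mult[OF \<beta>_hom] star_hom_mult[OF j_hom]\<close>)
  from lift_eqI[OF net_mult[OF f h] B.conv_cong[OF B.conv_mult[OF lift_cls[OF f] lift_cls[OF h]] this]]
  show "lift (X \<otimes>\<^bsub>lim_alg\<^esub> Y) = lift X \<otimes>\<^bsub>B\<^esub> lift Y"
    using f h by (simp add: X Y)
qed auto

lemma lift_emb: assumes a: "a \<in> carrier A" shows "lift (emb a) = j a"
  unfolding emb_def
proof (rule lift_eqI[OF net_orb[OF a]])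
  have "\<forall>\<^sub>F p in tail. j a = approx p (orb a p)"
    using eventually_tail_P by eventually_elim (use a in \<open>simp add: approx_def flip: \<beta>_j\<close>)
  then show "B.conv (\<lambda>p. approx p (orb a p)) (j a) tail"
    by (rule B.conv_cong[OF B.conv_const[OF j_in[OF a]]])
qed

text \<open>The limit may be taken along p t instead of p, and there \<beta>(t) cancels the factor
  \<beta>(t^-1) of \<beta>((p t)^-1).\<close>

lemma lift_act:
  assumes t: "t \<in> carrier G" and "X \<in> carrier lim_alg" shows "lift (act t X) = \<beta> t (lift X)"
proof -
  obtain f where f: "net f" and X: "X = cls f"
    using assms(2) by (rule lim_alg_cases)
  have "B.conv (\<lambda>p. \<beta> t (approx (p \<cdot> t) (f (p \<cdot> t)))) (\<beta> t (lift (cls f))) tail"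
  proof (rule conv_bounded_linear[OF B.pre_cstar_algebra_axioms B.pre_cstar_algebra_axioms \<beta>_linear[OF t]])
    show "nrm B (\<beta> t x) \<le> 1 * nrm B x" if "x \<in> carrier B" for x
      using t that by (simp add: \<beta>_contractive)
    show "B.conv (\<lambda>p. approx (p \<cdot> t) (f (p \<cdot> t))) (lift (cls f)) tail"
      by (rule B.conv_compose[OF lift_cls[OF f] filterlim_tail[OF t]])
  qed
  moreover have "\<forall>\<^sub>F p in tail. \<beta> t (approx (p \<cdot> t) (f (p \<cdot> t))) = approx p (f (p \<cdot> t))"
    using eventually_tail_P
  proof eventually_elim
    case (elim p)
    then show ?case
      using f t \<beta>_mult[of "ginv t" "ginv p"] by (simp add: approx_def G.inv_mult_group)
  qed
  ultimately have "B.conv (\<lambda>p. approx p (f (p \<cdot> t))) (\<beta> t (lift (cls f))) tail"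
    by (rule B.conv_cong)
  then have "lift (cls (\<lambda>p. f (p \<cdot> t))) = \<beta> t (lift (cls f))"
    by (rule lift_eqI[OF net_shift[OF f t]])
  then show ?thesis
    using f t by (simp add: X)
qed

text \<open>Both sides are limits of the same net: by the dilation equation F(\<beta>(p^-1)(j (f
  p))) = j(V_(p^-1)(f p)).\<close>

lemma lift_expect: assumes "X \<in> carrier lim_alg" shows "lift (expect X) = F (lift X)"
proof -
  obtain f x where f: "net f" "X = cls f" and x: "conv (\<lambda>p. V (ginv p) (f p)) x tail" "expect X = emb x"
    "x \<in> carrier A"
    using assms by (rule expect_cases)
  obtain K where K: "\<And>y. y \<in> carrier B \<Longrightarrow> nrm B (F y) \<le> K * nrm B y"
    using F_conditional by (auto simp: conditional_expectation_def bounded_operator_def)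
  have "B.conv (\<lambda>p. j (V (ginv p) (f p))) (j x) tail"
    by (rule conv_bounded_linear[OF pre_cstar_algebra_axioms B.pre_cstar_algebra_axioms j_linear _ x(1), of 1])
      (simp add: j_contractive)
  moreover have "\<forall>\<^sub>F p in tail. j (V (ginv p) (f p)) = F (approx p (f p))"
    using eventually_tail_P by eventually_elim (use f in \<open>simp add: approx_def j_V\<close>)
  ultimately have "B.conv (\<lambda>p. F (approx p (f p))) (j x) tail"
    by (rule B.conv_cong)
  moreover have "B.conv (\<lambda>p. F (approx p (f p))) (F (lift (cls f))) tail"
    by (rule conv_bounded_linear[OF B.pre_cstar_algebra_axioms B.pre_cstar_algebra_axioms F_linear K lift_cls[OF f(1)]])
  ultimately have "j x = F (lift (cls f))"
    by (rule B.conv_unique) simp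
  then show ?thesis
    using f x by (simp add: lift_emb)
qed

lemma lift_equivariant: "equivariant_hom G (lim_alg, act, expect) (B, \<beta>, F) lift"
  by (simp add: lift_hom lift_act lift_expect)

text \<open>Equivariance and the values on \<open>emb\<close> determine the map on a dense set, and
  homomorphisms are contractive.\<close>

lemma lift_unique:
  assumes \<phi>: "equivariant_hom G (lim_alg, act, expect) (B, \<beta>, F) \<phi>" and \<phi>j: "\<And>a. a \<in> carrier A \<Longrightarrow> \<phi> (emb a) = j a"
    and X: "X \<in> carrier lim_alg"
  shows "\<phi> X = lift X"
proof -
  have hom: "star_hom lim_alg B \<phi>"
    and eq: "\<And>t X. \<lbrakk>t \<in> carrier G; X \<in> carrier lim_alg\<rbrakk> \<Longrightarrow> \<phi> (act t X) = \<beta> t (\<phi> X)"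
    using \<phi> by simp_all
  show ?thesis
  proof (rule linear_eq_on_dense[OF lim_alg_pre_cstar B.pre_cstar_algebra_axioms star_hom_linear[OF hom]
        star_hom_linear[OF lift_hom] _ _ _ X])
    show "nrm B (\<phi> Y) \<le> nrm lim_alg Y" "nrm B (lift Y) \<le> nrm lim_alg Y" if "Y \<in> carrier lim_alg" for Y
      using that star_hom_contractive[OF lim_alg.unital_cstar_algebra_axioms B.pre_cstar_algebra_axioms] hom lift_hom
      by blast+
    fix e :: real assume "e > 0"
    then obtain p a where pa: "p \<in> P" "a \<in> carrier A" "nrm lim_alg (X \<ominus>\<^bsub>lim_alg\<^esub> act (ginv p) (emb a)) < e"
      using lim_alg_dense[OF X] by blast
    then show "\<exists>Y\<in>carrier lim_alg. \<phi> Y = lift Y \<and> nrm lim_alg (X \<ominus>\<^bsub>lim_alg\<^esub> Y) < e"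
      by (intro bexI[of _ "act (ginv p) (emb a)"]) (simp_all add: eq \<phi>j lift_act lift_emb)
  qed
qed

lemma lift_isometric:
  assumes inj: "inj_on j (carrier A)" and X: "X \<in> carrier lim_alg"
  shows "nrm B (lift X) = nrm lim_alg X"
proof -
  obtain f where f: "net f" "X = cls f"
    using X by (rule lim_alg_cases)
  have "\<forall>\<^sub>F p in tail. nrm B (approx p (f p)) = nrm A (f p)"
    using eventually_tail_P
    by eventually_elim (use f in \<open>simp add: approx_nrm
        star_hom_isometric[OF unital_cstar_algebra_axioms B.unital_cstar_algebra_axioms j_hom inj]\<close>)
  then have "((\<lambda>p. nrm A (f p)) \<longlongrightarrow> nrm B (lift (cls f))) tail"
    using B.conv_norm[OF lift_cls[OF f(1)]] by (rule Lim_transform_eventually[rotated])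
  then show ?thesis
    using lim_alg_nrm_eqI[OF f(1)] f(2) by simp
qed

text \<open>An isometric map has closed range; this one contains the generators that minimality
  provides.\<close>

lemma lift_surj:
  assumes inj: "inj_on j (carrier A)" and min: "minimal_dilation G A V j (B, \<beta>, F)"
  shows "lift ` carrier lim_alg = carrier B"
proof
  let ?S = "{\<beta> t (j a) |t a. t \<in> carrier G \<and> a \<in> carrier A}"
  note lin = star_hom_linear[OF lift_hom]
  show "lift ` carrier lim_alg \<subseteq> carrier B"
    by auto
  have "?S \<subseteq> lift ` carrier lim_alg"
  proof clarify
    fix t a assume ta: "t \<in> carrier G" "a \<in> carrier A"
    then have "\<beta> t (j a) = lift (act t (emb a))"
      by (simp add: lift_act lift_emb)
    then show "\<beta> t (j a) \<in> lift ` carrier lim_alg"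
      using ta by simp
  qed
  moreover have "submodule (lift ` carrier lim_alg) complex_ring B"
    by (rule linear_map_range_submodule[OF lim_alg_pre_cstar B.pre_cstar_algebra_axioms lin])
  ultimately have "linear_span B ?S \<subseteq> lift ` carrier lim_alg"
    unfolding linear_span_def by (intro Inter_lower) simp
  moreover have "closedin (norm_topology B) (lift ` carrier lim_alg)"
    by (rule isometric_range_closed[OF lim_alg.unital_cstar_algebra_axioms B.pre_cstar_algebra_axioms lin
          lift_isometric[OF inj]])
  ultimately have "norm_topology B closure_of linear_span B ?S \<subseteq> lift ` carrier lim_alg"
    by (rule closure_of_minimal)
  then show "carrier B \<subseteq> lift ` carrier lim_alg"
    using min by simp
qed

lemma lift_isomorphism:
  assumes inj: "inj_on j (carrier A)" and min: "minimal_dilation G A V j (B, \<beta>, F)"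
  shows "TG_isomorphism G (lim_alg, act, expect) (B, \<beta>, F) lift"
proof -
  note surj = lift_surj[OF inj min]
  have lift_inj: "inj_on lift (carrier lim_alg)"
  proof (rule inj_onI)
    fix X Y assume XY: "X \<in> carrier lim_alg" "Y \<in> carrier lim_alg" "lift X = lift Y"
    have "nrm lim_alg (X \<ominus>\<^bsub>lim_alg\<^esub> Y) = nrm B (lift X \<ominus>\<^bsub>B\<^esub> lift Y)"
      using XY lift_isometric[OF inj, of "X \<ominus>\<^bsub>lim_alg\<^esub> Y"]
      by (simp add: linear_map_minus[OF lim_alg_pre_cstar B.pre_cstar_algebra_axioms star_hom_linear[OF lift_hom]])
    also have "\<dots> = 0"
      using XY by (simp add: B.nrm_minus_eq_0)
    finally show "X = Y"
      using XY by (simp add: lim_alg.nrm_minus_eq_0)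
  qed
  \<comment> \<open>\<open>j\<close> is not assumed unital. The image of the unit is a unit for the
    range of \<open>lift\<close>, which is everything.\<close>
  have one: "lift \<one>\<^bsub>lim_alg\<^esub> = \<one>\<^bsub>B\<^esub>"
  proof -
    obtain X where X: "X \<in> carrier lim_alg" "lift X = \<one>\<^bsub>B\<^esub>"
      using surj by (metis B.one_closed imageE)
    have "lift \<one>\<^bsub>lim_alg\<^esub> = lift \<one>\<^bsub>lim_alg\<^esub> \<otimes>\<^bsub>B\<^esub> \<one>\<^bsub>B\<^esub>"
      by simp
    also have "\<dots> = lift \<one>\<^bsub>lim_alg\<^esub> \<otimes>\<^bsub>B\<^esub> lift X"
      by (simp only: X)
    also have "\<dots> = lift (\<one>\<^bsub>lim_alg\<^esub> \<otimes>\<^bsub>lim_alg\<^esub> X)"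
      by (rule star_hom_mult[OF lift_hom lim_alg.one_closed X(1), symmetric])
    also have "\<dots> = \<one>\<^bsub>B\<^esub>"
      using X by simp
    finally show ?thesis .
  qed
  define \<psi> where "\<psi> = inv_into (carrier lim_alg) lift"
  have \<psi>_lift [simp]: "\<psi> (lift X) = X" if "X \<in> carrier lim_alg" for X
    unfolding \<psi>_def by (rule inv_into_f_f[OF lift_inj that])
  have lift_\<psi> [simp]: "lift (\<psi> y) = y" and \<psi>_in [simp]: "\<psi> y \<in> carrier lim_alg" if "y \<in> carrier B" for y
    using that surj f_inv_into_f[of y lift "carrier lim_alg"] inv_into_into[of y lift "carrier lim_alg"]
    by (simp_all add: \<psi>_def)
  have \<psi>I: "\<psi> y = X" if "X \<in> carrier lim_alg" "lift X = y" for X y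
    using \<psi>_lift[OF that(1)] that(2) by simp
  have "star_hom B lim_alg \<psi>"
    unfolding star_hom_def linear_map_def
  proof (intro conjI ballI allI)
    fix x assume x: "x \<in> carrier B"
    show "\<psi> (star B x) = star lim_alg (\<psi> x)"
      by (rule \<psi>I) (use x in \<open>simp_all add: star_hom_star[OF lift_hom]\<close>)
    show "\<psi> (c \<odot>\<^bsub>B\<^esub> x) = c \<odot>\<^bsub>lim_alg\<^esub> \<psi> x" for c
      by (rule \<psi>I) (use x in \<open>simp_all add: linear_map_smult[OF star_hom_linear[OF lift_hom]]\<close>)
    fix y assume y: "y \<in> carrier B"
    show "\<psi> (x \<oplus>\<^bsub>B\<^esub> y) = \<psi> x \<oplus>\<^bsub>lim_alg\<^esub> \<psi> y"
      by (rule \<psi>I) (use x y in \<open>simp_all add: linear_map_add[OF star_hom_linear[OF lift_hom]]\<close>)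
    show "\<psi> (x \<otimes>\<^bsub>B\<^esub> y) = \<psi> x \<otimes>\<^bsub>lim_alg\<^esub> \<psi> y"
      by (rule \<psi>I) (use x y in \<open>simp_all add: star_hom_mult[OF lift_hom]\<close>)
  qed simp
  moreover have "\<psi> (F x) = expect (\<psi> x)" if "x \<in> carrier B" for x
    by (rule \<psi>I) (use that in \<open>simp_all add: lift_expect\<close>)
  moreover have "\<psi> (\<beta> t x) = act t (\<psi> x)" if "t \<in> carrier G" "x \<in> carrier B" for t x
    by (rule \<psi>I) (use that in \<open>simp_all add: lift_act\<close>)
  moreover have "\<psi> \<one>\<^bsub>B\<^esub> = \<one>\<^bsub>lim_alg\<^esub>"
    by (rule \<psi>I) (simp_all add: one)
  ultimately have "TG_morphism G (B, \<beta>, F) (lim_alg, act, expect) \<psi>"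
    by (simp add: TG_morphism_def)
  moreover have "TG_morphism G (lim_alg, act, expect) (B, \<beta>, F) lift"
    using lift_equivariant one by (simp add: TG_morphism_def)
  moreover have "\<forall>X\<in>carrier lim_alg. \<psi> (lift X) = X" "\<forall>y\<in>carrier B. lift (\<psi> y) = y"
    by simp_all
  ultimately show ?thesis
    unfolding TG_isomorphism_def fst_conv by blast
qed

end

section \<open>Universal property and uniqueness\<close>

context ore_interaction
begin

lemma lim_alg_universal: "universal_dilation TYPE('c) G A V emb (lim_alg, act, expect)"
  unfolding universal_dilation_def fst_conv
proof (intro allI impI)
  fix j :: "'a \<Rightarrow> 'c" and T' :: "('g, 'c) system"
  assume adm: "admissible_dilation G A V j T'"
  obtain B \<beta> F where T': "T' = (B, \<beta>, F)"
    by (rule prod_cases3)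
  interpret admissible_target A G P V B \<beta> F j
    by unfold_locales (use adm T' in simp)
  have unique: "\<phi> = lift" if "\<phi> \<in> extensional (carrier lim_alg)" "equivariant_hom G (lim_alg, act, expect) T' \<phi>"
    "\<forall>a\<in>carrier A. \<phi> (emb a) = j a" for \<phi>
  proof (rule extensionalityI[OF that(1) lift_extensional])
    show "\<phi> X = lift X" if "X \<in> carrier lim_alg" for X
      by (rule lift_unique[OF \<open>equivariant_hom G (lim_alg, act, expect) T' \<phi>\<close>[unfolded T'] bspec[OF \<open>\<forall>a\<in>carrier A. \<phi> (emb a) = j a\<close>] that])
  qed
  have ex: "equivariant_hom G (lim_alg, act, expect) T' lift" "\<forall>a\<in>carrier A. lift (emb a) = j a"
    using lift_equivariant lift_emb unfolding T' by blast+
  show "(\<exists>!\<phi>. \<phi> \<in> extensional (carrier lim_alg) \<and> equivariant_hom G (lim_alg, act, expect) T' \<phi> \<and>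
        (\<forall>a\<in>carrier A. \<phi> (emb a) = j a)) \<and>
      (j \<one> = \<one>\<^bsub>fst T'\<^esub> \<longrightarrow> (\<exists>!\<phi>. \<phi> \<in> extensional (carrier lim_alg) \<and> TG_morphism G (lim_alg, act, expect) T' \<phi> \<and>
        (\<forall>a\<in>carrier A. \<phi> (emb a) = j a)))"
  proof (intro conjI impI)
    show "\<exists>!\<phi>. \<phi> \<in> extensional (carrier lim_alg) \<and> equivariant_hom G (lim_alg, act, expect) T' \<phi> \<and>
        (\<forall>a\<in>carrier A. \<phi> (emb a) = j a)"
    proof (rule ex1I)
      show "lift \<in> extensional (carrier lim_alg) \<and> equivariant_hom G (lim_alg, act, expect) T' lift \<and>
          (\<forall>a\<in>carrier A. lift (emb a) = j a)"
        by (intro conjI lift_extensional ex)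
    qed (elim conjE, rule unique)
    assume "j \<one> = \<one>\<^bsub>fst T'\<^esub>"
    then have "TG_morphism G (lim_alg, act, expect) T' lift"
      using ex(1) lift_emb[of \<one>] by (simp add: TG_morphism_def emb_one)
    then show "\<exists>!\<phi>. \<phi> \<in> extensional (carrier lim_alg) \<and> TG_morphism G (lim_alg, act, expect) T' \<phi> \<and>
        (\<forall>a\<in>carrier A. \<phi> (emb a) = j a)"
    proof (intro ex1I[of _ lift] conjI lift_extensional ex(2))
      fix \<phi>
      assume "\<phi> \<in> extensional (carrier lim_alg) \<and> TG_morphism G (lim_alg, act, expect) T' \<phi> \<and>
        (\<forall>a\<in>carrier A. \<phi> (emb a) = j a)"
      then show "\<phi> = lift"
        unfolding TG_morphism_def by (elim conjE) (rule unique)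
    qed
  qed
qed

lemma lim_alg_unique: "unique_minimal_admissible_dilation TYPE('c) G A V emb (lim_alg, act, expect)"
  unfolding unique_minimal_admissible_dilation_def
proof (intro allI impI, elim conjE)
  fix j :: "'a \<Rightarrow> 'c" and T' :: "('g, 'c) system"
  assume min: "minimal_dilation G A V j T'" and adm: "admissible_dilation G A V j T'"
    and inj: "inj_on j (carrier A) \<or> universal_dilation TYPE(('g \<Rightarrow> 'a) set) G A V j T'"
  obtain B \<beta> F where T': "T' = (B, \<beta>, F)"
    by (rule prod_cases3)
  interpret admissible_target A G P V B \<beta> F j
    by unfold_locales (use adm T' in simp)
  have "inj_on j (carrier A)"
    using inj
  proof
    assume "universal_dilation TYPE(('g \<Rightarrow> 'a) set) G A V j T'"
    \<comment> \<open>Universality of \<open>T'\<close> is applied to the limit dilation itself. The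
      resulting factorisation of the injective \<open>emb\<close> through \<open>j\<close> makes
      \<open>j\<close> injective.\<close>
    from this[unfolded universal_dilation_def, THEN spec, THEN spec, THEN mp, OF lim_alg_admissible, THEN conjunct1]
    obtain \<phi> where \<phi>: "\<And>a. a \<in> carrier A \<Longrightarrow> \<phi> (j a) = emb a"
      by blast
    show ?thesis
    proof (rule inj_onI)
      fix x y assume xy: "x \<in> carrier A" "y \<in> carrier A" "j x = j y"
      then have "emb x = emb y"
        by (simp flip: \<phi>)
      then show "x = y"
        using emb_inj xy by (simp add: inj_on_def)
    qed
  qed
  then have "TG_isomorphism G (lim_alg, act, expect) T' lift"
    unfolding T' by (rule lift_isomorphism[OF _ min[unfolded T']])
  then show "isomorphic_dilations G A emb (lim_alg, act, expect) j T'"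
    unfolding isomorphic_dilations_def by (intro exI[of _ lift] conjI ballI lift_emb)
qed

end

theorem theorem2p4:
  fixes G :: "'g monoid" and P :: "'g set" and A :: "'a star_normed"
    and \<alpha> V :: "'g \<Rightarrow> 'a \<Rightarrow> 'a"
  assumes "ore_in_enveloping_group P G"
    and "unital_cstar_algebra A"
    and "unital_injective_semigroup_action G P A \<alpha>"
    and "interaction_group G A V"
    and "\<forall>t\<in>P. \<forall>a\<in>carrier A. V t a = \<alpha> t a"
  shows "\<exists>(i :: 'a \<Rightarrow> ('g \<Rightarrow> 'a) set) (T :: ('g, ('g \<Rightarrow> 'a) set) system).
           minimal_dilation G A V i T \<and> admissible_dilation G A V i T \<and> inj_on i (carrier A) \<and>
           universal_dilation TYPE(('g \<Rightarrow> 'a) set) G A V i T \<and>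
           universal_dilation TYPE('c) G A V i T \<and>
           unique_minimal_admissible_dilation TYPE(('g \<Rightarrow> 'a) set) G A V i T \<and>
           unique_minimal_admissible_dilation TYPE('c) G A V i T"
proof -
  interpret unital_cstar_algebra A by fact
  \<comment> \<open>\<open>V p\<close> and \<open>\<alpha> p\<close> agree only on the carrier, so
    the properties of \<open>\<alpha> p\<close> are carried over pointwise.\<close>
  have V_hom: "star_hom A A (V p)" and V_inj: "inj_on (V p) (carrier A)" if "p \<in> P" for p
  proof -
    have eq: "V p a = \<alpha> p a" if "a \<in> carrier A" for a
      using assms(5) \<open>p \<in> P\<close> that by blast
    have \<alpha>: "star_hom A A (\<alpha> p)" "inj_on (\<alpha> p) (carrier A)"
      using assms(3) \<open>p \<in> P\<close> by (auto simp: unital_injective_semigroup_action_def)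
    then show "star_hom A A (V p)"
      by (simp add: star_hom_def linear_map_def Pi_iff eq)
    show "inj_on (V p) (carrier A)"
      using \<alpha>(2) inj_on_cong[of "carrier A" "V p" "\<alpha> p"] eq by blast
  qed
  interpret ore_interaction A G P V
    by unfold_locales (fact assms V_hom V_inj)+
  show ?thesis
    by (intro exI[of _ emb] exI[of _ "(lim_alg, act, expect)"] conjI lim_alg_minimal lim_alg_admissible emb_inj
        lim_alg_universal lim_alg_unique)
qed

end
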